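(* Let $k \geq 1$ and $\alpha,\beta \in [0,1]$. Then $(\alpha,\beta) \in \mathsf{EXT}(k)$ if and only if one of the following holds: (i) $k = 1$ and $\beta \leq \alpha$; or (ii) $k \geq 2$ and either $\alpha = \beta = 0$, or $\alpha = \beta = 1$, or $\beta < \frac{k\alpha}{1+(k-1)\alpha}$.
   Context: $C$ denotes plain Kolmogorov complexity: fix an optimal (universal) partial computable machine $\mathbb{U}:\{0,1\}^*\to\{0,1\}^*$ and set $C(\sigma)=\min\{|p| : \mathbb{U}(p)=\sigma\}$. For $k \geq 1$, $\mathsf{EXT}(k)$ is the set of pairs of reals $(\alpha,\beta)$ with $\alpha,\beta\in[0,1]$ for which there exist a total one-to-one computable function $f:\mathbb{N}\to\mathbb{N}$, $k$ total computable functions $\Gamma_1,\ldots,\Gamma_k:\{0,1\}^*\to\{0,1\}^*$, and a constant $d\in\mathbb{N}$ such that for all $n$ and every string $\sigma$ with $|\sigma|=f(n)$: $|\Gamma_i(\sigma)|=n$ for all $i\le k$, and if furthermore $C(\sigma)\geq \alpha|\sigma|+d$, then for some $i$, $C(\Gamma_i(\sigma))\geq \beta|\Gamma_i(\sigma)|-d$. *)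

theory Defs
  imports Complex_Main "HOL-Library.Nat_Bijection"
begin

text \<open>
  Partial recursive functions of one argument. Functions of several arguments are
  represented through the pairing bijection \<^const>\<open>prod_encode\<close>, so that projections and
  pairing take the place of the usual arities.
\<close>

primrec rec_iter :: "(nat \<rightharpoonup> nat) \<Rightarrow> (nat \<rightharpoonup> nat) \<Rightarrow> nat \<Rightarrow> nat \<Rightarrow> nat option" where
  "rec_iter f g a 0 = f a"
| "rec_iter f g a (Suc n) =
     Option.bind (rec_iter f g a n) (\<lambda>r. g (prod_encode (a, prod_encode (n, r))))"

text \<open>A search diverges if it meets an undefined value before the first zero.\<close>

definition mu_search :: "(nat \<rightharpoonup> nat) \<Rightarrow> nat \<Rightarrow> nat option" where
  "mu_search g a =
     (if \<exists>n. g (prod_encode (a, n)) = Some 0 \<and> (\<forall>m<n. g (prod_encode (a, m)) \<noteq> None)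
      then Some (LEAST n. g (prod_encode (a, n)) = Some 0)
      else None)"

inductive partial_recursive :: "(nat \<rightharpoonup> nat) \<Rightarrow> bool" where
  zero: "partial_recursive (\<lambda>_. Some 0)"
| succ: "partial_recursive (\<lambda>x. Some (Suc x))"
| left: "partial_recursive (\<lambda>x. Some (fst (prod_decode x)))"
| right: "partial_recursive (\<lambda>x. Some (snd (prod_decode x)))"
| pair: "\<lbrakk>partial_recursive f; partial_recursive g\<rbrakk> \<Longrightarrow>
    partial_recursive
      (\<lambda>x. Option.bind (f x) (\<lambda>y. Option.bind (g x) (\<lambda>z. Some (prod_encode (y, z)))))"
| comp: "\<lbrakk>partial_recursive f; partial_recursive g\<rbrakk> \<Longrightarrow>
    partial_recursive (\<lambda>x. Option.bind (g x) f)"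
| prec: "\<lbrakk>partial_recursive f; partial_recursive g\<rbrakk> \<Longrightarrow>
    partial_recursive (\<lambda>x. rec_iter f g (fst (prod_decode x)) (snd (prod_decode x)))"
| mu: "partial_recursive g \<Longrightarrow> partial_recursive (mu_search g)"

definition computable_nat :: "(nat \<Rightarrow> nat) \<Rightarrow> bool" where
  "computable_nat f \<longleftrightarrow> partial_recursive (\<lambda>n. Some (f n))"

text \<open>Binary strings are coded by bijective base-2 numerals, least significant digit first.\<close>

type_synonym str = "bool list"

fun str_encode :: "str \<Rightarrow> nat" where
  "str_encode [] = 0"
| "str_encode (b # s) = 2 * str_encode s + (if b then 2 else 1)"

lemma str_encode_inject: "str_encode s = str_encode t \<Longrightarrow> s = t"
proof (induction s arbitrary: t)
  case Nil
  then show ?case by (cases t) (auto split: if_splits)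
next
  case (Cons b s)
  then obtain c t' where t: "t = c # t'" by (cases t) (auto split: if_splits)
  with Cons.prems have e: "2 * str_encode s + (if b then 2 else 1) =
      2 * str_encode t' + (if c then 2 else 1)" by simp
  then have bc: "b = c" by (auto split: if_splits) presburger+
  with e have "str_encode s = str_encode t'" by simp
  with Cons.IH bc t show ?case by simp
qed

lemma bij_str_encode: "bij str_encode"
proof (rule bijI)
  show "inj str_encode" by (rule injI) (rule str_encode_inject)
  have "\<exists>s. str_encode s = n" for n
  proof (induction n rule: less_induct)
    case (less n)
    show ?case
    proof (cases "n = 0")
      case True
      then have "str_encode [] = n" by simp
      then show ?thesis ..
    next
      case False
      then have "(n - 1) div 2 < n" by presburger
      then obtain s where "str_encode s = (n - 1) div 2"
        using less.IH by blast
      with False have "str_encode (even n # s) = n" by (auto elim!: evenE oddE)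
      then show ?thesis ..
    qed
  qed
  then show "surj str_encode" by (metis surjI)
qed

definition partial_computable_str :: "(str \<rightharpoonup> str) \<Rightarrow> bool" where
  "partial_computable_str F \<longleftrightarrow>
     (\<exists>g. partial_recursive g \<and> (\<forall>s. g (str_encode s) = map_option str_encode (F s)))"

definition computable_str :: "(str \<Rightarrow> str) \<Rightarrow> bool" where
  "computable_str F \<longleftrightarrow> partial_computable_str (\<lambda>s. Some (F s))"

definition optimal_machine :: "(str \<rightharpoonup> str) \<Rightarrow> bool" where
  "optimal_machine U \<longleftrightarrow> partial_computable_str U \<and>
     (\<forall>V. partial_computable_str V \<longrightarrow>
        (\<exists>c. \<forall>p s. V p = Some s \<longrightarrow> (\<exists>q. U q = Some s \<and> length q \<le> length p + c)))"

text \<open>The set of lengths is nonempty for every string when the machine is optimal.\<close>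

definition plain_complexity :: "(str \<rightharpoonup> str) \<Rightarrow> str \<Rightarrow> nat" where
  "plain_complexity U s = (LEAST l. \<exists>p. U p = Some s \<and> length p = l)"

definition EXT :: "(str \<rightharpoonup> str) \<Rightarrow> nat \<Rightarrow> (real \<times> real) set" where
  "EXT U k = {(\<alpha>, \<beta>). \<alpha> \<in> {0..1} \<and> \<beta> \<in> {0..1} \<and>
     (\<exists>(f :: nat \<Rightarrow> nat) (\<Gamma> :: nat \<Rightarrow> str \<Rightarrow> str) (d :: nat).
        inj f \<and> computable_nat f \<and> (\<forall>i\<in>{1..k}. computable_str (\<Gamma> i)) \<and>
        (\<forall>n \<sigma>. length \<sigma> = f n \<longrightarrow>
           (\<forall>i\<in>{1..k}. length (\<Gamma> i \<sigma>) = n) \<and>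
           (real (plain_complexity U \<sigma>) \<ge> \<alpha> * real (length \<sigma>) + real d \<longrightarrow>
              (\<exists>i\<in>{1..k}. real (plain_complexity U (\<Gamma> i \<sigma>))
                 \<ge> \<beta> * real (length (\<Gamma> i \<sigma>)) - real d))))}"

end

theory Submission
  imports Defs "HOL-Library.FuncSet"
begin

text \<open>
  Write \<open>N = f n\<close>. The question is how small the images of a large set of inputs can be made: the
  functions fail as soon as some set of about \<open>2 ^ (\<beta> n)\<close> outputs of length \<open>n\<close>, computable from its
  size, contains all the outputs of at least \<open>2 ^ (\<alpha> N)\<close> inputs.

  If \<open>\<alpha> N\<close> is below \<open>\<beta> n\<close>, the images of arbitrary \<open>2 ^ (\<alpha> N)\<close> inputs will do. If
  \<open>(1 - \<alpha>) N\<close> is above \<open>k (1 - \<beta>) n\<close>, choosing the most popular outputs successively for the \<open>k\<close>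
  functions will do. These ranges of \<open>N / n\<close> overlap for \<open>\<beta>\<close> above the critical value
  \<open>k \<alpha> / (1 + (k - 1) \<alpha>)\<close> and touch at it; at the common endpoint a set denser than average by any
  constant factor exists if \<open>k \<ge> 2\<close>, which excludes equality.

  Below the critical value \<open>N / n\<close> can be chosen strictly between the two ranges. A union bound then
  shows that random tables send fewer than \<open>2 ^ (\<alpha> N)\<close> inputs into any set of \<open>2 ^ (\<beta> n)\<close> outputs,
  and the first table with this property is computable. Inputs whose outputs are all of low complexity
  form a small enumerable set, hence have low complexity.
\<close>

section \<open>Closure properties of computable functions\<close>

text \<open>Keeping a fraction \<open>2 ^ (\<beta> n - n)\<close> of the values of each of
  \<open>k\<close> functions leaves about \<open>2 ^ (N - k (1 - \<beta>) n)\<close> inputs, which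
  is \<open>2 ^ (\<alpha> N)\<close> when \<open>(1 - \<alpha>) N = k (1 - \<beta>) n\<close>.
  Together with \<open>\<alpha> N = \<beta> n\<close> this gives the critical value. The union bound
  meets the same two conditions: choosing \<open>2 ^ (\<alpha> N)\<close> inputs costs about
  \<open>(1 - \<alpha>) N\<close> bits per input, choosing the outputs costs
  \<open>n 2 ^ (\<beta> n)\<close> bits in all, and each chosen input saves
  \<open>k (1 - \<beta>) n\<close> bits. Two obstacles shape the rest. The additive constant
  \<open>d\<close> of an alleged extraction must be beaten, so at the critical value, where a
  bounded window of \<open>N\<close> remains for each \<open>n\<close>, an arbitrary constant factor
  has to be gained; for one function the identity shows that there is no such gain. Moreover
  \<open>\<alpha>\<close> and \<open>\<beta>\<close> may be uncomputable, so no algorithm may refer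
  to them; extraction uses nearby rationals, for which the strict inequality leaves room.\<close>

abbreviation pfst :: "nat \<Rightarrow> nat" where "pfst z \<equiv> fst (prod_decode z)"
abbreviation psnd :: "nat \<Rightarrow> nat" where "psnd z \<equiv> snd (prod_decode z)"

definition decidable :: "(nat \<Rightarrow> bool) \<Rightarrow> bool" where
  "decidable P \<longleftrightarrow> computable_nat (\<lambda>x. of_bool (P x))"

lemma computable_nat_comp:
  assumes "computable_nat f" and "computable_nat g"
  shows "computable_nat (\<lambda>x. f (g x))"
  using partial_recursive.comp[OF assms[unfolded computable_nat_def]]
  by (simp add: computable_nat_def)

lemma computable_nat_pair:
  assumes "computable_nat f" and "computable_nat g"
  shows "computable_nat (\<lambda>x. prod_encode (f x, g x))"
  using partial_recursive.pair[OF assms[unfolded computable_nat_def]]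
  by (simp add: computable_nat_def)

lemma computable_nat_pfst:
  "computable_nat f \<Longrightarrow> computable_nat (\<lambda>x. pfst (f x))"
  by (rule computable_nat_comp[of pfst]) (simp_all add: computable_nat_def partial_recursive.left)

lemma computable_nat_psnd:
  "computable_nat f \<Longrightarrow> computable_nat (\<lambda>x. psnd (f x))"
  by (rule computable_nat_comp[of psnd]) (simp_all add: computable_nat_def partial_recursive.right)

lemma computable_nat_Suc:
  "computable_nat f \<Longrightarrow> computable_nat (\<lambda>x. Suc (f x))"
  by (rule computable_nat_comp[of Suc]) (simp_all add: computable_nat_def partial_recursive.succ)

text \<open>The base functions do not include the identity; pairing the two projections of an
  argument restores it.\<close>

lemma computable_nat_id: "computable_nat (\<lambda>x. x)"
  using computable_nat_pair[of pfst psnd]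
  by (simp add: computable_nat_def partial_recursive.left partial_recursive.right)

lemma computable_nat_const: "computable_nat (\<lambda>x. c)"
proof (induction c)
  case 0
  show ?case by (simp add: computable_nat_def partial_recursive.zero)
qed (rule computable_nat_Suc)

lemma computable_nat_comp2:
  assumes "computable_nat (\<lambda>z. h (pfst z) (psnd z))" "computable_nat f" "computable_nat g"
  shows "computable_nat (\<lambda>x. h (f x) (g x))"
  using computable_nat_comp[OF assms(1) computable_nat_pair[OF assms(2,3)]] by simp

lemma computable_nat_rec:
  assumes f: "computable_nat f"
    and g: "computable_nat (\<lambda>z. g (pfst z) (pfst (psnd z)) (psnd (psnd z)))"
    and h: "computable_nat h"
  shows "computable_nat (\<lambda>x. rec_nat (f x) (g x) (h x))"
proof -
  have "rec_iter (\<lambda>x. Some (f x)) (\<lambda>z. Some (g (pfst z) (pfst (psnd z)) (psnd (psnd z)))) a n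
      = Some (rec_nat (f a) (g a) n)" for a n
    by (induction n) simp_all
  with partial_recursive.prec[OF f[unfolded computable_nat_def] g[unfolded computable_nat_def]]
  have "computable_nat (\<lambda>z. rec_nat (f (pfst z)) (g (pfst z)) (psnd z))"
    by (simp add: computable_nat_def)
  from computable_nat_comp2[OF this computable_nat_id h] show ?thesis .
qed

lemma computable_nat_add:
  assumes "computable_nat f" "computable_nat g"
  shows "computable_nat (\<lambda>x. f x + g x)"
proof -
  have "computable_nat (\<lambda>x. rec_nat (f x) (\<lambda>_ r. Suc r) (g x))"
    by (intro computable_nat_rec computable_nat_Suc computable_nat_psnd computable_nat_id assms)
  moreover have "rec_nat a (\<lambda>_ r. Suc r) b = a + b" for a b by (induction b) simp_all
  ultimately show ?thesis by simp
qed

lemma computable_nat_pred: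
  assumes "computable_nat f" shows "computable_nat (\<lambda>x. f x - 1)"
proof -
  have "computable_nat (\<lambda>x. rec_nat 0 (\<lambda>i _. i) (f x))"
    by (intro computable_nat_rec computable_nat_const computable_nat_pfst computable_nat_psnd
        computable_nat_id assms)
  moreover have "rec_nat 0 (\<lambda>i _. i) b = b - 1" for b :: nat by (cases b) simp_all
  ultimately show ?thesis by simp
qed

lemma computable_nat_diff:
  assumes "computable_nat f" "computable_nat g"
  shows "computable_nat (\<lambda>x. f x - g x)"
proof -
  have "computable_nat (\<lambda>x. rec_nat (f x) (\<lambda>_ r. r - 1) (g x))"
    by (intro computable_nat_rec computable_nat_pred computable_nat_psnd computable_nat_id assms)
  moreover have "rec_nat a (\<lambda>_ r. r - 1) b = a - b" for a b :: nat by (induction b) simp_all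
  ultimately show ?thesis by simp
qed

lemma computable_nat_mult:
  assumes "computable_nat f" "computable_nat g"
  shows "computable_nat (\<lambda>x. f x * g x)"
proof -
  have "computable_nat (\<lambda>x. rec_nat 0 (\<lambda>_ r. r + f x) (g x))"
    by (intro computable_nat_rec computable_nat_add computable_nat_const computable_nat_psnd
        computable_nat_comp[OF assms(1)] computable_nat_pfst computable_nat_id assms)
  moreover have "rec_nat 0 (\<lambda>_ r. r + a) b = a * b" for a b :: nat by (induction b) simp_all
  ultimately show ?thesis by simp
qed

lemma computable_nat_power:
  assumes "computable_nat f" "computable_nat g"
  shows "computable_nat (\<lambda>x. f x ^ g x)"
proof -
  have "computable_nat (\<lambda>x. rec_nat 1 (\<lambda>_ r. r * f x) (g x))"
    by (intro computable_nat_rec computable_nat_mult computable_nat_const computable_nat_psnd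
        computable_nat_comp[OF assms(1)] computable_nat_pfst computable_nat_id assms)
  moreover have "rec_nat 1 (\<lambda>_ r. r * a) b = a ^ b" for a b :: nat by (induction b) simp_all
  ultimately show ?thesis by simp
qed

lemma computable_nat_sum:
  assumes h: "computable_nat (\<lambda>z. h (pfst z) (psnd z))" and f: "computable_nat f"
  shows "computable_nat (\<lambda>x. \<Sum>i<f x. h x i)"
proof -
  have "computable_nat (\<lambda>x. rec_nat 0 (\<lambda>i r. r + h x i) (f x))"
    by (intro computable_nat_rec computable_nat_add computable_nat_const computable_nat_psnd
        computable_nat_comp2[OF h] computable_nat_pfst computable_nat_id f)
  moreover have "rec_nat 0 (\<lambda>i r. r + q i) b = sum q {..<b}" for q :: "nat \<Rightarrow> nat" and b
    by (induction b) simp_all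
  ultimately show ?thesis by simp
qed

section \<open>Decidable predicates, bounded quantifiers and search\<close>

lemma decidable_le:
  assumes "computable_nat f" "computable_nat g"
  shows "decidable (\<lambda>x. f x \<le> g x)"
proof -
  have "computable_nat (\<lambda>x. 1 - (f x - g x))"
    by (intro computable_nat_diff computable_nat_const assms)
  moreover have "1 - (f x - g x) = of_bool (f x \<le> g x)" for x by auto
  ultimately show ?thesis by (simp add: decidable_def)
qed

lemma decidable_not:
  assumes "decidable P" shows "decidable (\<lambda>x. \<not> P x)"
proof -
  have "computable_nat (\<lambda>x. 1 - of_bool (P x))"
    by (intro computable_nat_diff computable_nat_const assms[unfolded decidable_def])
  moreover have "1 - of_bool (P x) = (of_bool (\<not> P x) :: nat)" for x by auto
  ultimately show ?thesis by (simp only: decidable_def)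
qed

lemma decidable_conj:
  assumes "decidable P" "decidable Q" shows "decidable (\<lambda>x. P x \<and> Q x)"
  using computable_nat_mult[OF assms[unfolded decidable_def]]
  by (simp only: decidable_def of_bool_conj)

lemma decidable_disj:
  assumes "decidable P" "decidable Q" shows "decidable (\<lambda>x. P x \<or> Q x)"
  using decidable_not[OF decidable_conj[OF assms[THEN decidable_not]]] by simp

lemma decidable_imp:
  assumes "decidable P" "decidable Q" shows "decidable (\<lambda>x. P x \<longrightarrow> Q x)"
  using decidable_disj[OF decidable_not[OF assms(1)] assms(2)] by (simp only: imp_conv_disj)

lemma decidable_less:
  assumes "computable_nat f" "computable_nat g"
  shows "decidable (\<lambda>x. f x < g x)"
  using decidable_not[OF decidable_le[OF assms(2,1)]] by (simp add: not_le)

lemma decidable_eq: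
  assumes "computable_nat f" "computable_nat g"
  shows "decidable (\<lambda>x. f x = g x)"
  using decidable_conj[OF decidable_le[OF assms] decidable_le[OF assms(2,1)]]
  by (simp add: eq_iff)

lemma decidable_const: "decidable (\<lambda>x. b)"
  by (simp add: decidable_def computable_nat_const)

lemma computable_nat_if:
  assumes "decidable P" "computable_nat f" "computable_nat g"
  shows "computable_nat (\<lambda>x. if P x then f x else g x)"
proof -
  have "computable_nat (\<lambda>x. of_bool (P x) * f x + of_bool (\<not> P x) * g x)"
    using assms(1) decidable_not[OF assms(1)]
    by (intro computable_nat_add computable_nat_mult assms(2,3)) (simp_all only: decidable_def)
  moreover have "of_bool (P x) * f x + of_bool (\<not> P x) * g x = (if P x then f x else g x)" for x
    by simp
  ultimately show ?thesis by (simp only:)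
qed

lemma computable_nat_of_bool:
  "decidable P \<Longrightarrow> computable_nat (\<lambda>x. of_bool (P x))"
  by (simp add: decidable_def)

lemma decidable_comp:
  "decidable P \<Longrightarrow> computable_nat f \<Longrightarrow> decidable (\<lambda>x. P (f x))"
  unfolding decidable_def by (rule computable_nat_comp)

lemma decidable_comp2:
  assumes "decidable (\<lambda>z. P (pfst z) (psnd z))" "computable_nat f" "computable_nat g"
  shows "decidable (\<lambda>x. P (f x) (g x))"
  using decidable_comp[OF assms(1) computable_nat_pair[OF assms(2,3)]] by simp

lemma decidable_comp3:
  assumes "decidable (\<lambda>z. P (pfst z) (pfst (psnd z)) (psnd (psnd z)))"
    and "computable_nat f" "computable_nat g" "computable_nat h"
  shows "decidable (\<lambda>x. P (f x) (g x) (h x))"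
  using decidable_comp[OF assms(1)
      computable_nat_pair[OF assms(2) computable_nat_pair[OF assms(3,4)]]] by simp

text \<open>Counting serves as the only bounded search: a bounded quantifier compares such a count
  with \<open>0\<close>, and a quotient counts the positive multiples of the divisor that
  fit.\<close>

lemma computable_nat_card:
  assumes "decidable (\<lambda>z. P (pfst z) (psnd z))" "computable_nat f"
  shows "computable_nat (\<lambda>x. card {i. i < f x \<and> P x i})"
proof -
  have "computable_nat (\<lambda>x. \<Sum>i<f x. of_bool (P x i))"
    by (intro computable_nat_sum assms(2) computable_nat_of_bool assms(1))
  moreover have "(\<Sum>i<n. of_bool (Q i)) = card {i. i < n \<and> Q i}" for Q and n :: nat
    using sum.inter_filter[of "{..<n}" "\<lambda>_. 1::nat" Q]
    by (simp add: of_bool_def)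
  ultimately show ?thesis by simp
qed

lemma decidable_ex_less:
  assumes "decidable (\<lambda>z. P (pfst z) (psnd z))" "computable_nat f"
  shows "decidable (\<lambda>x. \<exists>i<f x. P x i)"
proof -
  have "decidable (\<lambda>x. 0 < card {i. i < f x \<and> P x i})"
    by (intro decidable_less computable_nat_const computable_nat_card assms)
  moreover have "0 < card {i. i < f x \<and> P x i} \<longleftrightarrow> (\<exists>i<f x. P x i)" for x
    by (subst card_gt_0_iff) auto
  ultimately show ?thesis by simp
qed

lemma decidable_all_less:
  assumes "decidable (\<lambda>z. P (pfst z) (psnd z))" "computable_nat f"
  shows "decidable (\<lambda>x. \<forall>i<f x. P x i)"
  using decidable_not[OF decidable_ex_less[OF decidable_not[OF assms(1)] assms(2)]] by simp

lemma decidable_ball: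
  assumes "finite I" "\<And>i. i \<in> I \<Longrightarrow> decidable (P i)"
  shows "decidable (\<lambda>x. \<forall>i\<in>I. P i x)"
  using assms by (induction) (simp_all add: decidable_const decidable_conj)

text \<open>The test function is total with values \<open>0\<close> and \<open>1\<close>, so the
  definedness condition of \<open>mu_search\<close> always holds and the search becomes
  \<open>LEAST\<close>.\<close>

lemma partial_recursive_search:
  assumes "decidable (\<lambda>z. P (pfst z) (psnd z))"
  shows "partial_recursive (\<lambda>x. if \<exists>y. P x y then Some (LEAST y. P x y) else None)"
proof -
  let ?g = "\<lambda>z. if P (pfst z) (psnd z) then 0 else 1 :: nat"
  have "computable_nat ?g" by (intro computable_nat_if computable_nat_const assms)
  then have "partial_recursive (mu_search (\<lambda>z. Some (?g z)))"
    by (simp add: computable_nat_def partial_recursive.mu)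
  moreover have "mu_search (\<lambda>z. Some (?g z)) =
      (\<lambda>x. if \<exists>y. P x y then Some (LEAST y. P x y) else None)"
    by (simp add: mu_search_def fun_eq_iff)
  ultimately show ?thesis by (simp only:)
qed

lemma computable_nat_Least:
  assumes "decidable (\<lambda>z. P (pfst z) (psnd z))" "\<And>x. \<exists>y. P x y"
  shows "computable_nat (\<lambda>x. LEAST y. P x y)"
  using partial_recursive_search[OF assms(1)] assms(2) by (simp add: computable_nat_def)

lemma computable_nat_div:
  assumes "computable_nat f" "computable_nat g"
  shows "computable_nat (\<lambda>x. f x div g x)"
proof -
  have "computable_nat (\<lambda>x. card {i. i < f x \<and> 0 < g x \<and> Suc i * g x \<le> f x})"
    by (intro computable_nat_card decidable_conj decidable_less decidable_le computable_nat_mult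
        computable_nat_Suc computable_nat_const computable_nat_pfst computable_nat_psnd
        computable_nat_id assms computable_nat_comp[OF assms(1)] computable_nat_comp[OF assms(2)])
  moreover have "card {i. i < a \<and> 0 < b \<and> Suc i * b \<le> a} = a div b" for a b :: nat
  proof (cases "b = 0")
    case False
    then have "Suc i * b \<le> a \<longleftrightarrow> i < a div b" for i
      by (simp only: less_eq_div_iff_mult_less_eq[symmetric] Suc_le_eq neq0_conv)
    moreover have "i < a" if "i < a div b" for i
      using that div_le_dividend[of a b] by linarith
    ultimately have "{i. i < a \<and> 0 < b \<and> Suc i * b \<le> a} = {..<a div b}"
      using False by blast
    then show ?thesis by simp
  qed simp
  ultimately show ?thesis by simp
qed

lemma computable_nat_mod:
  assumes "computable_nat f" "computable_nat g"
  shows "computable_nat (\<lambda>x. f x mod g x)"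
  using computable_nat_diff[OF assms(1) computable_nat_mult[OF computable_nat_div[OF assms] assms(2)]]
  by (simp add: minus_div_mult_eq_mod)

lemma decidable_odd:
  "computable_nat f \<Longrightarrow> decidable (\<lambda>x. odd (f x))"
  using decidable_eq[OF computable_nat_mod[of f "\<lambda>_. 2"] computable_nat_const[of 1]]
  by (simp add: odd_iff_mod_2_eq_one computable_nat_const)

lemmas computable_intros =
  computable_nat_const computable_nat_id computable_nat_pfst computable_nat_psnd
  computable_nat_pair computable_nat_Suc computable_nat_add computable_nat_diff
  computable_nat_mult computable_nat_power computable_nat_div computable_nat_mod
  computable_nat_card computable_nat_if
  decidable_const decidable_le decidable_less decidable_eq decidable_not decidable_conj
  decidable_disj decidable_imp decidable_ex_less decidable_all_less decidable_odd

section \<open>Digits, sets and strings as numbers\<close>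

definition digit :: "nat \<Rightarrow> nat \<Rightarrow> nat \<Rightarrow> nat" where
  "digit B z i = z div B ^ i mod B"

lemma computable_nat_digit:
  "computable_nat B \<Longrightarrow> computable_nat z \<Longrightarrow> computable_nat i \<Longrightarrow>
   computable_nat (\<lambda>x. digit (B x) (z x) (i x))"
  unfolding digit_def by (intro computable_intros)

lemma ex_digits:
  assumes "\<And>i. i < n \<Longrightarrow> r i < B"
  shows "\<exists>z<B ^ n. \<forall>i<n. digit B z i = r i"
  using assms
proof (induction n arbitrary: r)
  case 0
  then show ?case by simp
next
  case (Suc n)
  obtain z where z: "z < B ^ n" "\<forall>i<n. digit B z i = r (Suc i)"
    using Suc.IH[of "\<lambda>i. r (Suc i)"] Suc.prems by auto
  have r0: "r 0 < B" using Suc.prems by simp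
  have "digit B (r 0 + B * z) i = r i" if "i < Suc n" for i
  proof (cases i)
    case 0
    then show ?thesis using r0 by (simp add: digit_def)
  next
    case (Suc j)
    have "(r 0 + B * z) div B = z" using r0 by simp
    then have "digit B (r 0 + B * z) i = digit B z j"
      using Suc by (simp add: digit_def div_mult2_eq)
    then show ?thesis using z that Suc by simp
  qed
  moreover have "r 0 + B * z < B ^ Suc n"
  proof -
    have "r 0 + B * z < B * Suc z" using r0 by simp
    also have "\<dots> \<le> B * B ^ n" using z(1) by (intro mult_left_mono) auto
    finally show ?thesis by simp
  qed
  ultimately show ?case by blast
qed

text \<open>A finite sequence is coded by a pair consisting of a base and a number in that base.\<close>

definition entry :: "nat \<Rightarrow> nat \<Rightarrow> nat" where
  "entry w i = digit (pfst w) (psnd w) i"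

lemma computable_nat_entry:
  "computable_nat w \<Longrightarrow> computable_nat i \<Longrightarrow> computable_nat (\<lambda>x. entry (w x) (i x))"
  unfolding entry_def by (intro computable_nat_digit computable_intros)

lemma ex_entries: "\<exists>w. \<forall>i<n. entry w i = r i"
proof -
  have "r i < Suc (Max (r ` {..<n}))" if "i < n" for i
    using that by (simp add: less_Suc_eq_le)
  from ex_digits[of n r, OF this] obtain z where "\<forall>i<n. digit (Suc (Max (r ` {..<n}))) z i = r i"
    by blast
  then show ?thesis
    by (intro exI[of _ "prod_encode (Suc (Max (r ` {..<n})), z)"]) (simp add: entry_def)
qed

definition bits :: "nat \<Rightarrow> nat set" where
  "bits z = {i. odd (z div 2 ^ i)}"

lemma decidable_mem_bits:
  "computable_nat f \<Longrightarrow> computable_nat g \<Longrightarrow> decidable (\<lambda>x. f x \<in> bits (g x))"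
  unfolding bits_def mem_Collect_eq by (intro computable_intros)

text \<open>The bound \<open>2 ^ n\<close> turns quantification over all subsets of
  \<open>{..<n}\<close> into a bounded, hence decidable, quantification over codes. Bits from
  position \<open>n\<close> on are left open.\<close>

lemma ex_bits:
  assumes "A \<subseteq> {..<n}"
  shows "\<exists>z<2 ^ n. \<forall>i<n. i \<in> bits z \<longleftrightarrow> i \<in> A"
proof -
  have of_bool_less: "of_bool b < (2::nat)" for b by simp
  obtain z where "z < 2 ^ n" "\<forall>i<n. digit 2 z i = of_bool (i \<in> A)"
    using ex_digits[of n "\<lambda>i. of_bool (i \<in> A)" 2] of_bool_less by blast
  moreover have "i \<in> bits z \<longleftrightarrow> digit 2 z i = 1" for i
    by (simp only: bits_def digit_def odd_iff_mod_2_eq_one mem_Collect_eq)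
  ultimately show ?thesis by (intro exI[of _ z]) simp
qed

definition str_decode :: "nat \<Rightarrow> str" where
  "str_decode = inv str_encode"

lemma str_decode_encode [simp]: "str_decode (str_encode s) = s"
  by (simp add: str_decode_def bij_str_encode bij_is_inj)

lemma str_encode_decode [simp]: "str_encode (str_decode x) = x"
  by (simp add: str_decode_def bij_str_encode bij_is_surj surj_f_inv_f)

text \<open>In bijective base 2 the strings of length \<open>l\<close> have as codes the
  \<open>x\<close> with \<open>2 ^ l \<le> x + 1 < 2 ^ (l + 1)\<close>: a block of
  \<open>2 ^ l\<close> consecutive numbers starting at \<open>2 ^ l - 1\<close>.\<close>

definition slen :: "nat \<Rightarrow> nat" where
  "slen x = (LEAST l. x + 1 < 2 ^ Suc l)"

lemma str_encode_bounds:
  "2 ^ length s \<le> str_encode s + 1 \<and> str_encode s + 1 < 2 ^ Suc (length s)"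
  by (induction s) auto

lemma slen_eq: "2 ^ l \<le> x + 1 \<Longrightarrow> x + 1 < 2 ^ Suc l \<Longrightarrow> slen x = l"
  unfolding slen_def
proof (rule Least_equality)
  fix y assume "2 ^ l \<le> x + 1" "x + 1 < 2 ^ Suc y"
  then have "(2::nat) ^ l < 2 ^ Suc y" by linarith
  then have "l < Suc y" by (rule power_less_imp_less_exp[rotated]) simp
  then show "l \<le> y" by simp
qed

lemma slen_str_encode [simp]: "slen (str_encode s) = length s"
  using str_encode_bounds by (intro slen_eq) auto

lemma length_str_decode [simp]: "length (str_decode x) = slen x"
  by (metis slen_str_encode str_encode_decode)

lemma slen_bounds: "2 ^ slen x \<le> x + 1" "x + 1 < 2 ^ Suc (slen x)"
  using str_encode_bounds[of "str_decode x"] by auto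

lemma computable_nat_slen:
  assumes "computable_nat f" shows "computable_nat (\<lambda>x. slen (f x))"
proof -
  have "computable_nat slen"
    unfolding slen_def
    by (intro computable_nat_Least computable_intros)
      (metis less_exp Suc_eq_plus1)
  then show ?thesis using assms by (rule computable_nat_comp)
qed

lemma computable_str_iff:
  "computable_str F \<longleftrightarrow> computable_nat (\<lambda>x. str_encode (F (str_decode x)))"
proof
  assume "computable_str F"
  then obtain g where g: "partial_recursive g" "\<And>s. g (str_encode s) = Some (str_encode (F s))"
    by (auto simp: computable_str_def partial_computable_str_def)
  have "g x = Some (str_encode (F (str_decode x)))" for x
    using g(2)[of "str_decode x"] by simp
  then have "g = (\<lambda>x. Some (str_encode (F (str_decode x))))" by blast
  with g(1) show "computable_nat (\<lambda>x. str_encode (F (str_decode x)))"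
    by (simp add: computable_nat_def)
next
  assume "computable_nat (\<lambda>x. str_encode (F (str_decode x)))"
  then show "computable_str F"
    unfolding computable_str_def partial_computable_str_def computable_nat_def
    by (intro exI[of _ "\<lambda>x. Some (str_encode (F (str_decode x)))"]) simp
qed

section \<open>Graphs of partial recursive functions\<close>

lemma rec_iter_eq_Some_iff:
  "rec_iter f g a n = Some y \<longleftrightarrow>
    (\<exists>r. f a = Some (r 0) \<and> (\<forall>i<n. g (prod_encode (a, prod_encode (i, r i))) = Some (r (Suc i)))
       \<and> r n = y)"
proof (induction n arbitrary: y)
  case 0
  then show ?case by auto
next
  case (Suc n)
  show ?case
  proof
    assume "rec_iter f g a (Suc n) = Some y"
    then obtain r' where "rec_iter f g a n = Some r'" and
      y: "g (prod_encode (a, prod_encode (n, r'))) = Some y"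
      by (auto simp: bind_eq_Some_conv)
    then obtain r where "f a = Some (r 0)" "r n = r'"
      "\<forall>i<n. g (prod_encode (a, prod_encode (i, r i))) = Some (r (Suc i))"
      using Suc.IH by blast
    then show "\<exists>r. f a = Some (r 0) \<and>
        (\<forall>i<Suc n. g (prod_encode (a, prod_encode (i, r i))) = Some (r (Suc i))) \<and> r (Suc n) = y"
      using y by (intro exI[of _ "r(Suc n := y)"]) (auto simp: less_Suc_eq)
  next
    assume "\<exists>r. f a = Some (r 0) \<and>
        (\<forall>i<Suc n. g (prod_encode (a, prod_encode (i, r i))) = Some (r (Suc i))) \<and> r (Suc n) = y"
    then obtain r where r: "f a = Some (r 0)" "r (Suc n) = y"
        "\<forall>i<Suc n. g (prod_encode (a, prod_encode (i, r i))) = Some (r (Suc i))"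
      by blast
    then have "rec_iter f g a n = Some (r n)" using Suc.IH[of "r n"] by auto
    then show "rec_iter f g a (Suc n) = Some y" using r by auto
  qed
qed

text \<open>Replaces \<open>LEAST\<close> by conditions on finitely many arguments, each of which
  can be certified separately.\<close>

lemma mu_search_eq_Some_iff:
  "mu_search g a = Some n \<longleftrightarrow>
    g (prod_encode (a, n)) = Some 0 \<and> (\<forall>m<n. \<exists>v. g (prod_encode (a, m)) = Some (Suc v))"
  (is "?L \<longleftrightarrow> ?R")
proof
  assume ?L
  then obtain n' where n': "g (prod_encode (a, n')) = Some 0" "\<forall>m<n'. g (prod_encode (a, m)) \<noteq> None"
    and n: "n = (LEAST n. g (prod_encode (a, n)) = Some 0)"
    by (auto simp: mu_search_def split: if_splits)
  have 1: "g (prod_encode (a, n)) = Some 0" unfolding n by (rule LeastI) (rule n'(1))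
  have 2: "n \<le> n'" unfolding n by (rule Least_le) (rule n'(1))
  have "\<exists>v. g (prod_encode (a, m)) = Some (Suc v)" if "m < n" for m
  proof -
    have "g (prod_encode (a, m)) \<noteq> Some 0" using that not_less_Least unfolding n by blast
    moreover have "m < n'" using 2 that by simp
    then have "g (prod_encode (a, m)) \<noteq> None" using n'(2) by blast
    then obtain u where "g (prod_encode (a, m)) = Some u" by blast
    ultimately show ?thesis by (cases u) auto
  qed
  with 1 show ?R by blast
next
  assume R: ?R
  have "(LEAST n. g (prod_encode (a, n)) = Some 0) = n"
  proof (rule Least_equality)
    fix y assume "g (prod_encode (a, y)) = Some 0"
    then show "n \<le> y" using R by (metis leI nat.distinct(1) option.inject)
  qed (use R in blast)
  moreover have "\<forall>m<n. g (prod_encode (a, m)) \<noteq> None" using R by fastforce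
  ultimately show ?L using R by (auto simp: mu_search_def)
qed

text \<open>A weak Kleene normal form: the witness \<open>s\<close> packs intermediate values
  together with witnesses for them, so no step counting is needed. Applied to the optimal machine it
  makes low complexity semi-decidable.\<close>

lemma partial_recursive_graph:
  assumes "partial_recursive g"
  shows "\<exists>R. decidable (\<lambda>z. R (pfst z) (pfst (psnd z)) (psnd (psnd z))) \<and>
    (\<forall>x y. g x = Some y \<longleftrightarrow> (\<exists>s. R x y s))"
  using assms
proof induction
  case zero
  show ?case
    by (intro exI[of _ "\<lambda>x y s. y = 0"] conjI computable_intros) auto
next
  case succ
  show ?case
    by (intro exI[of _ "\<lambda>x y s. y = Suc x"] conjI computable_intros) auto
next
  case left
  show ?case
    by (intro exI[of _ "\<lambda>x y s. y = pfst x"] conjI computable_intros) auto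
next
  case right
  show ?case
    by (intro exI[of _ "\<lambda>x y s. y = psnd x"] conjI computable_intros) auto
next
  case (pair f g)
  then obtain F G where F: "decidable (\<lambda>z. F (pfst z) (pfst (psnd z)) (psnd (psnd z)))"
      "\<And>x y. f x = Some y \<longleftrightarrow> (\<exists>s. F x y s)"
    and G: "decidable (\<lambda>z. G (pfst z) (pfst (psnd z)) (psnd (psnd z)))"
      "\<And>x y. g x = Some y \<longleftrightarrow> (\<exists>s. G x y s)" by auto
  show ?case
  proof (intro exI[of _ "\<lambda>x y s. F x (pfst y) (pfst s) \<and> G x (psnd y) (psnd s)"] conjI allI)
    show "decidable (\<lambda>z. F (pfst z) (pfst (pfst (psnd z))) (pfst (psnd (psnd z))) \<and>
             G (pfst z) (psnd (pfst (psnd z))) (psnd (psnd (psnd z))))"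
      by (intro decidable_comp3[OF F(1)] decidable_comp3[OF G(1)] computable_intros)
    fix x y
    have "(Option.bind (f x) (\<lambda>y. Option.bind (g x) (\<lambda>z. Some (prod_encode (y, z)))) = Some y) \<longleftrightarrow>
      f x = Some (pfst y) \<and> g x = Some (psnd y)"
      by (auto simp: bind_eq_Some_conv)
    also have "\<dots> \<longleftrightarrow> (\<exists>s. F x (pfst y) (pfst s) \<and> G x (psnd y) (psnd s))"
      unfolding F(2) G(2) by (metis fst_conv snd_conv prod_encode_inverse)
    finally show "(Option.bind (f x) (\<lambda>y. Option.bind (g x) (\<lambda>z. Some (prod_encode (y, z)))) = Some y)
      \<longleftrightarrow> (\<exists>s. F x (pfst y) (pfst s) \<and> G x (psnd y) (psnd s))" .
  qed
next
  case (comp f g)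
  then obtain F G where F: "decidable (\<lambda>z. F (pfst z) (pfst (psnd z)) (psnd (psnd z)))"
      "\<And>x y. f x = Some y \<longleftrightarrow> (\<exists>s. F x y s)"
    and G: "decidable (\<lambda>z. G (pfst z) (pfst (psnd z)) (psnd (psnd z)))"
      "\<And>x y. g x = Some y \<longleftrightarrow> (\<exists>s. G x y s)" by auto
  show ?case
  proof (intro exI[of _ "\<lambda>x y s. G x (pfst s) (pfst (psnd s)) \<and> F (pfst s) y (psnd (psnd s))"]
      conjI allI)
    show "decidable (\<lambda>z. G (pfst z) (pfst (psnd (psnd z))) (pfst (psnd (psnd (psnd z)))) \<and>
             F (pfst (psnd (psnd z))) (pfst (psnd z)) (psnd (psnd (psnd (psnd z)))))"
      by (intro decidable_comp3[OF F(1)] decidable_comp3[OF G(1)] computable_intros)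
    fix x y
    have "Option.bind (g x) f = Some y \<longleftrightarrow> (\<exists>u s t. G x u s \<and> F u y t)"
      by (auto simp: bind_eq_Some_conv F(2) G(2))
    also have "\<dots> \<longleftrightarrow> (\<exists>s. G x (pfst s) (pfst (psnd s)) \<and> F (pfst s) y (psnd (psnd s)))"
      by (metis fst_conv snd_conv prod_encode_inverse)
    finally show "Option.bind (g x) f = Some y \<longleftrightarrow>
      (\<exists>s. G x (pfst s) (pfst (psnd s)) \<and> F (pfst s) y (psnd (psnd s)))" .
  qed
next
  case (prec f g)
  then obtain F G where F: "decidable (\<lambda>z. F (pfst z) (pfst (psnd z)) (psnd (psnd z)))"
      "\<And>x y. f x = Some y \<longleftrightarrow> (\<exists>s. F x y s)"
    and G: "decidable (\<lambda>z. G (pfst z) (pfst (psnd z)) (psnd (psnd z)))"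
      "\<And>x y. g x = Some y \<longleftrightarrow> (\<exists>s. G x y s)" by auto
  \<comment> \<open>\<open>pfst s\<close> codes the successive values of the recursion,
    \<open>psnd s\<close> the witnesses: entry \<open>0\<close> for the base value, entry
    \<open>Suc i\<close> for step \<open>i\<close>.\<close>
  define R where "R x y s \<longleftrightarrow> F (pfst x) (entry (pfst s) 0) (entry (psnd s) 0) \<and>
    (\<forall>i<psnd x. G (prod_encode (pfst x, prod_encode (i, entry (pfst s) i)))
       (entry (pfst s) (Suc i)) (entry (psnd s) (Suc i))) \<and> entry (pfst s) (psnd x) = y" for x y s
  show ?case
  proof (intro exI[of _ R] conjI allI)
    show "decidable (\<lambda>z. R (pfst z) (pfst (psnd z)) (psnd (psnd z)))"
      unfolding R_def
      by (intro decidable_comp3[OF F(1)] decidable_comp3[OF G(1)] computable_nat_entry computable_intros)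
    fix x y
    show "rec_iter f g (pfst x) (psnd x) = Some y \<longleftrightarrow> (\<exists>s. R x y s)"
    proof
      assume "rec_iter f g (pfst x) (psnd x) = Some y"
      then obtain r where r: "f (pfst x) = Some (r 0)" "r (psnd x) = y"
        "\<forall>i<psnd x. g (prod_encode (pfst x, prod_encode (i, r i))) = Some (r (Suc i))"
        unfolding rec_iter_eq_Some_iff by blast
      obtain v0 where v0: "F (pfst x) (r 0) v0" using r(1) F(2) by blast
      have "\<forall>i. \<exists>v. i < psnd x \<longrightarrow> G (prod_encode (pfst x, prod_encode (i, r i))) (r (Suc i)) v"
        using r(3) G(2) by blast
      from choice[OF this] obtain v
        where v: "\<forall>i<psnd x. G (prod_encode (pfst x, prod_encode (i, r i))) (r (Suc i)) (v i)"
        by blast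
      obtain w1 where w1: "\<forall>i<Suc (psnd x). entry w1 i = r i" using ex_entries by blast
      obtain w2 where w2: "\<forall>i<Suc (psnd x). entry w2 i = case_nat v0 v i" using ex_entries by blast
      have "R x y (prod_encode (w1, w2))"
        unfolding R_def using v0 v w1 w2 r(2) by auto
      then show "\<exists>s. R x y s" ..
    next
      assume "\<exists>s. R x y s"
      then show "rec_iter f g (pfst x) (psnd x) = Some y"
        unfolding rec_iter_eq_Some_iff R_def F(2) G(2) by blast
    qed
  qed
next
  case (mu g)
  then obtain G where G: "decidable (\<lambda>z. G (pfst z) (pfst (psnd z)) (psnd (psnd z)))"
      "\<And>x y. g x = Some y \<longleftrightarrow> (\<exists>s. G x y s)" by auto
  \<comment> \<open>\<open>pfst s\<close> certifies the zero at \<open>y\<close>; the other two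
    parts list, for each earlier argument, the predecessor of its value and a witness.\<close>
  define R where "R x y s \<longleftrightarrow> G (prod_encode (x, y)) 0 (pfst s) \<and>
    (\<forall>i<y. G (prod_encode (x, i)) (Suc (entry (pfst (psnd s)) i)) (entry (psnd (psnd s)) i))" for x y s
  show ?case
  proof (intro exI[of _ R] conjI allI)
    show "decidable (\<lambda>z. R (pfst z) (pfst (psnd z)) (psnd (psnd z)))"
      unfolding R_def
      by (intro decidable_comp3[OF G(1)] computable_nat_entry computable_intros)
    fix x y
    show "mu_search g x = Some y \<longleftrightarrow> (\<exists>s. R x y s)"
    proof
      assume "mu_search g x = Some y"
      then have 0: "g (prod_encode (x, y)) = Some 0"
        and 1: "\<forall>m<y. \<exists>v. g (prod_encode (x, m)) = Some (Suc v)"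
        unfolding mu_search_eq_Some_iff by auto
      from 0 obtain s0 where s0: "G (prod_encode (x, y)) 0 s0" using G(2) by blast
      have "\<forall>m. \<exists>vs. m < y \<longrightarrow> G (prod_encode (x, m)) (Suc (fst vs)) (snd vs)"
        using 1 unfolding G(2) by auto
      from choice[OF this] obtain vs
        where vs: "\<forall>m<y. G (prod_encode (x, m)) (Suc (fst (vs m))) (snd (vs m))"
        by blast
      obtain w1 where w1: "\<forall>i<y. entry w1 i = fst (vs i)"
        using ex_entries[of y "\<lambda>i. fst (vs i)"] by blast
      obtain w2 where w2: "\<forall>i<y. entry w2 i = snd (vs i)"
        using ex_entries[of y "\<lambda>i. snd (vs i)"] by blast
      have "R x y (prod_encode (s0, prod_encode (w1, w2)))"
        unfolding R_def using s0 vs w1 w2 by auto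
      then show "\<exists>s. R x y s" ..
    next
      assume "\<exists>s. R x y s"
      then show "mu_search g x = Some y"
        unfolding mu_search_eq_Some_iff R_def G(2) by blast
    qed
  qed
qed

section \<open>Plain complexity\<close>

lemma plain_complexity_le:
  assumes "U p = Some s" shows "plain_complexity U s \<le> length p"
  unfolding plain_complexity_def using assms by (intro Least_le) blast

lemma optimal_machine_program:
  assumes "optimal_machine U"
  obtains p where "U p = Some s" "length p = plain_complexity U s"
proof -
  have "partial_computable_str (\<lambda>s. Some s)"
    unfolding partial_computable_str_def
    using computable_nat_id by (intro exI[of _ Some]) (simp add: computable_nat_def)
  then obtain q where "U q = Some s"
    using assms unfolding optimal_machine_def by blast
  then have "\<exists>p. U p = Some s \<and> length p = plain_complexity U s"
    unfolding plain_complexity_def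
    using LeastI_ex[of "\<lambda>l. \<exists>p. U p = Some s \<and> length p = l"] by blast
  then show ?thesis using that by blast
qed

lemma card_strings_shorter: "finite {p :: str. length p < b} \<and> card {p :: str. length p < b} < 2 ^ b"
proof -
  have "str_encode p < 2 ^ b - 1" if "length p < b" for p
  proof -
    have "(2::nat) ^ Suc (length p) \<le> 2 ^ b" using that by (intro power_increasing) auto
    then show ?thesis using str_encode_bounds[of p] by linarith
  qed
  then have sub: "str_encode ` {p :: str. length p < b} \<subseteq> {..<2 ^ b - 1}" by auto
  have inj: "inj_on str_encode A" for A
    using bij_is_inj[OF bij_str_encode] by (rule inj_on_subset) simp
  have "finite {p :: str. length p < b}"
    using finite_imageD[OF finite_subset[OF sub] inj] by simp
  moreover have "card {p :: str. length p < b} \<le> 2 ^ b - 1"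
    using card_mono[OF _ sub] card_image[OF inj, of "{p. length p < b}"] by simp
  ultimately show ?thesis by (simp add: Suc_le_lessD Suc_diff_1 le_imp_less_Suc order.strict_trans1)
qed

lemma card_low_complexity:
  assumes "optimal_machine U"
  shows "finite {s. plain_complexity U s < b}" "card {s. plain_complexity U s < b} < 2 ^ b"
proof -
  have "{s. plain_complexity U s < b} \<subseteq> (\<lambda>p. the (U p)) ` {p. length p < b}"
  proof
    fix s assume "s \<in> {s. plain_complexity U s < b}"
    moreover obtain p where "U p = Some s" "length p = plain_complexity U s"
      using optimal_machine_program[OF assms] .
    ultimately show "s \<in> (\<lambda>p. the (U p)) ` {p. length p < b}"
      by (intro image_eqI[of _ _ p]) auto
  qed
  then show "finite {s. plain_complexity U s < b}" "card {s. plain_complexity U s < b} < 2 ^ b"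
    using card_strings_shorter[of b]
    by (auto intro: finite_subset order.strict_trans1[OF surj_card_le])
qed

text \<open>A member of a recursively enumerable set with at most \<open>2 ^ m\<close> elements is determined by its
  position in the enumeration, written with exactly \<open>m\<close> bits, so that \<open>m\<close> itself comes for free.\<close>

lemma plain_complexity_enumerable:
  assumes U: "optimal_machine U"
    and Q: "decidable (\<lambda>z. Q (pfst z) (pfst (psnd z)) (psnd (psnd z)))"
  obtains c where "\<And>m x s. finite {x. \<exists>s. Q m x s} \<Longrightarrow> card {x. \<exists>s. Q m x s} \<le> 2 ^ m \<Longrightarrow> Q m x s \<Longrightarrow>
    plain_complexity U (str_decode x) \<le> m + c"
proof -
  \<comment> \<open>Of all witness pairs for one element only the least is kept, so that each
    element is enumerated once.\<close>
  define New where "New m w \<longleftrightarrow> Q m (pfst w) (psnd w) \<and>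
    (\<forall>w'<w. pfst w' = pfst w \<longrightarrow> \<not> Q m (pfst w') (psnd w'))" for m w
  have New: "decidable (\<lambda>z. New (pfst z) (psnd z))"
    unfolding New_def by (intro decidable_comp3[OF Q] computable_intros)
  \<comment> \<open>A program coded by \<open>p\<close> is read twice: its length is the index
    \<open>m\<close>, and its rank \<open>p + 1 - 2 ^ m\<close> among the strings of that length is
    the position in the enumeration.\<close>
  define P where "P p w \<longleftrightarrow> New (slen p) w \<and>
    card {w'. w' < w \<and> New (slen p) w'} = p + 1 - 2 ^ slen p" for p w
  have P: "decidable (\<lambda>z. P (pfst z) (psnd z))"
    unfolding P_def by (intro decidable_comp2[OF New] computable_nat_slen computable_intros)
  have unique: "w = w'" if "P p w" "P p w'" for p w w'
  proof -
    have False if "P p v" "P p v'" "v < v'" for v v'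
    proof -
      have "{u. u < v \<and> New (slen p) u} \<subset> {u. u < v' \<and> New (slen p) u}"
        using that unfolding P_def by auto
      then have "card {u. u < v \<and> New (slen p) u} < card {u. u < v' \<and> New (slen p) u}"
        by (intro psubset_card_mono) auto
      then show False using that unfolding P_def by simp
    qed
    then show ?thesis using that by (metis linorder_neqE_nat)
  qed
  define V where "V p = Option.bind (if \<exists>w. P p w then Some (LEAST w. P p w) else None)
    (\<lambda>w. Some (pfst w))" for p
  have "partial_recursive V"
    unfolding V_def by (intro partial_recursive.comp partial_recursive.left partial_recursive_search P)
  have V: "V p = Some (pfst w)" if "P p w" for p w
  proof -
    have "(LEAST w. P p w) = w" by (metis LeastI that unique)
    then show ?thesis using that by (auto simp: V_def)
  qed
  have "partial_computable_str (\<lambda>s. map_option str_decode (V (str_encode s)))"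
    unfolding partial_computable_str_def
    by (intro exI[of _ V] conjI \<open>partial_recursive V\<close>) (simp add: option.map_comp o_def option.map_ident)
  then obtain c where c: "\<And>p s. map_option str_decode (V (str_encode p)) = Some s \<Longrightarrow>
      \<exists>q. U q = Some s \<and> length q \<le> length p + c"
    using U unfolding optimal_machine_def by blast
  have "plain_complexity U (str_decode x) \<le> m + c"
    if fin: "finite {x. \<exists>s. Q m x s}" and card: "card {x. \<exists>s. Q m x s} \<le> 2 ^ m" and Qx: "Q m x s"
    for m x s
  proof -
    define w where "w = (LEAST w. pfst w = x \<and> Q m (pfst w) (psnd w))"
    have w: "pfst w = x \<and> Q m (pfst w) (psnd w)"
      unfolding w_def by (rule LeastI[of _ "prod_encode (x, s)"]) (use Qx in simp)
    have "\<not> (pfst w' = x \<and> Q m (pfst w') (psnd w'))" if "w' < w" for w'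
      using not_less_Least that unfolding w_def by blast
    with w have Neww: "New m w" unfolding New_def by blast
    define j where "j = card {w'. w' < w \<and> New m w'}"
    have "inj_on pfst {w'. w' \<le> w \<and> New m w'}"
    proof (rule inj_onI)
      fix u v assume "u \<in> {w'. w' \<le> w \<and> New m w'}" "v \<in> {w'. w' \<le> w \<and> New m w'}" "pfst u = pfst v"
      then show "u = v" unfolding New_def by (metis (mono_tags, lifting) mem_Collect_eq linorder_neqE_nat)
    qed
    moreover have "pfst ` {w'. w' \<le> w \<and> New m w'} \<subseteq> {x. \<exists>s. Q m x s}"
      unfolding New_def by blast
    ultimately have "card {w'. w' \<le> w \<and> New m w'} \<le> 2 ^ m"
      using card card_inj_on_le[OF _ _ fin] order.trans by blast
    moreover have "{w'. w' \<le> w \<and> New m w'} = insert w {w'. w' < w \<and> New m w'}"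
      using Neww by (auto simp: le_less)
    ultimately have j: "j < 2 ^ m" unfolding j_def by simp
    define p where "p = j + 2 ^ m - 1"
    have p: "p + 1 = j + 2 ^ m" unfolding p_def by simp
    have "slen p = m" using j p by (intro slen_eq) auto
    then have "P p w" unfolding P_def using Neww p by (simp add: j_def)
    from V[OF this] w have "map_option str_decode (V (str_encode (str_decode p))) = Some (str_decode x)"
      by simp
    from c[OF this] obtain q where "U q = Some (str_decode x)" "length q \<le> m + c"
      using \<open>slen p = m\<close> by auto
    then show ?thesis using plain_complexity_le[of U q] by fastforce
  qed
  then show ?thesis using that by blast
qed

section \<open>Hitting sets and dense subfamilies\<close>

text \<open>By double counting, some point lies in at least a fraction \<open>L / card Y\<close> of
  the neighbourhoods not yet met. Adding it to \<open>B\<close> multiplies their number by at most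
  \<open>1 - L / card Y\<close>.\<close>

lemma greedy_hitting_set:
  fixes L :: real
  assumes "finite W" "finite Y" "Y \<noteq> {}" "0 \<le> L"
    and N: "\<And>w. w \<in> W \<Longrightarrow> N w \<subseteq> Y \<and> L \<le> card (N w)"
  shows "\<exists>B\<subseteq>Y. card B \<le> m \<and>
    real (card {w \<in> W. N w \<inter> B = {}}) \<le> (1 - L / card Y) ^ m * card W"
proof (cases "W = {}")
  case True
  then show ?thesis by (intro exI[of _ "{}"]) auto
next
  case False
  have M: "card Y > 0" using assms by (simp add: card_gt_0_iff)
  obtain w0 where "w0 \<in> W" using False by blast
  then have "L \<le> card Y" using N[of w0] card_mono[OF \<open>finite Y\<close>, of "N w0"] by linarith
  then have q: "0 \<le> 1 - L / card Y" using M by (simp add: divide_le_eq_1)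
  show ?thesis
  proof (induction m)
    case 0
    then show ?case by (intro exI[of _ "{}"]) auto
  next
    case (Suc m)
    then obtain B where B: "B \<subseteq> Y" "card B \<le> m"
      "real (card {w \<in> W. N w \<inter> B = {}}) \<le> (1 - L / card Y) ^ m * card W" by blast
    define W' where "W' = {w \<in> W. N w \<inter> B = {}}"
    have finW': "finite W'" unfolding W'_def using \<open>finite W\<close> by simp
    have "\<exists>y\<in>Y. L * card W' / card Y \<le> card {w \<in> W'. y \<in> N w}"
    proof (rule ccontr)
      assume "\<not> ?thesis"
      then have "(\<Sum>y\<in>Y. real (card {w \<in> W'. y \<in> N w})) < (\<Sum>y\<in>Y. L * card W' / card Y)"
        using assms by (intro sum_strict_mono) auto
      also have "\<dots> = L * card W'" using M by simp
      also have "\<dots> = (\<Sum>w\<in>W'. L)" by simp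
      also have "\<dots> \<le> (\<Sum>w\<in>W'. real (card {y \<in> Y. y \<in> N w}))"
      proof (rule sum_mono)
        fix w assume "w \<in> W'"
        then have "w \<in> W" unfolding W'_def by simp
        moreover have "{y \<in> Y. y \<in> N w} = N w" using N[OF \<open>w \<in> W\<close>] by blast
        ultimately show "L \<le> card {y \<in> Y. y \<in> N w}" using N by simp
      qed
      also have "\<dots> = (\<Sum>y\<in>Y. real (card {w \<in> W'. y \<in> N w}))"
        unfolding of_nat_sum[symmetric]
        by (subst sum_multicount_gen[OF finW' \<open>finite Y\<close>]) auto
      finally show False by simp
    qed
    then obtain y where y: "y \<in> Y" "L * card W' / card Y \<le> card {w \<in> W'. y \<in> N w}" by blast
    have "{w \<in> W. N w \<inter> insert y B = {}} = W' - {w \<in> W'. y \<in> N w}"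
      unfolding W'_def by auto
    then have "real (card {w \<in> W. N w \<inter> insert y B = {}})
        = card W' - real (card {w \<in> W'. y \<in> N w})"
      using card_Diff_subset[of "{w \<in> W'. y \<in> N w}" W'] finW'
        card_mono[OF finW', of "{w \<in> W'. y \<in> N w}"] by (simp add: of_nat_diff)
    also have "\<dots> \<le> (1 - L / card Y) * card W'" using y(2) by (simp add: algebra_simps)
    also have "\<dots> \<le> (1 - L / card Y) * ((1 - L / card Y) ^ m * card W)"
      using B(3) q unfolding W'_def by (intro mult_left_mono)
    finally have "real (card {w \<in> W. N w \<inter> insert y B = {}}) \<le> (1 - L / card Y) ^ Suc m * card W"
      by (simp add: mult.assoc)
    moreover have "card (insert y B) \<le> Suc m"
      using B(2) finite_subset[OF B(1) \<open>finite Y\<close>] by (simp add: card_insert_if)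
    ultimately show ?case using B(1) y(1) by (intro exI[of _ "insert y B"]) auto
  qed
qed

text \<open>Put \<open>q = L / card Y\<close>. Since
  \<open>(1 - q) ^ m * (1 + q) ^ m \<le> 1\<close>, Bernoulli's inequality bounds the fraction
  missed by \<open>m\<close> greedy choices by \<open>1 / (1 + m q)\<close>, which is at most
  \<open>1 - c\<close> when \<open>m q \<ge> 2 c\<close> and \<open>c \<le> 1 / 2\<close>.\<close>

lemma hitting_set:
  fixes L c :: real
  assumes "finite W" "finite Y" "Y \<noteq> {}" "0 \<le> L"
    and N: "\<And>w. w \<in> W \<Longrightarrow> N w \<subseteq> Y \<and> L \<le> card (N w)"
    and c: "0 \<le> c" "c \<le> 1 / 2" "2 * c * card Y \<le> m * L"
  shows "\<exists>B\<subseteq>Y. card B \<le> m \<and> c * card W \<le> card {w \<in> W. N w \<inter> B \<noteq> {}}"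
proof (cases "W = {}")
  case True
  then show ?thesis by (intro exI[of _ "{}"]) auto
next
  case False
  have "\<exists>B\<subseteq>Y. card B \<le> m \<and>
      real (card {w \<in> W. N w \<inter> B = {}}) \<le> (1 - L / card Y) ^ m * card W"
    by (rule greedy_hitting_set[OF assms(1-4) N])
  then obtain B where B: "B \<subseteq> Y" "card B \<le> m"
      "real (card {w \<in> W. N w \<inter> B = {}}) \<le> (1 - L / card Y) ^ m * card W" by blast
  have M: "real (card Y) > 0" using assms by (simp add: card_gt_0_iff)
  define q where "q = L / card Y"
  have q0: "0 \<le> q" unfolding q_def using assms by simp
  obtain w0 where "w0 \<in> W" using False by blast
  then have "L \<le> card Y" using N[of w0] card_mono[OF \<open>finite Y\<close>, of "N w0"] by linarith
  then have q1: "q \<le> 1" unfolding q_def using M by (simp add: divide_le_eq_1)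
  have mq: "2 * c \<le> m * q" using c(3) M by (simp add: q_def field_simps)
  have "(1 - q) ^ m * (1 + m * q) \<le> (1 - q) ^ m * (1 + q) ^ m"
    using q0 q1 by (intro mult_left_mono Bernoulli_inequality) auto
  also have "\<dots> = (1 - q * q) ^ m" by (simp add: power_mult_distrib[symmetric] algebra_simps)
  also have "\<dots> \<le> 1" using q0 q1 by (intro power_le_one) (auto simp: mult_le_one)
  finally have p1: "(1 - q) ^ m * (1 + m * q) \<le> 1" .
  have mq0: "0 \<le> m * q" using q0 by simp
  have "c * (1 + m * q) \<le> m * q"
  proof -
    have "c * (m * q) \<le> 1 / 2 * (m * q)" using c(2) mq0 by (rule mult_right_mono)
    then show ?thesis using mq by (simp add: algebra_simps)
  qed
  then have "(1 - q) ^ m * (1 + m * q) \<le> (1 - c) * (1 + m * q)"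
    using p1 by (simp add: algebra_simps)
  then have "(1 - q) ^ m \<le> 1 - c" using mq0 by (simp add: mult_le_cancel_right)
  then have "real (card {w \<in> W. N w \<inter> B = {}}) \<le> (1 - c) * card W"
    using B(3) mult_right_mono[of "(1 - q) ^ m" "1 - c" "real (card W)"] unfolding q_def by linarith
  moreover have "card W = card {w \<in> W. N w \<inter> B = {}} + card {w \<in> W. N w \<inter> B \<noteq> {}}"
    by (subst card_Un_disjoint[symmetric]) (auto intro!: arg_cong[of _ _ card] simp: \<open>finite W\<close>)
  ultimately show ?thesis using B(1,2) by (intro exI[of _ B]) (auto simp: algebra_simps)
qed

text \<open>Each round adds at most \<open>m\<close> points and provides a new point for a
  proportion \<open>c\<close> of the neighbourhoods met exactly \<open>j\<close> times so far.
  Points already met do not count again; there are at most \<open>t\<close> of them, whence the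
  bound \<open>L + t\<close>.\<close>

lemma iterated_hitting_set:
  fixes L c :: real
  assumes "finite W" "finite Y" "Y \<noteq> {}" "0 \<le> L"
    and N: "\<And>w. w \<in> W \<Longrightarrow> N w \<subseteq> Y \<and> L + t \<le> card (N w)"
    and c: "0 \<le> c" "c \<le> 1 / 2" "2 * c * card Y \<le> m * L"
    and "j \<le> t"
  shows "\<exists>B\<subseteq>Y. card B \<le> j * m \<and> c ^ j * card W \<le> card {w \<in> W. j \<le> card (N w \<inter> B)}"
  using \<open>j \<le> t\<close>
proof (induction j)
  case 0
  then show ?case by (intro exI[of _ "{}"]) auto
next
  case (Suc j)
  then obtain B where B: "B \<subseteq> Y" "card B \<le> j * m"
      "c ^ j * card W \<le> card {w \<in> W. j \<le> card (N w \<inter> B)}" by auto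
  have finB: "finite B" using B(1) \<open>finite Y\<close> finite_subset by blast
  define W1 where "W1 = {w \<in> W. j \<le> card (N w \<inter> B)}"
  define W2 where "W2 = {w \<in> W. card (N w \<inter> B) = j}"
  define W3 where "W3 = {w \<in> W. Suc j \<le> card (N w \<inter> B)}"
  have fin: "finite W2" "finite W3" unfolding W2_def W3_def using \<open>finite W\<close> by auto
  have "N w - B \<subseteq> Y \<and> L \<le> card (N w - B)" if "w \<in> W2" for w
  proof -
    have w: "w \<in> W" "card (N w \<inter> B) = j" using that unfolding W2_def by auto
    have fw: "finite (N w)" using N[OF w(1)] \<open>finite Y\<close> finite_subset by blast
    have "card (N w) = card (N w \<inter> B) + card (N w - B)"
      using fw by (subst card_Un_disjoint[symmetric]) (auto intro!: arg_cong[of _ _ card])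
    then show ?thesis using N[OF w(1)] w(2) Suc.prems by auto
  qed
  then have "\<exists>B'\<subseteq>Y. card B' \<le> m \<and> c * card W2 \<le> card {w \<in> W2. (N w - B) \<inter> B' \<noteq> {}}"
    by (rule hitting_set[OF fin(1) assms(2-4) _ c])
  then obtain B' where B': "B' \<subseteq> Y" "card B' \<le> m"
    "c * card W2 \<le> card {w \<in> W2. (N w - B) \<inter> B' \<noteq> {}}" by blast
  define W4 where "W4 = {w \<in> W2. (N w - B) \<inter> B' \<noteq> {}}"
  have finB': "finite B'" using B'(1) \<open>finite Y\<close> finite_subset by blast
  have "W1 = W2 \<union> W3" "W2 \<inter> W3 = {}" unfolding W1_def W2_def W3_def by auto
  then have W1: "card W1 = card W2 + card W3" using fin by (simp add: card_Un_disjoint)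
  have "W3 \<union> W4 \<subseteq> {w \<in> W. Suc j \<le> card (N w \<inter> (B \<union> B'))}"
  proof
    fix w assume "w \<in> W3 \<union> W4"
    then show "w \<in> {w \<in> W. Suc j \<le> card (N w \<inter> (B \<union> B'))}"
    proof
      assume "w \<in> W3"
      moreover have "card (N w \<inter> B) \<le> card (N w \<inter> (B \<union> B'))"
        using finB finB' by (intro card_mono) auto
      ultimately show ?thesis unfolding W3_def by simp
    next
      assume w: "w \<in> W4"
      have "N w \<inter> B \<subset> N w \<inter> (B \<union> B')" using w unfolding W4_def by blast
      then have "card (N w \<inter> B) < card (N w \<inter> (B \<union> B'))"
        using finB finB' by (intro psubset_card_mono) auto
      then show ?thesis using w unfolding W4_def W2_def by simp
    qed
  qed
  then have "card (W3 \<union> W4) \<le> card {w \<in> W. Suc j \<le> card (N w \<inter> (B \<union> B'))}"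
    using \<open>finite W\<close> by (intro card_mono) auto
  moreover have "card (W3 \<union> W4) = card W3 + card W4"
    using \<open>finite W\<close> by (intro card_Un_disjoint) (auto simp: W4_def W3_def W2_def)
  moreover have "c ^ Suc j * card W \<le> card W3 + card W4"
  proof -
    have "c ^ Suc j * card W \<le> c * card W1"
      using mult_left_mono[OF B(3) c(1)] by (simp add: W1_def mult.assoc)
    also have "\<dots> = c * card W2 + c * card W3" by (simp add: W1 algebra_simps)
    also have "\<dots> \<le> real (card W4) + 1 * real (card W3)"
      using B'(3) c(2) unfolding W4_def by (intro add_mono mult_right_mono) auto
    finally show ?thesis by simp
  qed
  moreover have "card (B \<union> B') \<le> Suc j * m"
    using card_Un_le[of B B'] B(2) B'(2) by simp
  ultimately show ?case using B(1) B'(1) by (intro exI[of _ "B \<union> B'"]) auto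
qed

text \<open>This is the hitting set lemma for the singletons \<open>{h x}\<close>. The factor
  \<open>1 / 2\<close> lost there will cost one bit per function.\<close>

lemma popular_values:
  assumes "finite X" "finite Y" "Y \<noteq> {}" "h \<in> X \<rightarrow> Y" "m \<le> card Y"
  shows "\<exists>B\<subseteq>Y. card B \<le> m \<and> real m / (2 * real (card Y)) * card X \<le> card {x \<in> X. h x \<in> B}"
proof -
  have M: "real (card Y) > 0" using assms by (simp add: card_gt_0_iff)
  have "\<exists>B\<subseteq>Y. card B \<le> m \<and>
    real m / (2 * real (card Y)) * card X \<le> card {x \<in> X. {h x} \<inter> B \<noteq> {}}"
    using assms M by (intro hitting_set[where L = 1]) (auto simp: field_simps)
  then show ?thesis by simp
qed

lemma popular_values_family:
  assumes "finite I" "finite X" "finite Y" "Y \<noteq> {}" "\<And>i. i \<in> I \<Longrightarrow> h i \<in> X \<rightarrow> Y" "m \<le> card Y"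
  shows "\<exists>A. (\<forall>i\<in>I. A i \<subseteq> Y \<and> card (A i) \<le> m) \<and>
    (real m / (2 * real (card Y))) ^ card I * card X \<le> card {x \<in> X. \<forall>i\<in>I. h i x \<in> A i}"
  using assms(1,5)
proof (induction I)
  case empty
  then show ?case by simp
next
  case (insert i I)
  then obtain A where A: "\<forall>i\<in>I. A i \<subseteq> Y \<and> card (A i) \<le> m"
    "(real m / (2 * real (card Y))) ^ card I * card X \<le> card {x \<in> X. \<forall>i\<in>I. h i x \<in> A i}" by auto
  define X' where "X' = {x \<in> X. \<forall>i\<in>I. h i x \<in> A i}"
  have "h i \<in> X' \<rightarrow> Y" "finite X'" using insert.prems \<open>finite X\<close> unfolding X'_def by auto
  then obtain B where B: "B \<subseteq> Y" "card B \<le> m"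
    "real m / (2 * real (card Y)) * card X' \<le> card {x \<in> X'. h i x \<in> B}"
    using popular_values[of X' Y "h i" m] assms by blast
  have "(real m / (2 * real (card Y))) ^ card (insert i I) * card X
      = real m / (2 * real (card Y)) * ((real m / (2 * real (card Y))) ^ card I * card X)"
    using insert by simp
  also have "\<dots> \<le> real m / (2 * real (card Y)) * card X'"
    using A(2) unfolding X'_def by (intro mult_left_mono) auto
  also note B(3)
  also have "{x \<in> X'. h i x \<in> B} = {x \<in> X. \<forall>j\<in>insert i I. h j x \<in> (A(i := B)) j}"
    unfolding X'_def using insert.hyps by auto
  finally show ?case using A(1) B insert.hyps by (intro exI[of _ "A(i := B)"]) auto
qed

lemma card_eq_sum_fibres:
  assumes "finite X" "finite A" "\<And>x. x \<in> X \<Longrightarrow> g x \<in> A"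
  shows "card X = (\<Sum>y\<in>A. card {x \<in> X. g x = y})"
proof -
  have "X = (\<Union>y\<in>A. {x \<in> X. g x = y})" using assms(3) by auto
  also have "card \<dots> = (\<Sum>y\<in>A. card {x \<in> X. g x = y})"
    using assms by (intro card_UN_disjoint) auto
  finally show ?thesis .
qed

lemma card_ge_of_fibres:
  assumes "finite X" "finite A" "\<And>y. y \<in> A \<Longrightarrow> t \<le> card {x \<in> X. g x = y \<and> P x}"
  shows "card A * t \<le> card {x \<in> X. g x \<in> A \<and> P x}"
proof -
  have "card A * t = (\<Sum>y\<in>A. t)" by simp
  also have "\<dots> \<le> (\<Sum>y\<in>A. card {x \<in> X. g x = y \<and> P x})"
    using assms(3) by (rule sum_mono)
  also have "\<dots> = (\<Sum>y\<in>A. card {x \<in> {x \<in> X. g x \<in> A \<and> P x}. g x = y})"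
    by (intro sum.cong arg_cong[of _ _ card]) auto
  also have "\<dots> = card {x \<in> X. g x \<in> A \<and> P x}"
    using assms by (intro card_eq_sum_fibres[symmetric]) auto
  finally show ?thesis .
qed

text \<open>Random sets of size \<open>m\<close> would contain only about \<open>\<kappa> m\<close> points. The gain of an arbitrary constant
  factor comes from irregularity: either the fibres are unbalanced, or many points share both values,
  or one can hit the neighbourhoods of a constant proportion of the values \<open>t\<close> times over.\<close>

lemma dense_pair:
  fixes \<kappa> :: real and t :: nat
  assumes \<kappa>: "0 < \<kappa>" and t: "1 \<le> t"
  obtains \<eta> :: real where "0 < \<eta>"
    "\<And>(X :: 'a set) (Y :: 'b set) g h m. finite X \<Longrightarrow> finite Y \<Longrightarrow> Y \<noteq> {} \<Longrightarrow>
    g \<in> X \<rightarrow> Y \<Longrightarrow> h \<in> X \<rightarrow> Y \<Longrightarrow> t \<le> m \<Longrightarrow> real m \<le> \<eta> * real (card Y) \<Longrightarrow>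
    \<kappa> * real (card Y) ^ 2 \<le> real (card X) * m \<Longrightarrow>
    \<exists>A\<subseteq>Y. \<exists>B\<subseteq>Y. card A \<le> m \<and> card B \<le> m \<and> m * t \<le> card {x \<in> X. g x \<in> A \<and> h x \<in> B}"
proof -
  \<comment> \<open>A \<open>K\<close>-fold surplus on \<open>m\<close> values of \<open>g\<close>
    must survive the factor \<open>m / (2 * card Y)\<close> lost in the choice for \<open>h\<close>:
    by the density hypothesis at least \<open>K * m * \<kappa> / 2 = m * t\<close> inputs
    remain.\<close>
  define K where "K = 2 * real t / \<kappa>"
  \<comment> \<open>A round of at least \<open>m / (2 t)\<close> points with the \<open>L\<close>
    defined below satisfies the hypothesis of \<open>hitting_set\<close> exactly for
    \<open>c \<le> \<kappa> / (64 t ^ 2)\<close>.\<close>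
  define c where "c = min (1 / 2) (\<kappa> / (64 * real t ^ 2))"
  \<comment> \<open>In this order the bounds on \<open>m\<close> provide: room for \<open>m\<close>
    values, a loss of at most half of the inputs to overfull fibres, the case of few values of
    \<open>g\<close>, \<open>t \<le> L\<close>, and enough vertices hit \<open>t\<close>
    times.\<close>
  define \<eta> where "\<eta> = Min {1, 1 / (2 * K), \<kappa> / (8 * real t), \<kappa> / (16 * real t ^ 2), c ^ t / (8 * K)}"
  have t0: "0 < real t" using t by simp
  have K0: "0 < K" unfolding K_def using t0 \<kappa> by simp
  have c0: "0 < c" "c \<le> 1 / 2" "c \<le> \<kappa> / (64 * real t ^ 2)"
    unfolding c_def using t0 \<kappa> by auto
  have \<eta>0: "0 < \<eta>" unfolding \<eta>_def using t0 K0 c0 \<kappa> by simp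
  have \<eta>s: "\<eta> \<le> 1" "\<eta> \<le> 1 / (2 * K)" "\<eta> \<le> \<kappa> / (8 * real t)" "\<eta> \<le> \<kappa> / (16 * real t ^ 2)"
    "\<eta> \<le> c ^ t / (8 * K)"
    unfolding \<eta>_def by simp_all
  have "\<exists>A\<subseteq>Y. \<exists>B\<subseteq>Y. card A \<le> m \<and> card B \<le> m \<and> m * t \<le> card {x \<in> X. g x \<in> A \<and> h x \<in> B}"
    if fX: "finite X" and fY: "finite Y" and "Y \<noteq> {}" and g: "g \<in> X \<rightarrow> Y" and h: "h \<in> X \<rightarrow> Y"
      and tm: "t \<le> m" and m\<eta>: "real m \<le> \<eta> * real (card Y)" and big: "\<kappa> * real (card Y) ^ 2 \<le> real (card X) * m"
    for X :: "'a set" and Y :: "'b set" and g h m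
  proof -
    define M where "M = real (card Y)"
    define x where "x = real (card X)"
    have M0: "0 < M" unfolding M_def using fY \<open>Y \<noteq> {}\<close> by (simp add: card_gt_0_iff)
    have m0: "0 < real m" using tm t by simp
    have big': "\<kappa> * M ^ 2 \<le> x * m" using big unfolding M_def x_def .
    have m\<eta>': "real m \<le> q * M" if "\<eta> \<le> q" for q
      using m\<eta> mult_right_mono[OF that, of M] M0 unfolding M_def by linarith
    have mM: "m \<le> card Y" using m\<eta>'[OF \<eta>s(1)] unfolding M_def by simp
    have x0: "0 < x"
    proof (rule ccontr)
      assume "\<not> 0 < x"
      then have "x * m \<le> 0" using m0 by (simp add: mult_nonpos_nonneg)
      moreover have "0 < \<kappa> * M ^ 2" using \<kappa> M0 by simp
      ultimately show False using big' by linarith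
    qed
    show ?thesis
    \<comment> \<open>Unbalanced case: at most \<open>m\<close> values of \<open>g\<close> attract
      \<open>K\<close> times their fair share of the inputs, and popular values of \<open>h\<close>
      among these inputs preserve the gain.\<close>
    proof (cases "\<exists>A\<subseteq>Y. card A \<le> m \<and> K * (m / M) * x \<le> card {u \<in> X. g u \<in> A}")
      case True
      then obtain A where A: "A \<subseteq> Y" "card A \<le> m" "K * (m / M) * x \<le> card {u \<in> X. g u \<in> A}" by blast
      obtain B where B: "B \<subseteq> Y" "card B \<le> m"
        "real m / (2 * real (card Y)) * card {u \<in> X. g u \<in> A} \<le> card {v \<in> {u \<in> X. g u \<in> A}. h v \<in> B}"
        using popular_values[of "{u \<in> X. g u \<in> A}" Y h m] fX fY \<open>Y \<noteq> {}\<close> h mM by auto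
      have "real m * t = K * m * \<kappa> / 2" unfolding K_def using \<kappa> by simp
      also have "\<dots> = K * m / (2 * M ^ 2) * (\<kappa> * M ^ 2)" using M0 by simp
      also have "\<dots> \<le> K * m / (2 * M ^ 2) * (x * m)"
        using big' K0 M0 by (intro mult_left_mono) auto
      also have "\<dots> = real m / (2 * M) * (K * (m / M) * x)"
        by (simp add: power2_eq_square mult_ac)
      also have "\<dots> \<le> real m / (2 * M) * card {u \<in> X. g u \<in> A}"
        using A(3) M0 by (intro mult_left_mono) auto
      also have "\<dots> \<le> card {v \<in> {u \<in> X. g u \<in> A}. h v \<in> B}" using B(3) unfolding M_def .
      also have "{v \<in> {u \<in> X. g u \<in> A}. h v \<in> B} = {x \<in> X. g x \<in> A \<and> h x \<in> B}" by auto
      finally have "real (m * t) \<le> card {x \<in> X. g x \<in> A \<and> h x \<in> B}" by simp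
      then have "m * t \<le> card {x \<in> X. g x \<in> A \<and> h x \<in> B}" by (simp only: of_nat_le_iff)
      then show ?thesis using A B by blast
    next
      case False
      then have balanced: "card {u \<in> X. g u \<in> A} < K * (m / M) * x" if "A \<subseteq> Y" "card A \<le> m" for A
        using that by (meson not_le)
      \<comment> \<open>Values with overfull fibres. As many as \<open>m\<close> of them would
        contradict balance; being fewer, they carry less than half of the inputs, again by
        balance.\<close>
      define H where "H = {y \<in> Y. K * x / M < card {u \<in> X. g u = y}}"
      have HY: "H \<subseteq> Y" unfolding H_def by blast
      have "card H < m"
      proof (rule ccontr)
        assume "\<not> ?thesis"
        then obtain A where A: "A \<subseteq> H" "card A = m"
          by (meson not_less obtain_subset_with_card_n)
        have fA: "finite A" using A(1) HY fY by (meson finite_subset)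
        have "K * (m / M) * x = (\<Sum>y\<in>A. K * x / M)" using A(2) by simp
        also have "\<dots> \<le> (\<Sum>y\<in>A. real (card {u \<in> X. g u = y}))"
          using A(1) unfolding H_def by (intro sum_mono) auto
        also have "\<dots> = (\<Sum>y\<in>A. real (card {u \<in> {u \<in> X. g u \<in> A}. g u = y}))"
          by (intro sum.cong arg_cong[of _ _ real] arg_cong[of _ _ card]) auto
        also have "\<dots> = card {u \<in> X. g u \<in> A}"
          unfolding of_nat_sum[symmetric] using fX fA by (subst card_eq_sum_fibres[of _ A g]) auto
        finally show False using balanced[of A] A HY by auto
      qed
      then have "card {u \<in> X. g u \<in> H} < K * (m / M) * x" using balanced[OF HY] by simp
      also have "\<dots> \<le> K * (1 / (2 * K)) * x"
        using m\<eta>'[OF \<eta>s(2)] M0 K0 x0 by (intro mult_right_mono mult_left_mono) (auto simp: field_simps)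
      also have "\<dots> = x / 2" using K0 by simp
      finally have XH: "card {u \<in> X. g u \<in> H} < x / 2" .
      define X1 where "X1 = {u \<in> X. g u \<notin> H}"
      have fX1: "finite X1" unfolding X1_def using fX by simp
      have "card X = card {u \<in> X. g u \<in> H} + card X1"
        unfolding X1_def using fX
        by (subst card_Un_disjoint[symmetric]) (auto intro!: arg_cong[of _ _ card])
      then have X1: "x / 2 \<le> card X1" using XH unfolding x_def by linarith
      \<comment> \<open>Inputs are the edges of a bipartite multigraph, and \<open>mult u\<close> is
        the multiplicity of the edge from \<open>g u\<close> to \<open>h u\<close>. A quarter of the
        inputs lies on heavy edges or a quarter on light ones.\<close>
      define mult where "mult u = card {v \<in> X1. g v = g u \<and> h v = h u}" for u
      define Xh where "Xh = {u \<in> X1. t \<le> mult u}"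
      define Xl where "Xl = {u \<in> X1. mult u < t}"
      have fh: "finite Xh" and fl: "finite Xl" unfolding Xh_def Xl_def using fX1 by auto
      have "card X1 = card Xh + card Xl"
        unfolding Xh_def Xl_def using fX1
        by (subst card_Un_disjoint[symmetric]) (auto intro!: arg_cong[of _ _ card])
      then consider "x / 4 \<le> card Xh" | "x / 4 \<le> card Xl" using X1 by linarith
      then show ?thesis
      proof cases
        case 1
        have hXh: "h \<in> Xh \<rightarrow> Y" using h unfolding Xh_def X1_def by auto
        obtain B where B: "B \<subseteq> Y" "card B \<le> m"
          "real m / (2 * real (card Y)) * card Xh \<le> card {v \<in> Xh. h v \<in> B}"
          using popular_values[OF fh fY \<open>Y \<noteq> {}\<close> hXh mM] by blast
        define S where "S = {v \<in> Xh. h v \<in> B}"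
        have SX: "S \<subseteq> X" unfolding S_def Xh_def X1_def by auto
        have fS: "finite S" unfolding S_def using fh by simp
        have gS: "g ` S \<subseteq> Y" using g SX by auto
        show ?thesis
        \<comment> \<open>If few values of \<open>g\<close> occur, all can be taken. Otherwise any
          \<open>m\<close> of them will do: each has a heavy edge into \<open>B\<close>, hence
          \<open>t\<close> inputs.\<close>
        proof (cases "card (g ` S) \<le> m")
          case True
          have "real m * t \<le> \<kappa> / (8 * real t) * M * t"
            using m\<eta>'[OF \<eta>s(3)] t0 by (intro mult_right_mono) auto
          also have "\<dots> = (\<kappa> * M ^ 2) / (8 * M)" using t0 M0 by (simp add: power2_eq_square)
          also have "\<dots> \<le> (x * m) / (8 * M)" using big' M0 by (intro divide_right_mono) auto
          also have "\<dots> = real m / (2 * M) * (x / 4)" by simp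
          also have "\<dots> \<le> real m / (2 * M) * card Xh"
            using 1 M0 by (intro mult_left_mono) auto
          also have "\<dots> \<le> card S" using B(3) unfolding M_def S_def .
          finally have "real (m * t) \<le> card S" by simp
          then have "m * t \<le> card S" by (simp only: of_nat_le_iff)
          also have "\<dots> \<le> card {x \<in> X. g x \<in> g ` S \<and> h x \<in> B}"
            using SX fX unfolding S_def by (intro card_mono) auto
          finally show ?thesis using True gS B by blast
        next
          case False
          then obtain A where A: "A \<subseteq> g ` S" "card A = m"
            by (meson nat_le_linear obtain_subset_with_card_n)
          have fA: "finite A" using A(1) fS by (meson finite_imageI finite_subset)
          have "t \<le> card {x \<in> X. g x = y \<and> h x \<in> B}" if y: "y \<in> A" for y
          proof -
            obtain u where u: "u \<in> S" "y = g u" using y A(1) by blast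
            then have "t \<le> mult u" unfolding S_def Xh_def by simp
            also have "\<dots> \<le> card {x \<in> X. g x = y \<and> h x \<in> B}"
              unfolding mult_def using u fX by (intro card_mono) (auto simp: X1_def S_def)
            finally show ?thesis .
          qed
          from card_ge_of_fibres[OF fX fA this] have "m * t \<le> card {x \<in> X. g x \<in> A \<and> h x \<in> B}"
            using A(2) by simp
          then show ?thesis using A gS B by (intro exI[of _ A] conjI exI[of _ B]) auto
        qed
      next
        case 2
        \<comment> \<open>On light edges, a fibre of \<open>g\<close> has at most \<open>t\<close>
          times as many inputs as neighbours, so large fibres give large neighbourhoods.\<close>
        define N where "N y = h ` {u \<in> Xl. g u = y}" for y
        have NY: "N y \<subseteq> Y" for y unfolding N_def using h by (auto simp: Xl_def X1_def)
        have Nge: "card {u \<in> Xl. g u = y} \<le> card (N y) * t" for y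
        proof -
          have "card {u \<in> Xl. g u = y} = (\<Sum>v\<in>N y. card {u \<in> {u \<in> Xl. g u = y}. h u = v})"
            using fl by (intro card_eq_sum_fibres) (auto simp: N_def)
          also have "\<dots> \<le> (\<Sum>v\<in>N y. t)"
          proof (rule sum_mono)
            fix v assume "v \<in> N y"
            then obtain u where u: "u \<in> Xl" "g u = y" "h u = v" unfolding N_def by blast
            have "card {u \<in> {u \<in> Xl. g u = y}. h u = v} \<le> mult u"
              unfolding mult_def using u fX1 by (intro card_mono) (auto simp: Xl_def)
            also have "\<dots> \<le> t" using u(1) unfolding Xl_def by simp
            finally show "card {u \<in> {u \<in> Xl. g u = y}. h u = v} \<le> t" .
          qed
          finally show ?thesis by simp
        qed
        \<comment> \<open>The threshold is half of the guaranteed average \<open>x / (4 M)\<close>.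
          Vertices below it carry at most \<open>x / 8\<close> inputs, and no light fibre exceeds
          \<open>K x / M\<close>, so \<open>W\<close> is a constant proportion of
          \<open>Y\<close>.\<close>
        define W where "W = {y \<in> Y. x / (8 * M) \<le> card {u \<in> Xl. g u = y}}"
        have WY: "W \<subseteq> Y" unfolding W_def by blast
        have fW: "finite W" using WY fY by (rule finite_subset)
        have W: "M / (8 * K) \<le> card W"
        proof -
          have "card Xl = (\<Sum>y\<in>Y. card {u \<in> Xl. g u = y})"
            using fl fY g by (intro card_eq_sum_fibres) (auto simp: Xl_def X1_def)
          then have "real (card Xl) = (\<Sum>y\<in>Y. real (card {u \<in> Xl. g u = y}))" by simp
          also have "\<dots> = (\<Sum>y\<in>W. real (card {u \<in> Xl. g u = y}))
              + (\<Sum>y\<in>Y - W. real (card {u \<in> Xl. g u = y}))"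
            using sum.subset_diff[OF WY fY] by (simp add: add.commute)
          also have "(\<Sum>y\<in>Y - W. real (card {u \<in> Xl. g u = y})) \<le> (\<Sum>y\<in>Y - W. x / (8 * M))"
            unfolding W_def by (intro sum_mono) auto
          also have "(\<Sum>y\<in>Y - W. x / (8 * M)) \<le> (\<Sum>y\<in>Y. x / (8 * M))"
            using fY x0 M0 by (intro sum_mono2) auto
          also have "\<dots> = x / 8" using M0 unfolding M_def by simp
          also have "(\<Sum>y\<in>W. real (card {u \<in> Xl. g u = y})) \<le> (\<Sum>y\<in>W. K * x / M)"
          proof (rule sum_mono)
            fix y assume "y \<in> W"
            show "card {u \<in> Xl. g u = y} \<le> K * x / M"
            proof (cases "y \<in> H")
              case True
              then have "{u \<in> Xl. g u = y} = {}" unfolding Xl_def X1_def by auto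
              then have "real (card {u \<in> Xl. g u = y}) = 0" by (simp only: card.empty of_nat_0)
              moreover have "0 \<le> K * x / M" using K0 x0 M0 by simp
              ultimately show ?thesis by linarith
            next
              case False
              have "card {u \<in> Xl. g u = y} \<le> card {u \<in> X. g u = y}"
                using fX by (intro card_mono) (auto simp: Xl_def X1_def)
              moreover have "card {u \<in> X. g u = y} \<le> K * x / M"
                using False \<open>y \<in> W\<close> WY unfolding H_def by auto
              ultimately show ?thesis by linarith
            qed
          qed
          also have "(\<Sum>y\<in>W. K * x / M) = card W * (K * x / M)" by simp
          finally have "x / 8 \<le> card W * (K * x / M)" using 2 by linarith
          then have "x * (M / (8 * K)) \<le> x * card W" using M0 K0 by (simp add: field_simps)
          then show ?thesis using x0 by (rule mult_left_le_imp_le)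
        qed
        \<comment> \<open>A vertex of \<open>W\<close> has at least
          \<open>x / (8 M t) \<ge> 2 L\<close> neighbours. One half is the \<open>L\<close> of the
          hitting lemma; the other, at least \<open>t\<close>, pays for points met in earlier
          rounds.\<close>
        define L where "L = \<kappa> * M / (16 * real t * real m)"
        have L0: "0 \<le> L" unfolding L_def using \<kappa> M0 by simp
        have tL: "t \<le> L"
          using m\<eta>'[OF \<eta>s(4)] t0 m0 unfolding L_def by (simp add: field_simps power2_eq_square)
        have NL: "N y \<subseteq> Y \<and> L + t \<le> card (N y)" if y: "y \<in> W" for y
        proof -
          have "L + t \<le> 2 * L" using tL by simp
          also have "2 * L = (\<kappa> * M ^ 2) / (8 * real t * real m * M)"
            unfolding L_def using M0 by (simp add: power2_eq_square mult_ac)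
          also have "\<dots> \<le> (x * m) / (8 * real t * real m * M)"
            using big' M0 by (intro divide_right_mono) auto
          also have "\<dots> = x / (8 * M) / real t" using m0 by simp
          also have "\<dots> \<le> card {u \<in> Xl. g u = y} / real t"
            using y unfolding W_def by (intro divide_right_mono) auto
          also have "\<dots> \<le> card (N y)"
          proof -
            have "real (card {u \<in> Xl. g u = y}) \<le> card (N y) * real t"
              using Nge[of y] by (metis of_nat_le_iff of_nat_mult)
            then show ?thesis using t0 by (simp add: pos_divide_le_eq)
          qed
          finally show ?thesis using NY by simp
        qed
        \<comment> \<open>With \<open>m'\<close> points per round, \<open>t\<close> rounds stay
          within the budget \<open>m\<close>.\<close>
        define m' where "m' = m div t"
        have m'1: "t * m' \<le> m" unfolding m'_def by simp
        have m'2: "real m / (2 * real t) \<le> m'"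
        proof -
          have "m < t * m' + t" unfolding m'_def
            using t mod_less_divisor[of t m] mult_div_mod_eq[of t m] by linarith
          moreover have "t \<le> t * m'" unfolding m'_def using tm t by (simp add: Suc_le_eq div_greater_zero_iff)
          ultimately have "m \<le> 2 * t * m'" by linarith
          then have "real m \<le> real (2 * t * m')" by (simp only: of_nat_le_iff)
          then show ?thesis using t0 by (simp add: field_simps)
        qed
        have cL: "2 * c * card Y \<le> m' * L"
        proof -
          have "2 * c * M \<le> 2 * (\<kappa> / (64 * real t ^ 2)) * M"
            using c0(3) M0 by (intro mult_right_mono mult_left_mono) auto
          also have "\<dots> = real m / (2 * real t) * L"
            unfolding L_def using m0 by (simp add: power2_eq_square mult_ac)
          also have "\<dots> \<le> m' * L" using m'2 L0 by (rule mult_right_mono)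
          finally show ?thesis unfolding M_def .
        qed
        have "\<exists>B\<subseteq>Y. card B \<le> t * m' \<and> c ^ t * card W \<le> card {w \<in> W. t \<le> card (N w \<inter> B)}"
          using c0 by (intro iterated_hitting_set[OF fW fY \<open>Y \<noteq> {}\<close> L0 NL _ _ cL order.refl]) auto
        then obtain B where B: "B \<subseteq> Y" "card B \<le> t * m'"
          "c ^ t * card W \<le> card {w \<in> W. t \<le> card (N w \<inter> B)}" by blast
        have "real m \<le> c ^ t / (8 * K) * M" by (rule m\<eta>'[OF \<eta>s(5)])
        also have "\<dots> = c ^ t * (M / (8 * K))" by simp
        also have "\<dots> \<le> c ^ t * card W" using W c0 by (intro mult_left_mono) auto
        also note B(3)
        finally have "m \<le> card {w \<in> W. t \<le> card (N w \<inter> B)}" by simp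
        then obtain A where A: "A \<subseteq> {w \<in> W. t \<le> card (N w \<inter> B)}" "card A = m"
          by (meson obtain_subset_with_card_n)
        have fA: "finite A" using A(1) fW by (auto intro: finite_subset)
        have "t \<le> card {x \<in> X. g x = y \<and> h x \<in> B}" if y: "y \<in> A" for y
        proof -
          have "t \<le> card (N y \<inter> B)" using y A(1) by blast
          also have "\<dots> \<le> card (h ` {x \<in> X. g x = y \<and> h x \<in> B})"
            using fX by (intro card_mono) (auto simp: N_def Xl_def X1_def)
          also have "\<dots> \<le> card {x \<in> X. g x = y \<and> h x \<in> B}"
            using fX by (intro card_image_le) auto
          finally show ?thesis .
        qed
        from card_ge_of_fibres[OF fX fA this] have "m * t \<le> card {x \<in> X. g x \<in> A \<and> h x \<in> B}"
          using A(2) by simp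
        moreover have "A \<subseteq> Y" "card A \<le> m" "card B \<le> m" using A B(2) m'1 WY by auto
        ultimately show ?thesis using B(1) by blast
      qed
    qed
  qed
  then show ?thesis by (rule that[OF \<eta>0])
qed

text \<open>Popular values for the functions \<open>3\<close> to \<open>k\<close> cost a factor
  \<open>m / (2 * card Y)\<close> each, which turns the density hypothesis into that of
  \<open>dense_pair\<close> for the first two functions, with \<open>\<kappa> / 2 ^ (k - 2)\<close>.
  The gain has to come from a pair, since a single function may be perfectly balanced.\<close>

lemma dense_family:
  fixes \<kappa> :: real and t k :: nat
  assumes \<kappa>: "0 < \<kappa>" and t: "1 \<le> t" and k: "2 \<le> k"
  obtains \<eta> :: real where "0 < \<eta>" "\<And>(X :: 'a set) (Y :: 'b set) h m. finite X \<Longrightarrow> finite Y \<Longrightarrow> Y \<noteq> {} \<Longrightarrow>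
    (\<And>i. i \<in> {1..k} \<Longrightarrow> h i \<in> X \<rightarrow> Y) \<Longrightarrow> t \<le> m \<Longrightarrow> real m \<le> \<eta> * real (card Y) \<Longrightarrow>
    \<kappa> * real (card Y) ^ k \<le> real (card X) * real m ^ (k - 1) \<Longrightarrow>
    \<exists>A\<subseteq>Y. card A \<le> k * m \<and> m * t \<le> card {x \<in> X. \<forall>i\<in>{1..k}. h i x \<in> A}"
proof -
  have pos: "0 < \<kappa> / 2 ^ (k - 2)" using \<kappa> by simp
  obtain \<eta> :: real where \<eta>: "0 < \<eta>"
    "\<And>(X :: 'a set) (Y :: 'b set) g h m. finite X \<Longrightarrow> finite Y \<Longrightarrow> Y \<noteq> {} \<Longrightarrow>
    g \<in> X \<rightarrow> Y \<Longrightarrow> h \<in> X \<rightarrow> Y \<Longrightarrow> t \<le> m \<Longrightarrow> real m \<le> \<eta> * real (card Y) \<Longrightarrow>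
    \<kappa> / 2 ^ (k - 2) * real (card Y) ^ 2 \<le> real (card X) * m \<Longrightarrow>
    \<exists>A\<subseteq>Y. \<exists>B\<subseteq>Y. card A \<le> m \<and> card B \<le> m \<and> m * t \<le> card {x \<in> X. g x \<in> A \<and> h x \<in> B}"
    by (fact dense_pair[OF pos t])
  have "\<exists>A\<subseteq>Y. card A \<le> k * m \<and> m * t \<le> card {x \<in> X. \<forall>i\<in>{1..k}. h i x \<in> A}"
    if fX: "finite X" and fY: "finite Y" and "Y \<noteq> {}" and h: "\<And>i. i \<in> {1..k} \<Longrightarrow> h i \<in> X \<rightarrow> Y"
      and tm: "t \<le> m" and m\<eta>: "real m \<le> min 1 \<eta> * real (card Y)"
      and big: "\<kappa> * real (card Y) ^ k \<le> real (card X) * real m ^ (k - 1)"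
    for X :: "'a set" and Y :: "'b set" and h m
  proof -
    define M where "M = real (card Y)"
    have M0: "0 < M" unfolding M_def using fY \<open>Y \<noteq> {}\<close> by (simp add: card_gt_0_iff)
    have "min 1 \<eta> * M \<le> 1 * M" "min 1 \<eta> * M \<le> \<eta> * M"
      using M0 by (intro mult_right_mono; simp)+
    then have mM: "m \<le> card Y" and m\<eta>': "real m \<le> \<eta> * real (card Y)"
      using m\<eta> unfolding M_def by linarith+
    have "\<exists>A. (\<forall>i\<in>{3..k}. A i \<subseteq> Y \<and> card (A i) \<le> m) \<and>
      (real m / (2 * real (card Y))) ^ card {3..k} * card X \<le> card {x \<in> X. \<forall>i\<in>{3..k}. h i x \<in> A i}"
      using h by (intro popular_values_family[OF _ fX fY \<open>Y \<noteq> {}\<close> _ mM]) auto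
    then obtain A where A: "\<forall>i\<in>{3..k}. A i \<subseteq> Y \<and> card (A i) \<le> m"
      and A2: "(real m / (2 * M)) ^ (k - 2) * card X \<le> card {x \<in> X. \<forall>i\<in>{3..k}. h i x \<in> A i}"
      unfolding M_def by (auto simp: numeral_2_eq_2 numeral_3_eq_3)
    define X' where "X' = {x \<in> X. \<forall>i\<in>{3..k}. h i x \<in> A i}"
    obtain j where j: "k = Suc (Suc j)" using k by (metis add_2_eq_Suc le_Suc_ex)
    have "\<kappa> / 2 ^ (k - 2) * real (card Y) ^ 2 = \<kappa> * M ^ k / (2 ^ j * M ^ j)"
      using M0 unfolding j M_def[symmetric] by (simp add: power2_eq_square M_def)
    also have "\<dots> \<le> real (card X) * real m ^ (k - 1) / (2 ^ j * M ^ j)"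
      using big M0 unfolding M_def by (intro divide_right_mono) auto
    also have "\<dots> = (real m / (2 * M)) ^ (k - 2) * card X * m"
      unfolding j by (simp add: power_divide power_mult_distrib mult_ac)
    also have "\<dots> \<le> card X' * real m"
      using A2 unfolding X'_def by (intro mult_right_mono) auto
    finally have "\<kappa> / 2 ^ (k - 2) * real (card Y) ^ 2 \<le> real (card X') * m" .
    moreover have "finite X'" "h 1 \<in> X' \<rightarrow> Y" "h 2 \<in> X' \<rightarrow> Y"
      using fX h[of 1] h[of 2] k unfolding X'_def by auto
    ultimately obtain A1 A2 where A12: "A1 \<subseteq> Y" "A2 \<subseteq> Y" "card A1 \<le> m" "card A2 \<le> m"
      "m * t \<le> card {x \<in> X'. h 1 x \<in> A1 \<and> h 2 x \<in> A2}"
      using \<eta>(2)[of X' Y "h 1" "h 2" m] fY \<open>Y \<noteq> {}\<close> tm m\<eta>' by blast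
    define A' where "A' = A1 \<union> A2 \<union> (\<Union>i\<in>{3..k}. A i)"
    have A'Y: "A' \<subseteq> Y" unfolding A'_def using A12 A by auto
    have "card (\<Union>i\<in>{3..k}. A i) \<le> (\<Sum>i\<in>{3..k}. card (A i))" by (rule card_UN_le) simp
    also have "\<dots> \<le> (\<Sum>i\<in>{3..k}. m)" using A by (intro sum_mono) auto
    also have "\<dots> = j * m" unfolding j by simp
    finally have "card A' \<le> k * m"
      using card_Un_le[of "A1 \<union> A2" "\<Union>i\<in>{3..k}. A i"] card_Un_le[of A1 A2] A12(3,4)
      unfolding A'_def j by simp
    moreover have "{x \<in> X'. h 1 x \<in> A1 \<and> h 2 x \<in> A2} \<subseteq> {x \<in> X. \<forall>i\<in>{1..k}. h i x \<in> A'}"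
    proof safe
      fix x i assume x: "x \<in> X'" "h 1 x \<in> A1" "h 2 x \<in> A2" "i \<in> {1..k}"
      consider "i = 1" | "i = 2" | "i \<in> {3..k}" using x(4) by fastforce
      then show "h i x \<in> A'" using x unfolding A'_def X'_def by cases blast+
    qed (simp add: X'_def)
    then have "card {x \<in> X'. h 1 x \<in> A1 \<and> h 2 x \<in> A2} \<le> card {x \<in> X. \<forall>i\<in>{1..k}. h i x \<in> A'}"
      using fX by (intro card_mono) auto
    ultimately show ?thesis using A'Y A12(5) by (meson order.trans)
  qed
  note main = this
  have "0 < min 1 \<eta>" using \<eta>(1) by linarith
  then show ?thesis using main by (rule that)
qed

section \<open>Compressible sets of outputs\<close>

definition codes :: "nat \<Rightarrow> nat set" where
  "codes l = {x. slen x = l}"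

lemma codes_eq: "codes l = {2 ^ l - 1..<2 ^ Suc l - 1}"
proof -
  have "slen x = l \<longleftrightarrow> 2 ^ l \<le> x + 1 \<and> x + 1 < 2 ^ Suc l" for x
    using slen_bounds[of x] slen_eq[of l x] by auto
  moreover have "2 ^ l \<le> x + 1 \<and> x + 1 < 2 ^ Suc l \<longleftrightarrow> 2 ^ l - 1 \<le> x \<and> x < 2 ^ Suc l - 1" for x :: nat
    by auto
  ultimately have "x \<in> codes l \<longleftrightarrow> x \<in> {2 ^ l - 1..<2 ^ Suc l - 1}" for x
    by (simp only: codes_def mem_Collect_eq atLeastLessThan_iff)
  then show ?thesis by blast
qed

lemma finite_codes [simp]: "finite (codes l)"
  by (simp add: codes_eq)

lemma card_codes [simp]: "card (codes l) = 2 ^ l"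
  by (simp add: codes_eq)

lemma codes_nonempty [simp]: "codes l \<noteq> {}"
  by (metis card.empty card_codes power_not_zero zero_neq_numeral)

lemma codes_subset: "codes l \<subseteq> {..<2 ^ Suc l}"
  by (auto simp: codes_eq)

lemma real_two_power: "(2::real) ^ n = 2 powr n"
  by (simp add: powr_realpow)

text \<open>With \<open>b\<close> the rounded \<open>\<alpha> N + D\<close>, any
  \<open>2 ^ b\<close> inputs have at most \<open>k * 2 ^ b \<le> 2 ^ (k + b)\<close> outputs; the
  second condition ensures that there are so many inputs.\<close>

lemma ex_outputs_of_arbitrary_inputs:
  fixes \<alpha> :: real and k N n D a :: nat
  assumes h: "\<And>i. i \<in> {1..k} \<Longrightarrow> h i \<in> codes N \<rightarrow> codes n"
    and 1: "\<alpha> * N + D + 1 + k \<le> a" and 2: "\<alpha> * N + D + 1 \<le> N" and 3: "0 \<le> \<alpha>"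
  shows "\<exists>A\<subseteq>codes n. card A \<le> 2 ^ a \<and>
    2 powr (\<alpha> * N + real D) \<le> card {x \<in> codes N. \<forall>i\<in>{1..k}. h i x \<in> A}"
proof -
  define b where "b = nat \<lceil>\<alpha> * N + real D\<rceil>"
  have "0 \<le> \<alpha> * N + real D" using 3 by simp
  then have b: "\<alpha> * N + real D \<le> b" "b < \<alpha> * N + real D + 1" unfolding b_def by linarith+
  then have bN: "b \<le> N" and bk: "k + b \<le> a" using 1 2 by linarith+
  have "2 ^ b \<le> card (codes N)" using bN by simp
  then obtain S where S: "S \<subseteq> codes N" "card S = 2 ^ b" by (meson obtain_subset_with_card_n)
  have fS: "finite S" using S(1) finite_subset[OF _ finite_codes] by blast
  define A where "A = (\<Union>i\<in>{1..k}. h i ` S)"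
  have AY: "A \<subseteq> codes n" unfolding A_def using h S(1) by fastforce
  have "card A \<le> (\<Sum>i\<in>{1..k}. card (h i ` S))" unfolding A_def by (rule card_UN_le) simp
  also have "\<dots> \<le> (\<Sum>i\<in>{1..k}. 2 ^ b)"
    unfolding S(2)[symmetric] by (intro sum_mono card_image_le fS)
  also have "\<dots> \<le> 2 ^ k * 2 ^ b" using less_exp[of k] by simp
  also have "\<dots> \<le> 2 ^ a" unfolding power_add[symmetric] using bk by simp
  finally have "card A \<le> 2 ^ a" .
  moreover have "2 powr (\<alpha> * N + real D) \<le> card {x \<in> codes N. \<forall>i\<in>{1..k}. h i x \<in> A}"
  proof -
    have "2 powr (\<alpha> * N + real D) \<le> 2 powr b" using b(1) by simp
    also have "\<dots> = real (card S)" using S(2) by (simp add: powr_realpow)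
    also have "\<dots> \<le> card {x \<in> codes N. \<forall>i\<in>{1..k}. h i x \<in> A}"
      using S(1) unfolding A_def by (intro of_nat_mono card_mono) auto
    finally show ?thesis .
  qed
  ultimately show ?thesis using AY by blast
qed

text \<open>A budget of \<open>2 ^ (a - k)\<close> values per function keeps their union within
  \<open>2 ^ a\<close>. Each function then costs \<open>n - a + k\<close> bits, and one more for the
  factor \<open>1 / 2\<close>; this is the bracket in the last hypothesis.\<close>

lemma ex_popular_outputs:
  fixes \<alpha> :: real and k N n D a :: nat
  assumes h: "\<And>i. i \<in> {1..k} \<Longrightarrow> h i \<in> codes N \<rightarrow> codes n"
    and an: "a \<le> n" and ka: "k \<le> a"
    and 1: "\<alpha> * N + D + real k * (real n - a + k + 1) \<le> N"
  shows "\<exists>A\<subseteq>codes n. card A \<le> 2 ^ a \<and>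
    2 powr (\<alpha> * N + real D) \<le> card {x \<in> codes N. \<forall>i\<in>{1..k}. h i x \<in> A}"
proof -
  define m where "m = (2::nat) ^ (a - k)"
  have mn: "m \<le> card (codes n)" unfolding m_def using an by simp
  have "\<exists>A. (\<forall>i\<in>{1..k}. A i \<subseteq> codes n \<and> card (A i) \<le> m) \<and>
    (real m / (2 * real (card (codes n)))) ^ card {1..k} * card (codes N)
      \<le> card {x \<in> codes N. \<forall>i\<in>{1..k}. h i x \<in> A i}"
    using h by (intro popular_values_family mn) auto
  then obtain A where A: "\<forall>i\<in>{1..k}. A i \<subseteq> codes n \<and> card (A i) \<le> m"
    and A2: "(real m / (2 * 2 ^ n)) ^ k * 2 ^ N \<le> card {x \<in> codes N. \<forall>i\<in>{1..k}. h i x \<in> A i}"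
    by auto
  define A' where "A' = (\<Union>i\<in>{1..k}. A i)"
  have A'Y: "A' \<subseteq> codes n" unfolding A'_def using A by auto
  have "card A' \<le> (\<Sum>i\<in>{1..k}. card (A i))" unfolding A'_def by (rule card_UN_le) simp
  also have "\<dots> \<le> (\<Sum>i\<in>{1..k}. m)" using A by (intro sum_mono) auto
  also have "\<dots> \<le> 2 ^ k * m" using less_exp[of k] by simp
  also have "\<dots> = 2 ^ a" unfolding m_def using ka by (simp flip: power_add)
  finally have "card A' \<le> 2 ^ a" .
  moreover have "2 powr (\<alpha> * N + real D) \<le> card {x \<in> codes N. \<forall>i\<in>{1..k}. h i x \<in> A'}"
  proof -
    have "real m / (2 * 2 ^ n) = 2 powr (real a - k - n - 1)"
      unfolding m_def using ka by (simp add: real_two_power powr_diff of_nat_diff)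
    then have "(real m / (2 * 2 ^ n)) ^ k * 2 ^ N = 2 powr ((real a - k - n - 1) * k + N)"
      by (simp add: real_two_power powr_add powr_powr[symmetric] powr_realpow[symmetric])
    moreover have "\<alpha> * N + real D \<le> (real a - k - n - 1) * k + N" using 1 by (simp add: algebra_simps)
    ultimately have "2 powr (\<alpha> * N + real D) \<le> (real m / (2 * 2 ^ n)) ^ k * 2 ^ N" by simp
    also note A2
    also have "card {x \<in> codes N. \<forall>i\<in>{1..k}. h i x \<in> A i}
        \<le> card {x \<in> codes N. \<forall>i\<in>{1..k}. h i x \<in> A'}"
      unfolding A'_def by (intro card_mono) auto
    finally show ?thesis by simp
  qed
  ultimately show ?thesis using A'Y by blast
qed

text \<open>\<open>D\<close> stands for all additive constants of an alleged extraction. The length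
  \<open>N\<close> is only bounded below, because an injective \<open>f\<close> may relate it to
  \<open>n\<close> in any way.\<close>

definition compressible :: "nat \<Rightarrow> real \<Rightarrow> real \<Rightarrow> bool" where
  "compressible k \<alpha> \<beta> \<longleftrightarrow> (\<forall>D :: nat. \<exists>n0. \<forall>n\<ge>n0. \<forall>N\<ge>n0. \<forall>h.
     (\<forall>i\<in>{1..k}. h i \<in> codes N \<rightarrow> codes n) \<longrightarrow>
     (\<exists>A\<subseteq>codes n. card A \<le> 2 ^ (nat \<lfloor>\<beta> * n\<rfloor> - D) \<and>
        2 powr (\<alpha> * N + real D) \<le> card {x \<in> codes N. \<forall>i\<in>{1..k}. h i x \<in> A}))"

lemma eventually_ge_real_of_nat:
  fixes c C :: real
  assumes "0 < c" obtains n0 where "\<And>n. n \<ge> n0 \<Longrightarrow> C \<le> c * real n"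
proof -
  obtain n0 :: nat where "C / c \<le> n0" using real_arch_simple by blast
  then have "C \<le> c * real n0" using assms by (simp add: pos_divide_le_eq mult.commute)
  moreover have "c * real n0 \<le> c * real n" if "n \<ge> n0" for n
    using that assms by (intro mult_left_mono) auto
  ultimately have "C \<le> c * real n" if "n \<ge> n0" for n
    using that order.trans by blast
  then show ?thesis using that by blast
qed

text \<open>For \<open>\<alpha> = 0\<close> constantly many inputs suffice, whatever the ratio of
  \<open>N\<close> to \<open>n\<close>, and a positive \<open>\<beta>\<close> leaves room for their
  outputs.\<close>

lemma compressible_alpha_zero:
  assumes "0 < \<beta>" shows "compressible k 0 \<beta>"
  unfolding compressible_def
proof
  fix D :: nat
  obtain n0 where n0: "\<And>n. n \<ge> n0 \<Longrightarrow> real (2 * D + k + 3) \<le> \<beta> * real n"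
    using eventually_ge_real_of_nat[OF assms] by blast
  show "\<exists>n0. \<forall>n\<ge>n0. \<forall>N\<ge>n0. \<forall>h. (\<forall>i\<in>{1..k}. h i \<in> codes N \<rightarrow> codes n) \<longrightarrow>
     (\<exists>A\<subseteq>codes n. card A \<le> 2 ^ (nat \<lfloor>\<beta> * n\<rfloor> - D) \<and>
        2 powr (0 * real N + real D) \<le> card {x \<in> codes N. \<forall>i\<in>{1..k}. h i x \<in> A})"
  proof (intro exI[of _ "max n0 (D + 1)"] allI impI)
    fix n N :: nat and h
    assume n: "n \<ge> max n0 (D + 1)" and N: "N \<ge> max n0 (D + 1)"
      and h: "\<forall>i\<in>{1..k}. h i \<in> codes N \<rightarrow> codes n"
    have "real (D + 1 + k) \<le> nat \<lfloor>\<beta> * n\<rfloor> - D" using n0[of n] n by simp linarith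
    then show "\<exists>A\<subseteq>codes n. card A \<le> 2 ^ (nat \<lfloor>\<beta> * n\<rfloor> - D) \<and>
        2 powr (0 * real N + real D) \<le> card {x \<in> codes N. \<forall>i\<in>{1..k}. h i x \<in> A}"
      using h N by (intro ex_outputs_of_arbitrary_inputs) auto
  qed
qed

lemma compressible_one:
  assumes "0 < \<alpha>" "\<alpha> < \<beta>" "\<beta> \<le> 1" shows "compressible 1 \<alpha> \<beta>"
  unfolding compressible_def
proof
  fix D :: nat
  define C where "C = 2 * real D + 3"
  define C' where "C' = 2 * real D + 3"
  obtain n1 where n1: "\<And>n. n \<ge> n1 \<Longrightarrow> (1 - \<alpha>) * C + \<alpha> * C' \<le> (\<beta> - \<alpha>) * real n"
    using eventually_ge_real_of_nat[of "\<beta> - \<alpha>"] assms by auto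
  obtain n2 where n2: "\<And>n. n \<ge> n2 \<Longrightarrow> D + 3 \<le> \<beta> * real n"
    using eventually_ge_real_of_nat[of "\<beta>"] assms by auto
  obtain n3 where n3: "\<And>n. n \<ge> n3 \<Longrightarrow> D + 1 \<le> (1 - \<alpha>) * real n"
    using eventually_ge_real_of_nat[of "1 - \<alpha>"] assms by auto
  show "\<exists>n0. \<forall>n\<ge>n0. \<forall>N\<ge>n0. \<forall>h. (\<forall>i\<in>{1..1::nat}. h i \<in> codes N \<rightarrow> codes n) \<longrightarrow>
     (\<exists>A\<subseteq>codes n. card A \<le> 2 ^ (nat \<lfloor>\<beta> * n\<rfloor> - D) \<and>
        2 powr (\<alpha> * N + real D) \<le> card {x \<in> codes N. \<forall>i\<in>{1..1::nat}. h i x \<in> A})"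
  proof (intro exI[of _ "max n1 (max n2 n3)"] allI impI)
    fix n N :: nat and h
    assume n: "n \<ge> max n1 (max n2 n3)" and N: "N \<ge> max n1 (max n2 n3)"
      and h: "\<forall>i\<in>{1..1::nat}. h i \<in> codes N \<rightarrow> codes n"
    define a where "a = nat \<lfloor>\<beta> * n\<rfloor> - D"
    have a: "real a \<le> \<beta> * n - D" "\<beta> * n - D - 1 \<le> a"
      unfolding a_def using n2[of n] n by linarith+
    have "\<beta> * n \<le> 1 * real n" using assms by (intro mult_right_mono) auto
    then have an: "a \<le> n" using a by linarith
    have ka: "1 \<le> a" using a n2[of n] n by linarith
    have "\<exists>A\<subseteq>codes n. card A \<le> 2 ^ a \<and>
        2 powr (\<alpha> * N + real D) \<le> card {x \<in> codes N. \<forall>i\<in>{1..1::nat}. h i x \<in> A}"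
    proof (cases "\<alpha> * N \<le> \<beta> * n - C")
      case True
      have "D + 1 \<le> (1 - \<alpha>) * N" using n3[of N] N by simp
      then show ?thesis
        using h True a assms unfolding C_def
        by (intro ex_outputs_of_arbitrary_inputs) (auto simp: algebra_simps)
    next
      case False
      \<comment> \<open>Since \<open>(1 - \<alpha>) \<beta> - \<alpha> (1 - \<beta>) = \<beta> -
        \<alpha>\<close>, leaving the first range puts \<open>N\<close> into the second one, with a
        surplus \<open>(\<beta> - \<alpha>) n\<close> that pays for both constants.\<close>
      then have "(1 - \<alpha>) * (\<beta> * n - C) \<le> (1 - \<alpha>) * (\<alpha> * N)"
        using assms by (intro mult_left_mono) auto
      moreover have "(1 - \<alpha>) * C + \<alpha> * C' \<le> (\<beta> - \<alpha>) * real n" using n1[of n] n by simp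
      ultimately have "\<alpha> * ((1 - \<beta>) * n + C') \<le> \<alpha> * ((1 - \<alpha>) * N)"
        by (simp add: algebra_simps)
      then have "(1 - \<beta>) * n + C' \<le> (1 - \<alpha>) * N" using assms by simp
      then show ?thesis
        using h a an ka unfolding C'_def
        by (intro ex_popular_outputs) (auto simp: algebra_simps)
    qed
    then show "\<exists>A\<subseteq>codes n. card A \<le> 2 ^ (nat \<lfloor>\<beta> * n\<rfloor> - D) \<and>
        2 powr (\<alpha> * N + real D) \<le> card {x \<in> codes N. \<forall>i\<in>{1..1::nat}. h i x \<in> A}"
      unfolding a_def .
  qed
qed

text \<open>Here \<open>\<alpha> k (1 - \<beta>) = (1 - \<alpha>) \<beta>\<close>, so the two simple
  ranges leave only boundedly many \<open>N\<close> for each \<open>n\<close>. For these, with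
  \<open>m\<close> close to \<open>2 ^ (\<beta> n)\<close>, the product
  \<open>2 ^ N * m ^ (k - 1)\<close> is within a constant factor of \<open>2 ^ (n k)\<close>, as
  \<open>dense_family\<close> requires; its gain \<open>2 ^ T\<close> compensates for all
  constants.\<close>

lemma compressible_critical:
  assumes "0 < \<alpha>" "\<alpha> < 1" "2 \<le> k" and \<beta>: "\<beta> * (1 + (real k - 1) * \<alpha>) = k * \<alpha>"
  shows "compressible k \<alpha> \<beta>"
  unfolding compressible_def
proof
  fix D :: nat
  have den: "0 < 1 + (real k - 1) * \<alpha>" using assms(1-3) by (intro add_pos_nonneg) auto
  have \<beta>0: "0 < \<beta>"
  proof (rule ccontr)
    assume "\<not> 0 < \<beta>"
    then have "\<beta> * (1 + (real k - 1) * \<alpha>) \<le> 0" using den by (simp add: mult_nonpos_nonneg)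
    moreover have "0 < k * \<alpha>" using assms by simp
    ultimately show False using \<beta> by linarith
  qed
  have \<beta>1: "\<beta> < 1"
  proof (rule ccontr)
    assume "\<not> \<beta> < 1"
    then have "1 * (1 + (real k - 1) * \<alpha>) \<le> \<beta> * (1 + (real k - 1) * \<alpha>)"
      using den by (intro mult_right_mono) auto
    then show False using \<beta> assms(2) by (simp add: algebra_simps)
  qed
  \<comment> \<open>\<open>C\<close> and \<open>C'\<close> collect the constants required for
    arbitrary inputs and for popular outputs, including the loss of at most \<open>D + 1\<close> in
    \<open>a\<close>.\<close>
  define C where "C = 2 * real D + 2 + k"
  define C' where "C' = D + k * (real D + k + 2)"
  \<comment> \<open>\<open>G\<close> comes from the lower end of the remaining window,
    \<open>\<alpha> N > \<beta> n - C\<close>, and bounds the defect in density. \<open>T\<close>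
    comes from the upper end and is the gain needed there.\<close>
  define G where "G = nat \<lceil>C / \<alpha> + (real D + 1 + k) * (real k - 1)\<rceil>"
  define T where "T = nat \<lceil>\<alpha> * C' / (1 - \<alpha>) + 2 * real D + k + 1\<rceil>"
  have G: "C / \<alpha> + (real D + 1 + k) * (real k - 1) \<le> G" unfolding G_def by linarith
  have T: "\<alpha> * C' / (1 - \<alpha>) + 2 * real D + k + 1 \<le> T" unfolding T_def by linarith
  have pos: "0 < 1 / (2 :: real) ^ G" "1 \<le> (2 :: nat) ^ T" by simp_all
  obtain \<eta> :: real where \<eta>: "0 < \<eta>" "\<And>(X :: nat set) (Y :: nat set) h m. finite X \<Longrightarrow> finite Y \<Longrightarrow> Y \<noteq> {} \<Longrightarrow>
    (\<And>i. i \<in> {1..k} \<Longrightarrow> h i \<in> X \<rightarrow> Y) \<Longrightarrow> 2 ^ T \<le> m \<Longrightarrow> real m \<le> \<eta> * real (card Y) \<Longrightarrow>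
    1 / 2 ^ G * real (card Y) ^ k \<le> real (card X) * real m ^ (k - 1) \<Longrightarrow>
    \<exists>A\<subseteq>Y. card A \<le> k * m \<and> m * 2 ^ T \<le> card {x \<in> X. \<forall>i\<in>{1..k}. h i x \<in> A}"
    by (fact dense_family[OF pos assms(3)])
  obtain n1 where n1: "\<And>n. n \<ge> n1 \<Longrightarrow> real (D + 2 + k + T) \<le> \<beta> * real n"
    using eventually_ge_real_of_nat[OF \<beta>0] by blast
  obtain n2 where n2: "\<And>n. n \<ge> n2 \<Longrightarrow> D + 1 \<le> (1 - \<alpha>) * real n"
    using eventually_ge_real_of_nat[of "1 - \<alpha>"] assms by auto
  obtain n3 where n3: "\<And>n. n \<ge> n3 \<Longrightarrow> - log 2 \<eta> \<le> (1 - \<beta>) * real n"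
    using eventually_ge_real_of_nat[of "1 - \<beta>"] \<beta>1 by auto
  show "\<exists>n0. \<forall>n\<ge>n0. \<forall>N\<ge>n0. \<forall>h. (\<forall>i\<in>{1..k}. h i \<in> codes N \<rightarrow> codes n) \<longrightarrow>
     (\<exists>A\<subseteq>codes n. card A \<le> 2 ^ (nat \<lfloor>\<beta> * n\<rfloor> - D) \<and>
        2 powr (\<alpha> * N + real D) \<le> card {x \<in> codes N. \<forall>i\<in>{1..k}. h i x \<in> A})"
  proof (intro exI[of _ "max n1 (max n2 n3)"] allI impI)
    fix n N :: nat and h
    assume n: "n \<ge> max n1 (max n2 n3)" and N: "N \<ge> max n1 (max n2 n3)"
      and h: "\<forall>i\<in>{1..k}. h i \<in> codes N \<rightarrow> codes n"
    define a where "a = nat \<lfloor>\<beta> * n\<rfloor> - D"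
    have n1': "D + 2 + k + T \<le> \<beta> * n" using n1[of n] n by simp
    have a: "real a \<le> \<beta> * n - D" "\<beta> * n - D - 1 \<le> a"
      unfolding a_def using n1' by linarith+
    have "\<beta> * n \<le> 1 * real n" using \<beta>1 by (intro mult_right_mono) auto
    then have an: "a \<le> n" using a by linarith
    have ka: "k + T \<le> a" using a n1' by linarith
    have "\<exists>A\<subseteq>codes n. card A \<le> 2 ^ a \<and>
        2 powr (\<alpha> * N + real D) \<le> card {x \<in> codes N. \<forall>i\<in>{1..k}. h i x \<in> A}"
    proof (cases "\<alpha> * N \<le> \<beta> * n - C \<or> k * (1 - \<beta>) * n + C' \<le> (1 - \<alpha>) * N")
      case True
      then show ?thesis
      proof
        assume 1: "\<alpha> * N \<le> \<beta> * n - C"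
        have "D + 1 \<le> (1 - \<alpha>) * N" using n2[of N] N by simp
        then show ?thesis
          using h 1 a assms unfolding C_def
          by (intro ex_outputs_of_arbitrary_inputs) (auto simp: algebra_simps)
      next
        assume 1: "k * (1 - \<beta>) * n + C' \<le> (1 - \<alpha>) * N"
        have "real k * (real n - a + k + 1) \<le> real k * (real n - (\<beta> * n - D - 1) + k + 1)"
          using a(2) by (intro mult_left_mono) auto
        then have "\<alpha> * N + D + real k * (real n - a + k + 1) \<le> N"
          using 1 unfolding C'_def by (simp add: algebra_simps)
        then show ?thesis
          using h an ka by (intro ex_popular_outputs) auto
      qed
    next
      case False
      then have lo: "\<beta> * n - C < \<alpha> * N" and hi: "(1 - \<alpha>) * N < k * (1 - \<beta>) * n + C'" by auto
      define m where "m = (2::nat) ^ (a - k)"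
      have "2 ^ T \<le> m" unfolding m_def using ka by simp
      moreover have "real m \<le> \<eta> * real (card (codes n))"
      proof -
        have "real m \<le> 2 powr (real a)" unfolding m_def by (simp add: powr_realpow)
        also have "\<dots> \<le> 2 powr (log 2 \<eta> + n)"
        proof -
          have "- log 2 \<eta> \<le> (1 - \<beta>) * real n" using n3[of n] n by simp
          then have "real a \<le> log 2 \<eta> + n" using a(1) by (simp add: algebra_simps)
          then show ?thesis by simp
        qed
        also have "\<dots> = \<eta> * 2 ^ n" using \<eta>(1) by (simp add: powr_add powr_realpow)
        finally show ?thesis by simp
      qed
      moreover have "1 / 2 ^ G * real (card (codes n)) ^ k \<le> real (card (codes N)) * real m ^ (k - 1)"
      proof -
        \<comment> \<open>The critical equation divided by \<open>\<alpha>\<close>; in the exponent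
          it compares \<open>2 ^ (n k)\<close> with \<open>2 ^ N\<close> and
          \<open>m ^ (k - 1)\<close>.\<close>
        have "real n * k = \<beta> * n / \<alpha> + (real k - 1) * \<beta> * n"
        proof -
          have "\<alpha> * (real n * k) = \<beta> * n + \<alpha> * ((real k - 1) * \<beta> * n)"
            using arg_cong[OF \<beta>, of "\<lambda>u. u * n"] by (simp add: algebra_simps)
          then show ?thesis using assms(1) by (simp add: field_simps)
        qed
        also have "\<beta> * n / \<alpha> \<le> N + C / \<alpha>" using lo assms(1) by (simp add: field_simps)
        also have "(real k - 1) * \<beta> * n \<le> (real k - 1) * (real a - k) + (real D + 1 + k) * (real k - 1)"
        proof -
          have "(real k - 1) * (\<beta> * n) \<le> (real k - 1) * (real a + D + 1)"
            using a(2) assms(3) by (intro mult_left_mono) auto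
          then show ?thesis by (simp add: algebra_simps)
        qed
        finally have "real n * k - G \<le> N + (real k - 1) * (real a - k)" using G by linarith
        then have "2 powr (real n * k - G) \<le> 2 powr (N + (real k - 1) * (real a - k))" by simp
        moreover have "2 powr (real n * k - G) = 1 / 2 ^ G * real (card (codes n)) ^ k"
          by (simp add: powr_diff real_two_power powr_powr[symmetric] powr_realpow[symmetric])
        moreover have "2 powr (N + (real k - 1) * (real a - k)) = real (card (codes N)) * real m ^ (k - 1)"
          unfolding m_def using ka assms(3)
          by (simp add: powr_add real_two_power of_nat_diff powr_realpow[symmetric] powr_powr mult.commute)
        ultimately show ?thesis by simp
      qed
      ultimately obtain A where A: "A \<subseteq> codes n" "card A \<le> k * m"
        "m * 2 ^ T \<le> card {x \<in> codes N. \<forall>i\<in>{1..k}. h i x \<in> A}"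
        using \<eta>(2)[of "codes N" "codes n" h m] h by auto
      note A(2)
      also have "k * m \<le> 2 ^ k * m" using less_exp[of k] by simp
      also have "\<dots> = 2 ^ a" unfolding m_def using ka by (simp flip: power_add)
      finally have "card A \<le> 2 ^ a" .
      moreover have "2 powr (\<alpha> * N + real D) \<le> card {x \<in> codes N. \<forall>i\<in>{1..k}. h i x \<in> A}"
      proof -
        have "\<alpha> * ((1 - \<alpha>) * N) \<le> \<alpha> * (k * (1 - \<beta>) * n + C')"
          using hi assms(1) by (intro mult_left_mono) auto
        also have "\<alpha> * (k * (1 - \<beta>) * n) = (1 - \<alpha>) * (\<beta> * n)"
          using arg_cong[OF \<beta>, of "\<lambda>u. u * n"] by (simp add: algebra_simps)
        then have "\<alpha> * (k * (1 - \<beta>) * n + C') = (1 - \<alpha>) * (\<beta> * n + \<alpha> * C' / (1 - \<alpha>))"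
          using assms(2) by (simp add: distrib_left)
        finally have "(1 - \<alpha>) * (\<alpha> * N) \<le> (1 - \<alpha>) * (\<beta> * n + \<alpha> * C' / (1 - \<alpha>))"
          by (simp add: mult_ac)
        then have "\<alpha> * N \<le> \<beta> * n + \<alpha> * C' / (1 - \<alpha>)"
          by (rule mult_left_le_imp_le) (use assms(2) in simp)
        then have "\<alpha> * N + D \<le> real (a - k + T)" using T a(2) ka by (simp add: of_nat_diff)
        then have "2 powr (\<alpha> * N + real D) \<le> 2 powr real (a - k + T)" by simp
        also have "\<dots> = real (m * 2 ^ T)" unfolding m_def by (simp only: powr_realpow) (simp add: power_add)
        also have "\<dots> \<le> card {x \<in> codes N. \<forall>i\<in>{1..k}. h i x \<in> A}" using A(3) by (rule of_nat_mono)
        finally show ?thesis .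
      qed
      ultimately show ?thesis using A(1) by blast
    qed
    then show "\<exists>A\<subseteq>codes n. card A \<le> 2 ^ (nat \<lfloor>\<beta> * n\<rfloor> - D) \<and>
        2 powr (\<alpha> * N + real D) \<le> card {x \<in> codes N. \<forall>i\<in>{1..k}. h i x \<in> A}"
      unfolding a_def .
  qed
qed

section \<open>From compressible outputs to the failure of extraction\<close>

lemma inj_nat_eventually_ge:
  fixes f :: "nat \<Rightarrow> nat"
  assumes "inj f" shows "\<exists>n1. \<forall>n\<ge>n1. c \<le> f n"
proof -
  have "finite (f -` {..<c})" using assms by (intro finite_vimageI) auto
  then obtain n1 where "\<forall>n\<in>f -` {..<c}. n < n1" using finite_nat_set_iff_bounded by auto
  then show ?thesis by (intro exI[of _ n1]) (auto simp: not_less[symmetric])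
qed

lemma EXT_I:
  assumes "\<alpha> \<in> {0..1}" "\<beta> \<in> {0..1}" "inj f" "computable_nat f"
    and "\<And>i. i \<in> {1..k} \<Longrightarrow> computable_str (\<Gamma> i)"
    and "\<And>n \<sigma> i. length \<sigma> = f n \<Longrightarrow> i \<in> {1..k} \<Longrightarrow> length (\<Gamma> i \<sigma>) = n"
    and "\<And>n \<sigma>. length \<sigma> = f n \<Longrightarrow> \<alpha> * real (f n) + real d \<le> real (plain_complexity U \<sigma>) \<Longrightarrow>
      \<exists>i\<in>{1..k}. \<beta> * real n - real d \<le> real (plain_complexity U (\<Gamma> i \<sigma>))"
  shows "(\<alpha>, \<beta>) \<in> EXT U k"
proof -
  have "(\<forall>i\<in>{1..k}. length (\<Gamma> i \<sigma>) = n) \<and>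
     (real (plain_complexity U \<sigma>) \<ge> \<alpha> * real (length \<sigma>) + real d \<longrightarrow>
        (\<exists>i\<in>{1..k}. real (plain_complexity U (\<Gamma> i \<sigma>)) \<ge> \<beta> * real (length (\<Gamma> i \<sigma>)) - real d))"
    if "length \<sigma> = f n" for n \<sigma>
    using assms(6)[OF that] assms(7)[OF that] that by fastforce
  then show ?thesis unfolding EXT_def mem_Collect_eq prod.case using assms(1-5) by blast
qed

lemma EXT_E:
  assumes "(\<alpha>, \<beta>) \<in> EXT U k"
  obtains f \<Gamma> d where "\<alpha> \<in> {0..1}" "\<beta> \<in> {0..1}" "inj f" "computable_nat f"
    "\<And>i. i \<in> {1..k} \<Longrightarrow> computable_str (\<Gamma> i)"
    "\<And>n \<sigma> i. length \<sigma> = f n \<Longrightarrow> i \<in> {1..k} \<Longrightarrow> length (\<Gamma> i \<sigma>) = n"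
    "\<And>n \<sigma>. length \<sigma> = f n \<Longrightarrow> \<alpha> * real (f n) + real d \<le> real (plain_complexity U \<sigma>) \<Longrightarrow>
      \<exists>i\<in>{1..k}. \<beta> * real n - real d \<le> real (plain_complexity U (\<Gamma> i \<sigma>))"
proof -
  from assms obtain f \<Gamma> d where 1: "\<alpha> \<in> {0..1}" "\<beta> \<in> {0..1}" "inj f" "computable_nat f"
    "\<And>i. i \<in> {1..k} \<Longrightarrow> computable_str (\<Gamma> i)"
    and 2: "\<And>n \<sigma>. length \<sigma> = f n \<Longrightarrow> (\<forall>i\<in>{1..k}. length (\<Gamma> i \<sigma>) = n) \<and>
     (real (plain_complexity U \<sigma>) \<ge> \<alpha> * real (length \<sigma>) + real d \<longrightarrow>
        (\<exists>i\<in>{1..k}. real (plain_complexity U (\<Gamma> i \<sigma>)) \<ge> \<beta> * real (length (\<Gamma> i \<sigma>)) - real d))"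
    unfolding EXT_def mem_Collect_eq prod.case by blast
  show ?thesis
  proof (rule that[of f \<Gamma> d])
    fix n and \<sigma> :: str assume l: "length \<sigma> = f n"
    show "length (\<Gamma> i \<sigma>) = n" if "i \<in> {1..k}" for i using 2[OF l] that by blast
    show "\<exists>i\<in>{1..k}. \<beta> * real n - real d \<le> real (plain_complexity U (\<Gamma> i \<sigma>))"
      if "\<alpha> * real (f n) + real d \<le> real (plain_complexity U \<sigma>)"
      using 2[OF l] that l by fastforce
  qed (use 1 in auto)
qed

text \<open>Restricting the output length to powers of a fixed base \<open>B\<close> makes the length \<open>n\<close> computable
  from \<open>a \<approx> \<beta> n\<close> even if \<open>\<beta>\<close> is not computable. Maximising the number of inputs likewise avoids any
  reference to \<open>\<alpha>\<close>.\<close>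

lemma not_EXT_if_compressible:
  assumes U: "optimal_machine U" and comp: "compressible k \<alpha> \<beta>" and \<beta>: "0 < \<beta>" "\<beta> \<le> 1"
    and \<alpha>: "0 \<le> \<alpha>"
  shows "(\<alpha>, \<beta>) \<notin> EXT U k"
proof
  assume mem: "(\<alpha>, \<beta>) \<in> EXT U k"
  obtain f \<Gamma> d where "\<alpha> \<in> {0..1}" "\<beta> \<in> {0..1}" and "inj f" and f: "computable_nat f"
    and \<Gamma>: "\<And>i. i \<in> {1..k} \<Longrightarrow> computable_str (\<Gamma> i)"
    and len: "\<And>n \<sigma> i. length \<sigma> = f n \<Longrightarrow> i \<in> {1..k} \<Longrightarrow> length (\<Gamma> i \<sigma>) = n"
    and ext: "\<And>n \<sigma>. length \<sigma> = f n \<Longrightarrow> \<alpha> * real (f n) + real d \<le> real (plain_complexity U \<sigma>) \<Longrightarrow>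
      \<exists>i\<in>{1..k}. \<beta> * real n - real d \<le> real (plain_complexity U (\<Gamma> i \<sigma>))"
    by (fact EXT_E[OF mem])
  define \<gamma> where "\<gamma> i x = str_encode (\<Gamma> i (str_decode x))" for i x
  have \<gamma>: "computable_nat (\<lambda>x. \<gamma> i (g x))" if "i \<in> {1..k}" "computable_nat g" for i g
    using \<Gamma> that computable_nat_comp[of "\<gamma> i" g] unfolding computable_str_iff \<gamma>_def by blast
  \<comment> \<open>With \<open>\<beta> B \<ge> 2\<close>, the number \<open>a\<close>, about
    \<open>\<beta> n\<close> for \<open>n = B ^ Suc i\<close>, still exceeds \<open>B ^ i\<close>.
    Hence \<open>pw\<close>, which rounds up to a power of \<open>B\<close>, recovers
    \<open>n\<close> from \<open>a\<close>.\<close>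
  define B where "B = nat \<lceil>2 / \<beta>\<rceil> + 2"
  have "2 / \<beta> \<le> B" unfolding B_def by linarith
  then have B: "2 \<le> \<beta> * B" using \<beta> by (simp add: pos_divide_le_eq mult.commute)
  have B2: "2 \<le> B" unfolding B_def by simp
  have B_gt: "i < B ^ i" for i
    using less_exp[of i] power_mono[OF B2, of i] by linarith
  define pw where "pw a = B ^ (LEAST i. a \<le> B ^ i)" for a
  have "computable_nat pw"
    unfolding pw_def by (intro computable_intros computable_nat_Least) (meson B_gt less_imp_le)
  then have pw: "computable_nat (\<lambda>x. pw (g x))" if "computable_nat g" for g
    using that by (rule computable_nat_comp)
  have f': "computable_nat (\<lambda>x. f (g x))" if "computable_nat g" for g
    using f that by (rule computable_nat_comp)
  define out where "out n z = {y. y < 2 ^ Suc n \<and> (slen y = n \<and> y \<in> bits z)}" for n z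
  define inp where "inp n z = {x. x < 2 ^ Suc (f n) \<and> (slen x = f n \<and> (\<forall>i\<in>{1..k}. \<gamma> i x \<in> bits z))}"
    for n z
  have out: "out n z = {y \<in> codes n. y \<in> bits z}" for n z
    using codes_subset[of n] unfolding out_def codes_def by auto
  have inp: "inp n z = {x \<in> codes (f n). \<forall>i\<in>{1..k}. \<gamma> i x \<in> bits z}" for n z
    using codes_subset[of "f n"] unfolding inp_def codes_def by auto
  have card_out: "computable_nat (\<lambda>v. card (out (n v) (z v)))"
    if "computable_nat n" "computable_nat z" for n z
    unfolding out_def
    by (intro computable_intros decidable_mem_bits computable_nat_slen that
        computable_nat_comp[OF that(1)] computable_nat_comp[OF that(2)])
  have card_inp: "computable_nat (\<lambda>v. card (inp (n v) (z v)))"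
    if "computable_nat n" "computable_nat z" for n z
    unfolding inp_def
    by (intro computable_intros decidable_ball finite_atLeastAtMost decidable_mem_bits
        computable_nat_slen f' \<gamma> that computable_nat_comp[OF that(1)] computable_nat_comp[OF that(2)])
  \<comment> \<open>Among the sets of at most \<open>2 ^ a\<close> outputs, \<open>z\<close> codes
    one that captures the most inputs. Every set of outputs has a code below the bound on
    \<open>z'\<close>, so optimality is decidable.\<close>
  define good where "good a z \<longleftrightarrow> card (out (pw a) z) \<le> 2 ^ a \<and>
    (\<forall>z'<2 ^ 2 ^ Suc (pw a). card (out (pw a) z') \<le> 2 ^ a \<longrightarrow>
       card (inp (pw a) z') \<le> card (inp (pw a) z))" for a z
  have good: "decidable (\<lambda>v. good (pfst v) (psnd v))"
    unfolding good_def by (intro computable_intros card_out card_inp pw)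
  have ex_good: "\<exists>z. good a z" for a
  proof -
    define F where "F = {z. z < 2 ^ 2 ^ Suc (pw a) \<and> card (out (pw a) z) \<le> 2 ^ a}"
    have "out (pw a) 0 = {}" unfolding out_def bits_def by simp
    then have "0 \<in> F" unfolding F_def by simp
    moreover have "finite F" unfolding F_def by simp
    ultimately have "Max ((\<lambda>z. card (inp (pw a) z)) ` F) \<in> (\<lambda>z. card (inp (pw a) z)) ` F"
      by (intro Max_in) auto
    then obtain z where z: "z \<in> F" "card (inp (pw a) z) = Max ((\<lambda>z. card (inp (pw a) z)) ` F)" by auto
    have "card (inp (pw a) z') \<le> card (inp (pw a) z)" if "z' \<in> F" for z'
      unfolding z(2) using that \<open>finite F\<close> by (intro Max_ge) auto
    then have "good a z" using z(1) unfolding good_def F_def by blast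
    then show ?thesis ..
  qed
  define Z where "Z a = (LEAST z. good a z)" for a
  have "computable_nat Z" unfolding Z_def by (intro computable_nat_Least good ex_good)
  then have Zc: "computable_nat (\<lambda>x. Z (g x))" if "computable_nat g" for g
    using that by (rule computable_nat_comp)
  have Z: "good a (Z a)" for a unfolding Z_def using ex_good by (rule LeastI_ex)
  define Q where "Q a y s \<longleftrightarrow> y < 2 ^ Suc (pw a) \<and> slen y = pw a \<and> y \<in> bits (Z a)" for a y s :: nat
  have Q: "decidable (\<lambda>v. Q (pfst v) (pfst (psnd v)) (psnd (psnd v)))"
    unfolding Q_def by (intro computable_intros computable_nat_slen decidable_mem_bits pw Zc)
  have Q_out: "{y. \<exists>s. Q a y s} = out (pw a) (Z a)" for a
    unfolding Q_def out_def by auto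
  obtain c where c: "\<And>m x s. finite {x. \<exists>s. Q m x s} \<Longrightarrow> card {x. \<exists>s. Q m x s} \<le> 2 ^ m \<Longrightarrow> Q m x s \<Longrightarrow>
    plain_complexity U (str_decode x) \<le> m + c"
    by (fact plain_complexity_enumerable[OF U Q])
  have low: "plain_complexity U (str_decode y) \<le> a + c" if "y \<in> out (pw a) (Z a)" for a y
  proof -
    have "Q a y 0" using that Q_out[of a] unfolding Q_def by blast
    moreover have "finite (out (pw a) (Z a))" unfolding out_def by simp
    moreover have "card (out (pw a) (Z a)) \<le> 2 ^ a" using Z[of a] unfolding good_def by blast
    ultimately show ?thesis using c[of a y 0] unfolding Q_out by blast
  qed
  \<comment> \<open>Outputs in the computed set have complexity at most
    \<open>a + c \<le> \<beta> n - D + c\<close>, which is below \<open>\<beta> n - d\<close>. The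
    margin also covers the rounding of \<open>\<alpha> N + d\<close>.\<close>
  define D where "D = c + d + 2"
  obtain n0 where n0: "\<forall>n\<ge>n0. \<forall>N\<ge>n0. \<forall>h. (\<forall>i\<in>{1..k}. h i \<in> codes N \<rightarrow> codes n) \<longrightarrow>
     (\<exists>A\<subseteq>codes n. card A \<le> 2 ^ (nat \<lfloor>\<beta> * n\<rfloor> - D) \<and>
        2 powr (\<alpha> * N + real D) \<le> card {x \<in> codes N. \<forall>i\<in>{1..k}. h i x \<in> A})"
    using comp[unfolded compressible_def, THEN spec[where x = D]] by (elim exE)
  obtain n1 where n1: "\<And>n. n \<ge> n1 \<Longrightarrow> n0 \<le> f n"
    using inj_nat_eventually_ge[OF \<open>inj f\<close>] by blast
  define i where "i = n0 + n1 + D + 2"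
  define n where "n = B ^ Suc i"
  define a where "a = nat \<lfloor>\<beta> * n\<rfloor> - D"
  define N where "N = f n"
  have Bi: "i < B ^ i" by (rule B_gt)
  have "2 * real B ^ i \<le> (\<beta> * B) * real B ^ i" using B by (intro mult_right_mono) auto
  then have \<beta>n: "2 * real (B ^ i) \<le> \<beta> * n" unfolding n_def by (simp add: mult_ac)
  then have a: "real a \<le> \<beta> * n - D" "\<beta> * n - D - 1 \<le> a"
    unfolding a_def using Bi unfolding i_def by linarith+
  have aB: "B ^ i < a" using a(2) \<beta>n Bi unfolding i_def by linarith
  have "\<beta> * n \<le> 1 * real n" using \<beta> by (intro mult_right_mono) auto
  then have an: "a \<le> B ^ Suc i" using a(1) unfolding n_def by linarith
  have "(LEAST i. a \<le> B ^ i) = Suc i"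
  proof (rule Least_equality)
    fix j assume "a \<le> B ^ j"
    then have "B ^ i < B ^ j" using aB by linarith
    then have "i < j" by (rule power_less_imp_less_exp[rotated]) (use B2 in simp)
    then show "Suc i \<le> j" by simp
  qed (rule an)
  then have pwa: "pw a = n" unfolding pw_def n_def by simp
  have "n > Suc i" unfolding n_def by (rule B_gt)
  then have nn: "n \<ge> n0" "n \<ge> n1" unfolding i_def by auto
  have maps: "\<gamma> i \<in> codes N \<rightarrow> codes n" if "i \<in> {1..k}" for i
    using len[OF _ that] unfolding codes_def N_def \<gamma>_def by auto
  have "n0 \<le> N" unfolding N_def by (rule n1[OF nn(2)])
  from n0[rule_format, OF nn(1) this, of \<gamma>] maps obtain A where A: "A \<subseteq> codes n" "card A \<le> 2 ^ a"
    "2 powr (\<alpha> * N + real D) \<le> card {x \<in> codes N. \<forall>i\<in>{1..k}. \<gamma> i x \<in> A}"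
    unfolding a_def by blast
  \<comment> \<open>The set \<open>A\<close> need not be found effectively: as a competitor of
    \<open>Z a\<close> it forces the latter to capture at least as many inputs.\<close>
  have "A \<subseteq> {..<2 ^ Suc n}" using A(1) codes_subset[of n] by blast
  then obtain z where z: "z < 2 ^ 2 ^ Suc n" "\<And>y. y < 2 ^ Suc n \<Longrightarrow> y \<in> bits z \<longleftrightarrow> y \<in> A"
    using ex_bits by blast
  have zA: "y \<in> bits z \<longleftrightarrow> y \<in> A" if "y \<in> codes n" for y
    using that codes_subset[of n] z(2) by blast
  have "out n z = A" unfolding out using zA A(1) by blast
  moreover have "inp n z = {x \<in> codes N. \<forall>i\<in>{1..k}. \<gamma> i x \<in> A}"
    unfolding inp N_def[symmetric] using zA maps by blast
  ultimately have "card {x \<in> codes N. \<forall>i\<in>{1..k}. \<gamma> i x \<in> A} \<le> card (inp n (Z a))"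
    using Z[of a] z(1) A(2) unfolding good_def pwa by metis
  with A(3) have large: "2 powr (\<alpha> * N + real D) \<le> card (inp n (Z a))" by linarith
  have "\<exists>x\<in>inp n (Z a). \<alpha> * N + d \<le> plain_complexity U (str_decode x)"
  proof (rule ccontr)
    assume neg: "\<not> ?thesis"
    define b where "b = nat \<lceil>\<alpha> * N + d\<rceil>"
    have "0 \<le> \<alpha> * N + d" using \<alpha> by simp
    then have b: "\<alpha> * N + d \<le> b" "b \<le> \<alpha> * N + D" unfolding b_def D_def by linarith+
    have "str_decode ` inp n (Z a) \<subseteq> {s. plain_complexity U s < b}"
      using neg b(1) by fastforce
    then have "card (str_decode ` inp n (Z a)) \<le> card {s. plain_complexity U s < b}"
      using card_low_complexity(1)[OF U] by (rule card_mono[rotated])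
    also have "\<dots> < 2 ^ b" by (rule card_low_complexity(2)[OF U])
    also have "card (str_decode ` inp n (Z a)) = card (inp n (Z a))"
      by (intro card_image inj_on_inverseI[of _ str_encode]) simp
    finally have "real (card (inp n (Z a))) < 2 powr b" by (simp add: powr_realpow)
    also have "\<dots> \<le> 2 powr (\<alpha> * N + D)" using b(2) by simp
    finally show False using large by simp
  qed
  then obtain x where x: "x \<in> inp n (Z a)" "\<alpha> * N + d \<le> plain_complexity U (str_decode x)" by blast
  have lx: "length (str_decode x) = f n" using x(1) unfolding inp codes_def by simp
  obtain i where i: "i \<in> {1..k}"
    "\<beta> * n - d \<le> plain_complexity U (\<Gamma> i (str_decode x))"
    using ext[OF lx] x(2) unfolding N_def by blast
  have "\<gamma> i x \<in> out n (Z a)"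
    using x(1) i(1) maps[OF i(1)] unfolding inp out N_def[symmetric] by blast
  then have "plain_complexity U (str_decode (\<gamma> i x)) \<le> a + c" using low[of "\<gamma> i x" a] pwa by simp
  then have "plain_complexity U (\<Gamma> i (str_decode x)) \<le> a + c" unfolding \<gamma>_def by simp
  then show False using i(2) a(1) unfolding D_def by simp
qed

text \<open>Reduces failure above the critical value to failure at it.\<close>

lemma EXT_mono:
  assumes mem: "(\<alpha>, \<beta>) \<in> EXT U k" and le: "\<alpha> \<le> \<alpha>'" "\<alpha>' \<le> 1" "0 \<le> \<beta>'" "\<beta>' \<le> \<beta>"
  shows "(\<alpha>', \<beta>') \<in> EXT U k"
  using mem
proof (rule EXT_E)
  fix f \<Gamma> d
  assume ab: "\<alpha> \<in> {0..1}" "\<beta> \<in> {0..1}" and *: "inj f" "computable_nat f"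
    "\<And>i. i \<in> {1..k} \<Longrightarrow> computable_str (\<Gamma> i)"
    "\<And>n \<sigma> i. length \<sigma> = f n \<Longrightarrow> i \<in> {1..k} \<Longrightarrow> length (\<Gamma> i \<sigma>) = n"
    and ext: "\<And>n \<sigma>. length \<sigma> = f n \<Longrightarrow> \<alpha> * real (f n) + real d \<le> real (plain_complexity U \<sigma>) \<Longrightarrow>
      \<exists>i\<in>{1..k}. \<beta> * real n - real d \<le> real (plain_complexity U (\<Gamma> i \<sigma>))"
  show ?thesis
  proof (rule EXT_I[where f = f and \<Gamma> = \<Gamma> and d = d])
    fix n \<sigma> assume l: "length \<sigma> = f n"
      and C: "\<alpha>' * real (f n) + real d \<le> real (plain_complexity U \<sigma>)"
    have "\<alpha> * real (f n) \<le> \<alpha>' * real (f n)" using le by (intro mult_right_mono) auto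
    with C obtain i where i: "i \<in> {1..k}" "\<beta> * real n - real d \<le> real (plain_complexity U (\<Gamma> i \<sigma>))"
      using ext[OF l] by fastforce
    have "\<beta>' * real n \<le> \<beta> * real n" using le by (intro mult_right_mono) auto
    with i show "\<exists>i\<in>{1..k}. \<beta>' * real n - real d \<le> real (plain_complexity U (\<Gamma> i \<sigma>))"
      by (intro bexI[of _ i]) auto
  qed (use ab le * in auto)
qed

lemma EXT_if_le:
  assumes "0 \<le> \<beta>" "\<beta> \<le> \<alpha>" "\<alpha> \<le> 1" "1 \<le> k"
  shows "(\<alpha>, \<beta>) \<in> EXT U k"
proof (rule EXT_I[where f = "\<lambda>n. n" and \<Gamma> = "\<lambda>_ s. s" and d = 0])
  show "computable_str (\<lambda>s. s)" by (simp add: computable_str_iff computable_nat_id)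
  fix n and \<sigma> :: str
  assume "\<alpha> * real n + real 0 \<le> real (plain_complexity U \<sigma>)"
  moreover have "\<beta> * real n \<le> \<alpha> * real n" using assms by (intro mult_right_mono) auto
  ultimately show "\<exists>i\<in>{1..k}. \<beta> * real n - real 0 \<le> real (plain_complexity U \<sigma>)"
    using assms by (intro bexI[of _ 1]) auto
qed (use assms computable_nat_id in auto)

section \<open>Extraction by random tables\<close>

text \<open>\<open>n ^ n / n!\<close> is one term of the exponential series at \<open>n\<close>, and
  \<open>e \<le> 4\<close>. With this crude Stirling bound, choosing \<open>2 ^ m\<close> inputs out
  of \<open>2 ^ N\<close> costs at most \<open>N - m + 2\<close> bits for each.\<close>

lemma self_power_le_fact: "n ^ n \<le> 4 ^ n * (fact n :: nat)"
proof -
  have "real n ^ n / fact n \<le> exp (real n)"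
  proof -
    have "(\<Sum>i\<in>{n}. real n ^ i /\<^sub>R fact i) \<le> (\<Sum>i. real n ^ i /\<^sub>R fact i)"
      by (intro sum_le_suminf summable_exp_generic) auto
    then show ?thesis by (simp add: exp_def divide_inverse mult.commute)
  qed
  also have "exp (real n) = exp 1 ^ n" by (simp add: exp_of_nat_mult[symmetric])
  also have "\<dots> \<le> 4 ^ n" using exp_le by (intro power_mono) auto
  finally have "real n ^ n \<le> 4 ^ n * fact n" by (simp add: pos_divide_le_eq)
  then have "real (n ^ n) \<le> real (4 ^ n * fact n)" by simp
  then show ?thesis by (simp only: of_nat_le_iff)
qed

text \<open>In logarithms divided by \<open>2 ^ m\<close>, choosing the inputs costs
  \<open>N - m + 2\<close>, choosing the outputs less than \<open>1\<close> by \<open>nb\<close>,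
  and restricting their table entries saves \<open>k (n - b)\<close>. This is the origin of the
  summand \<open>3\<close>.\<close>

lemma table_union_bound:
  assumes nb: "n * 2 ^ b < 2 ^ m" and N: "N + 3 + k * b \<le> k * n + m" and "m \<le> N" "b \<le> n"
  shows "((2::nat) ^ n choose 2 ^ b) * (2 ^ N choose 2 ^ m) * ((2 ^ b) ^ (k * 2 ^ m))
    < (2 ^ n) ^ (k * 2 ^ m)"
proof -
  define T where "T = (2::nat) ^ m"
  have "T ^ T * (2 ^ N choose T) \<le> 4 ^ T * fact T * (2 ^ N choose T)"
    using self_power_le_fact[of T] by (rule mult_right_mono) simp
  also have "\<dots> \<le> 4 ^ T * (2 ^ N) ^ T"
    using binomial_fact_pow[of "2 ^ N" T] by (simp add: mult_ac)
  finally have 1: "(2::nat) ^ (m * T) * (2 ^ N choose T) \<le> 2 ^ (2 * T + N * T)"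
    unfolding T_def by (simp add: power_mult power_add)
  have 2: "((2::nat) ^ n choose 2 ^ b) \<le> 2 ^ (n * 2 ^ b)"
    using binomial_le_pow[of "2 ^ b" "2 ^ n"] \<open>b \<le> n\<close> by (simp add: power_mult)
  have "(2::nat) ^ (m * T) * ((2 ^ n choose 2 ^ b) * (2 ^ N choose T) * (2 ^ b) ^ (k * T))
     = (2 ^ n choose 2 ^ b) * (2 ^ (m * T) * (2 ^ N choose T)) * 2 ^ (b * (k * T))"
    by (subst power_mult[of 2 b "k * T"]) (simp only: mult_ac)
  also have "\<dots> \<le> 2 ^ (n * 2 ^ b) * 2 ^ (2 * T + N * T) * 2 ^ (b * (k * T))"
    using 1 2 by (intro mult_mono) auto
  also have "\<dots> = 2 ^ (n * 2 ^ b + (2 * T + N * T) + b * (k * T))" by (simp only: power_add)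
  also have "\<dots> < 2 ^ (m * T + n * (k * T))"
  proof -
    have "(N + 3 + k * b) * T \<le> (k * n + m) * T" using N by (rule mult_right_mono) simp
    then have "n * 2 ^ b + (2 * T + N * T) + b * (k * T) < m * T + n * (k * T)"
      using nb unfolding T_def[symmetric] by (simp add: algebra_simps)
    then show ?thesis by simp
  qed
  also have "\<dots> = 2 ^ (m * T) * (2 ^ n) ^ (k * T)" by (simp add: power_add power_mult)
  finally show ?thesis unfolding T_def by simp
qed

lemma ex_table:
  fixes n N b m k :: nat
  assumes nb: "n * 2 ^ b < 2 ^ m" and N: "N + 3 + k * b \<le> k * n + m" and "b \<le> n"
  shows "\<exists>G :: nat \<Rightarrow> nat \<Rightarrow> nat. (\<forall>i<k. \<forall>x<2 ^ N. G i x < 2 ^ n) \<and>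
    (\<forall>A\<subseteq>{..<2 ^ n}. card A \<le> 2 ^ b \<longrightarrow> card {x. x < 2 ^ N \<and> (\<forall>i<k. G i x \<in> A)} < 2 ^ m)"
proof (cases "m \<le> N")
  case False
  have "card {x. x < (2::nat) ^ N \<and> P x} < 2 ^ m" for P
  proof -
    have "card {x. x < (2::nat) ^ N \<and> P x} \<le> card {..<(2::nat) ^ N}" by (intro card_mono) auto
    also have "\<dots> < 2 ^ m" using False by simp
    finally show ?thesis .
  qed
  then show ?thesis by (intro exI[of _ "\<lambda>_ _. 0"]) auto
next
  case True
  define X where "X = {..<(2::nat) ^ N}"
  define Y where "Y = {..<(2::nat) ^ n}"
  define I where "I = {..<k} \<times> X"
  \<comment> \<open>Tables that send all of \<open>B\<close> into \<open>A\<close> under each of the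
    \<open>k\<close> functions. Entries for inputs outside \<open>B\<close> are free;
    \<open>r\<close> below counts these choices.\<close>
  define Bad where "Bad A B = (\<Pi>\<^sub>E p\<in>I. if snd p \<in> B then A else Y)" for A B
  define \<A> where "\<A> = {A. A \<subseteq> Y \<and> card A = 2 ^ b}"
  define \<B> where "\<B> = {B. B \<subseteq> X \<and> card B = 2 ^ m}"
  have fin: "finite X" "finite Y" "finite I" unfolding X_def Y_def I_def by auto
  have finAB: "finite \<A>" "finite \<B>" unfolding \<A>_def \<B>_def using fin by auto
  have cA: "card \<A> = 2 ^ n choose 2 ^ b" unfolding \<A>_def using n_subsets[OF fin(2)] by (simp add: Y_def)
  have cB: "card \<B> = 2 ^ N choose 2 ^ m" unfolding \<B>_def using n_subsets[OF fin(1)] by (simp add: X_def)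
  define r where "r = (2 ^ n :: nat) ^ (k * (2 ^ N - 2 ^ m))"
  have cBad: "card (Bad A B) = (2 ^ b) ^ (k * 2 ^ m) * r" if "A \<in> \<A>" "B \<in> \<B>" for A B
  proof -
    have B: "B \<subseteq> X" "card B = 2 ^ m" "finite B" and A: "card A = 2 ^ b"
      using that fin finite_subset unfolding \<A>_def \<B>_def by auto
    have "card (Bad A B) = (\<Prod>p\<in>I. card (if snd p \<in> B then A else Y))"
      unfolding Bad_def by (intro card_PiE fin)
    also have "\<dots> = (\<Prod>i<k. \<Prod>x\<in>X. card (if x \<in> B then A else Y))"
      unfolding I_def prod.cartesian_product by (simp add: split_def)
    also have "(\<Prod>x\<in>X. card (if x \<in> B then A else Y))
        = (\<Prod>x\<in>X - B. card Y) * (\<Prod>x\<in>B. card A)"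
      using B fin by (subst prod.subset_diff[OF B(1)]) auto
    also have "\<dots> = (2 ^ n) ^ (2 ^ N - 2 ^ m) * (2 ^ b) ^ (2 ^ m)"
      using A B by (simp add: card_Diff_subset X_def Y_def)
    finally show ?thesis unfolding r_def
      by (simp add: power_mult[symmetric] power_mult_distrib mult_ac)
  qed
  have "card (\<Union>A\<in>\<A>. \<Union>B\<in>\<B>. Bad A B) \<le> (\<Sum>A\<in>\<A>. card (\<Union>B\<in>\<B>. Bad A B))"
    by (intro card_UN_le finAB)
  also have "\<dots> \<le> (\<Sum>A\<in>\<A>. \<Sum>B\<in>\<B>. card (Bad A B))"
    by (intro sum_mono card_UN_le finAB)
  also have "\<dots> = (\<Sum>A\<in>\<A>. \<Sum>B\<in>\<B>. (2 ^ b) ^ (k * 2 ^ m) * r)"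
    by (intro sum.cong refl cBad)
  also have "\<dots> = (2 ^ n choose 2 ^ b) * (2 ^ N choose 2 ^ m) * ((2 ^ b) ^ (k * 2 ^ m)) * r"
    by (simp add: cA cB)
  also have "\<dots> < (2 ^ n) ^ (k * 2 ^ m) * r"
    using table_union_bound[OF nb N True \<open>b \<le> n\<close>] unfolding r_def by (intro mult_strict_right_mono) auto
  also have "\<dots> = (2 ^ n) ^ (k * 2 ^ N)"
  proof -
    have "k * 2 ^ m + k * (2 ^ N - 2 ^ m) = k * (2::nat) ^ N"
      using True by (simp add: distrib_left[symmetric])
    then show ?thesis unfolding r_def by (simp only: power_add[symmetric])
  qed
  also have "\<dots> = card (\<Pi>\<^sub>E p\<in>I. Y)"
    using fin by (subst card_PiE) (simp_all add: I_def X_def Y_def card_cartesian_product)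
  finally have less: "card (\<Union>A\<in>\<A>. \<Union>B\<in>\<B>. Bad A B) < card (\<Pi>\<^sub>E p\<in>I. Y)" .
  have "finite (Bad A B)" if "A \<in> \<A>" for A B
  proof -
    have "finite A" using that fin(2) finite_subset unfolding \<A>_def by blast
    then show ?thesis unfolding Bad_def using fin by (intro finite_PiE) auto
  qed
  then have "finite (\<Union>A\<in>\<A>. \<Union>B\<in>\<B>. Bad A B)" using finAB by blast
  then have "\<not> (\<Pi>\<^sub>E p\<in>I. Y) \<subseteq> (\<Union>A\<in>\<A>. \<Union>B\<in>\<B>. Bad A B)"
    using less card_mono not_less by blast
  then obtain g where g: "g \<in> (\<Pi>\<^sub>E p\<in>I. Y)" "\<And>A B. A \<in> \<A> \<Longrightarrow> B \<in> \<B> \<Longrightarrow> g \<notin> Bad A B" by blast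
  show ?thesis
  proof (intro exI[of _ "\<lambda>i x. g (i, x)"] conjI allI impI)
    show "g (i, x) < 2 ^ n" if "i < k" "x < 2 ^ N" for i x
      using g(1) that unfolding I_def X_def Y_def by (auto simp: PiE_def Pi_def)
    fix A assume A: "A \<subseteq> {..<(2::nat) ^ n}" "card A \<le> 2 ^ b"
    show "card {x. x < 2 ^ N \<and> (\<forall>i<k. g (i, x) \<in> A)} < 2 ^ m"
    proof (rule ccontr)
      assume "\<not> ?thesis"
      then obtain B where B: "B \<subseteq> {x. x < 2 ^ N \<and> (\<forall>i<k. g (i, x) \<in> A)}" "card B = 2 ^ m"
        by (meson not_less obtain_subset_with_card_n)
      \<comment> \<open>Only sets of exactly \<open>2 ^ b\<close> outputs were counted, so smaller
        ones are enlarged; \<open>b \<le> n\<close> leaves room.\<close>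
      obtain A' where A': "A \<subseteq> A'" "A' \<subseteq> Y" "card A' = 2 ^ b"
        using exists_subset_between[of A "2 ^ b" Y] A \<open>b \<le> n\<close> by (auto simp: Y_def)
      have "A' \<in> \<A>" "B \<in> \<B>" using A' B unfolding \<A>_def \<B>_def X_def by auto
      moreover have "g \<in> Bad A' B"
        using g(1) A'(1) B(1) unfolding Bad_def I_def by (fastforce simp: PiE_def Pi_def)
      ultimately show False using g(2) by blast
    qed
  qed
qed

text \<open>With \<open>e = n div w\<close> this gives \<open>n < w * Suc e < 2 ^ e\<close> for
  large \<open>n\<close>: a factor \<open>n\<close> is absorbed by a small linear increase of the
  exponent.\<close>

lemma times_Suc_less_power: "2 * w \<le> e \<Longrightarrow> w * Suc e < 2 ^ e"
proof -
  assume "2 * w \<le> e"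
  have "e * Suc e < 2 * 2 ^ e"
  proof (induction e)
    case (Suc e)
    have "Suc e \<le> 2 ^ e" by (simp add: Suc_le_eq less_exp)
    then show ?case using Suc by simp
  qed simp
  moreover have "2 * w * Suc e \<le> e * Suc e" using \<open>2 * w \<le> e\<close> by (rule mult_right_mono) simp
  ultimately show ?thesis by linarith
qed

text \<open>The integers make all sizes computable: inputs have length \<open>N\<close> about
  \<open>(R / w) n\<close>, outputs count as low below complexity about
  \<open>(u / w) n \<ge> \<beta> n\<close>, and fewer than \<open>2 ^ m\<close> inputs have only low
  outputs, with \<open>m\<close> about \<open>(v / w) n \<le> \<alpha> N\<close>. The slack reads
  \<open>N - m < k (n - m)\<close> in these rates, and \<open>u < v\<close> keeps the set of low
  outputs cheap to choose.\<close>

lemma EXT_if_rational_slack: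
  fixes u v w R k :: nat and \<alpha> \<beta> :: real
  assumes U: "optimal_machine U"
    and \<alpha>: "0 \<le> \<alpha>" "\<alpha> \<le> 1" and \<beta>: "0 \<le> \<beta>" "\<beta> \<le> 1"
    and uv: "u < v" and wR: "w \<le> R" and vR: "v \<le> \<alpha> * R" and uw: "\<beta> * w \<le> u"
    and slack: "R + k * v < k * w + v"
  shows "(\<alpha>, \<beta>) \<in> EXT U k"
proof -
  define F where "F n = R * n div w" for n
  define b where "b n = u * n div w" for n
  define m where "m n = v * n div w" for n
  have "\<alpha> * R \<le> 1 * real R" using \<alpha> by (intro mult_right_mono) auto
  then have "v \<le> R" using vR by linarith
  then have "k * v < k * w" using slack by linarith
  then have vw: "v < w" by simp
  then have w0: "0 < w" by simp
  have F_Suc: "F n < F (Suc n)" for n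
  proof -
    have "Suc (F n) = (R * n + w) div w" unfolding F_def using w0 by simp
    also have "\<dots> \<le> F (Suc n)" unfolding F_def using wR by (intro div_le_mono) simp
    finally show ?thesis by simp
  qed
  then have F_mono: "strict_mono F" by (simp add: strict_mono_Suc_iff)
  have F_ge: "n \<le> F n" for n using F_mono by (rule strict_mono_imp_increasing)
  \<comment> \<open>The first summand gives \<open>n < 2 ^ (n div w)\<close>; the second absorbs,
    after multiplication by \<open>w\<close>, the constant \<open>3\<close> and the rounding of
    \<open>m n\<close>.\<close>
  define n0 where "n0 = 2 * w * w + 4 * w"
  have b_le: "b n \<le> n" for n
  proof -
    have "b n \<le> w * n div w" unfolding b_def using uv vw by (intro div_le_mono mult_right_mono) auto
    then show ?thesis using w0 by simp
  qed
  have table: "\<exists>G :: nat \<Rightarrow> nat \<Rightarrow> nat. (\<forall>i<k. \<forall>x<2 ^ F n. G i x < 2 ^ n) \<and>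
    (\<forall>A\<subseteq>{..<2 ^ n}. card A \<le> 2 ^ b n \<longrightarrow> card {x. x < 2 ^ F n \<and> (\<forall>i<k. G i x \<in> A)} < 2 ^ m n)"
    if n: "n0 \<le> n" for n
  proof (rule ex_table)
    define e where "e = n div w"
    have "2 * w * w \<le> n" "4 * w \<le> n" using n unfolding n0_def by auto
    then have "2 * w \<le> e" unfolding e_def using w0 by (simp add: less_eq_div_iff_mult_less_eq)
    then have "w * Suc e < 2 ^ e" by (rule times_Suc_less_power)
    moreover have "n < w * Suc e" unfolding e_def using w0 by (simp add: dividend_less_times_div)
    ultimately have "n < 2 ^ e" by linarith
    then have "n * 2 ^ b n < 2 ^ e * 2 ^ b n" by simp
    also have "\<dots> = 2 ^ (e + b n)" by (simp add: power_add)
    also have "\<dots> \<le> 2 ^ m n"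
    proof -
      have "e + b n \<le> (n + u * n) div w"
        unfolding less_eq_div_iff_mult_less_eq[OF w0] e_def b_def add_mult_distrib
        by (intro add_mono div_times_less_eq_dividend)
      also have "\<dots> \<le> m n" unfolding m_def using uv mult_le_mono1[of "Suc u" v n]
        by (intro div_le_mono) simp
      finally show ?thesis by simp
    qed
    finally show "n * 2 ^ b n < 2 ^ m n" .
    have "w * F n \<le> R * n" "w * b n \<le> u * n" unfolding F_def b_def by simp_all
    then have "w * F n + 3 * w + k * (w * b n) \<le> R * n + 3 * w + k * (u * n)"
      by (intro add_mono mult_le_mono2) auto
    then have "w * (F n + 3 + k * b n) \<le> R * n + 3 * w + k * (u * n)"
      by (simp add: algebra_simps)
    also have "\<dots> + w \<le> k * w * n + v * n"
    proof -
      have "k * u \<le> k * v" using uv by simp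
      then have "R + k * u + 1 \<le> k * w + v" using slack by linarith
      then have "(R + k * u + 1) * n \<le> (k * w + v) * n" by (rule mult_right_mono) simp
      then show ?thesis using \<open>4 * w \<le> n\<close> by (simp add: algebra_simps)
    qed
    also have "v * n < w * m n + w"
      unfolding m_def using w0 by (metis dividend_less_times_div mult_Suc_right add.commute)
    finally have "w * (F n + 3 + k * b n) < w * (k * n + m n)" by (simp add: algebra_simps)
    then show "F n + 3 + k * b n \<le> k * n + m n" by simp
    show "b n \<le> n" by (rule b_le)
  qed
  \<comment> \<open>\<open>z\<close> is a table of \<open>k\<close> consecutive blocks of
    \<open>2 ^ F n\<close> entries in base \<open>2 ^ n\<close>. The bound on \<open>A\<close>
    covers all sets of table values.\<close>
  define good where "good n z \<longleftrightarrow> (\<forall>A<2 ^ 2 ^ n. card {y. y < 2 ^ n \<and> y \<in> bits A} \<le> 2 ^ b n \<longrightarrow>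
    card {x. x < 2 ^ F n \<and> (\<forall>i<k. digit (2 ^ n) z (i * 2 ^ F n + x) \<in> bits A)} < 2 ^ m n)" for n z
  have good: "decidable (\<lambda>z. n0 \<le> pfst z \<longrightarrow> good (pfst z) (psnd z))"
    unfolding good_def F_def b_def m_def
    by (intro computable_intros decidable_mem_bits computable_nat_digit)
  have ex_good: "\<exists>z. n0 \<le> n \<longrightarrow> good n z" for n
  proof (cases "n0 \<le> n")
    case True
    then obtain G :: "nat \<Rightarrow> nat \<Rightarrow> nat" where G: "\<And>i x. i < k \<Longrightarrow> x < 2 ^ F n \<Longrightarrow> G i x < 2 ^ n"
      "\<And>A. A \<subseteq> {..<2 ^ n} \<Longrightarrow> card A \<le> 2 ^ b n \<Longrightarrow>
        card {x. x < 2 ^ F n \<and> (\<forall>i<k. G i x \<in> A)} < 2 ^ m n"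
      using table by meson
    define r where "r j = G (j div 2 ^ F n) (j mod 2 ^ F n)" for j
    have "r j < 2 ^ n" if "j < k * 2 ^ F n" for j
      unfolding r_def using that by (intro G(1)) (simp_all add: less_mult_imp_div_less)
    then obtain z where z: "\<forall>j<k * 2 ^ F n. digit (2 ^ n) z j = r j"
      using ex_digits[of "k * 2 ^ F n" r "2 ^ n"] by blast
    have zG: "digit (2 ^ n) z (i * 2 ^ F n + x) = G i x" if "i < k" "x < 2 ^ F n" for i x
    proof -
      have "i * 2 ^ F n + x < Suc i * 2 ^ F n" using that by simp
      also have "\<dots> \<le> k * 2 ^ F n" using that by (intro mult_right_mono) auto
      finally show ?thesis using z that unfolding r_def by simp
    qed
    have "good n z"
      unfolding good_def
    proof (intro allI impI)
      fix A assume "card {y. y < 2 ^ n \<and> y \<in> bits A} \<le> 2 ^ b n"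
      then have "card {x. x < 2 ^ F n \<and> (\<forall>i<k. G i x \<in> {y. y < 2 ^ n \<and> y \<in> bits A})} < 2 ^ m n"
        by (intro G(2)) auto
      also have "{x. x < 2 ^ F n \<and> (\<forall>i<k. G i x \<in> {y. y < 2 ^ n \<and> y \<in> bits A})} =
        {x. x < 2 ^ F n \<and> (\<forall>i<k. digit (2 ^ n) z (i * 2 ^ F n + x) \<in> bits A)}"
        using zG G(1) by auto
      finally show "card {x. x < 2 ^ F n \<and> (\<forall>i<k. digit (2 ^ n) z (i * 2 ^ F n + x) \<in> bits A)} < 2 ^ m n" .
    qed
    then show ?thesis by blast
  qed simp
  \<comment> \<open>Below \<open>n0\<close> no good table is guaranteed; the guard then makes every
    \<open>z\<close> admissible, so the search is total.\<close>
  define Z where "Z n = (LEAST z. n0 \<le> n \<longrightarrow> good n z)" for n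
  have "computable_nat Z" unfolding Z_def by (intro computable_nat_Least good ex_good)
  then have Zc: "computable_nat (\<lambda>x. Z (g x))" if "computable_nat g" for g
    using that by (rule computable_nat_comp)
  have Z: "good n (Z n)" if "n0 \<le> n" for n
    using LeastI_ex[OF ex_good[of n]] that unfolding Z_def by blast
  define idx where "idx l = (LEAST n. l \<le> F n)" for l
  have "computable_nat idx"
    unfolding idx_def F_def[abs_def]
    by (intro computable_nat_Least computable_intros) (use F_ge in \<open>auto simp: F_def\<close>)
  then have idxc: "computable_nat (\<lambda>x. idx (g x))" if "computable_nat g" for g
    using that by (rule computable_nat_comp)
  have idx: "idx (F n) = n" for n
    unfolding idx_def by (rule Least_equality) (use F_mono in \<open>auto simp: strict_mono_less_eq\<close>)
  \<comment> \<open>The rank of \<open>x\<close> among the inputs of its length selects an entry of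
    block \<open>i\<close>, and that entry is the rank of the output among the strings of length
    \<open>n\<close>. On lengths outside the range of \<open>F\<close> this is still total.\<close>
  define \<gamma> where "\<gamma> i x = 2 ^ idx (slen x) - 1 +
    digit (2 ^ idx (slen x)) (Z (idx (slen x))) (i * 2 ^ F (idx (slen x)) + (x + 1 - 2 ^ slen x))" for i x
  have \<gamma>c: "computable_nat (\<lambda>x. \<gamma> (g x) (h x))" if "computable_nat g" "computable_nat h" for g h
    unfolding \<gamma>_def F_def
    by (intro computable_intros computable_nat_digit computable_nat_slen idxc Zc that)
  have slen_\<gamma>: "slen (\<gamma> i x) = idx (slen x)" for i x
  proof -
    have "digit (2 ^ l) z j < 2 ^ l" for l z j unfolding digit_def by simp
    then show ?thesis unfolding \<gamma>_def by (intro slen_eq) (auto simp: add.commute)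
  qed
  define \<Gamma> where "\<Gamma> i s = str_decode (\<gamma> (i - 1) (str_encode s))" for i s
  obtain g where g: "partial_recursive g" "\<And>s. g (str_encode s) = map_option str_encode (U s)"
    using U unfolding optimal_machine_def partial_computable_str_def by blast
  obtain Rg where Rg: "decidable (\<lambda>z. Rg (pfst z) (pfst (psnd z)) (psnd (psnd z)))"
    "\<And>x y. g x = Some y \<longleftrightarrow> (\<exists>s. Rg x y s)"
    using partial_recursive_graph[OF g(1)] by blast
  have U_iff: "U p = Some s \<longleftrightarrow> (\<exists>t. Rg (str_encode p) (str_encode s) t)" for p s
    unfolding Rg(2)[symmetric] g(2) by (auto dest: str_encode_inject)
  \<comment> \<open>The enumeration receives only \<open>l\<close>, while several \<open>n\<close>
    may share the same \<open>m n\<close>. At most \<open>w\<close> of them do, and setting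
    \<open>l = m n + w\<close> leaves a factor \<open>2 ^ w\<close> for them. The bounds on
    \<open>n\<close>, \<open>p\<close> and \<open>t\<close> keep the relation decidable.\<close>
  define Q where "Q l x s \<longleftrightarrow> (\<exists>n<w * Suc l. n0 \<le> n \<and> m n + w = l \<and> slen x = F n \<and>
    (\<forall>i<k. \<exists>p<s. \<exists>t<s. slen p < b n \<and> Rg p (\<gamma> i x) t))" for l x s
  have Q: "decidable (\<lambda>z. Q (pfst z) (pfst (psnd z)) (psnd (psnd z)))"
    unfolding Q_def F_def b_def m_def
    by (intro computable_intros computable_nat_slen decidable_comp3[OF Rg(1)] \<gamma>c)
  define Bad where "Bad n = {x \<in> codes (F n). \<forall>i<k. plain_complexity U (str_decode (\<gamma> i x)) < b n}" for n
  have card_Bad: "card (Bad n) \<le> 2 ^ m n" if n: "n0 \<le> n" for n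
  proof -
    define A where "A = {y. y < 2 ^ n \<and> plain_complexity U (str_decode (2 ^ n - 1 + y)) < b n}"
    have "A \<subseteq> {..<2 ^ n}" unfolding A_def by auto
    from ex_bits[OF this] obtain z where z: "z < 2 ^ 2 ^ n" "\<And>y. y < 2 ^ n \<Longrightarrow> y \<in> bits z \<longleftrightarrow> y \<in> A"
      by blast
    have "inj_on (\<lambda>y. str_decode (2 ^ n - 1 + y)) A"
      by (rule inj_onI) (metis add_left_cancel str_encode_decode)
    moreover have "(\<lambda>y. str_decode (2 ^ n - 1 + y)) ` A \<subseteq> {s. plain_complexity U s < b n}"
      unfolding A_def by auto
    ultimately have "card A \<le> card {s. plain_complexity U s < b n}"
      using card_low_complexity(1)[OF U] by (rule card_inj_on_le)
    also have "\<dots> < 2 ^ b n" by (rule card_low_complexity(2)[OF U])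
    also have "A = {y. y < 2 ^ n \<and> y \<in> bits z}" using z(2) unfolding A_def by auto
    finally have "card {x. x < 2 ^ F n \<and> (\<forall>i<k. digit (2 ^ n) (Z n) (i * 2 ^ F n + x) \<in> bits z)} < 2 ^ m n"
      using Z[OF n] z(1) unfolding good_def by auto
    moreover have "card (Bad n) \<le>
      card {x. x < 2 ^ F n \<and> (\<forall>i<k. digit (2 ^ n) (Z n) (i * 2 ^ F n + x) \<in> bits z)}"
    proof (rule card_inj_on_le[of "\<lambda>x. x + 1 - 2 ^ F n"])
      show "inj_on (\<lambda>x. x + 1 - 2 ^ F n) (Bad n)"
        by (rule inj_onI) (auto simp: Bad_def codes_eq)
      show "(\<lambda>x. x + 1 - 2 ^ F n) ` Bad n \<subseteq>
        {x. x < 2 ^ F n \<and> (\<forall>i<k. digit (2 ^ n) (Z n) (i * 2 ^ F n + x) \<in> bits z)}"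
      proof (intro image_subsetI CollectI conjI allI impI)
        fix x assume x: "x \<in> Bad n"
        then have x1: "x \<in> codes (F n)" unfolding Bad_def by simp
        then have "2 ^ F n \<le> x + 1" "x + 1 < 2 * 2 ^ F n"
          using slen_bounds[of x] unfolding codes_def by auto
        then show "x + 1 - 2 ^ F n < 2 ^ F n" by linarith
        fix i assume i: "i < k"
        have \<gamma>x: "\<gamma> i x = 2 ^ n - 1 + digit (2 ^ n) (Z n) (i * 2 ^ F n + (x + 1 - 2 ^ F n))"
          using x1 unfolding \<gamma>_def codes_def by (simp add: idx)
        have lt: "digit (2 ^ n) (Z n) (i * 2 ^ F n + (x + 1 - 2 ^ F n)) < 2 ^ n"
          unfolding digit_def by simp
        have "plain_complexity U (str_decode (\<gamma> i x)) < b n" using x i unfolding Bad_def by simp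
        then show "digit (2 ^ n) (Z n) (i * 2 ^ F n + (x + 1 - 2 ^ F n)) \<in> bits z"
          unfolding z(2)[OF lt] \<gamma>x A_def using lt by simp
      qed
    qed simp
    ultimately show ?thesis by simp
  qed
  have Q_Bad: "{x. \<exists>s. Q l x s} \<subseteq> (\<Union>n\<in>{n. n0 \<le> n \<and> m n + w = l}. Bad n)" for l
  proof
    fix x assume "x \<in> {x. \<exists>s. Q l x s}"
    then obtain n s where n: "n0 \<le> n" "m n + w = l" "slen x = F n"
      and ps: "\<And>i. i < k \<Longrightarrow> \<exists>p t. slen p < b n \<and> Rg p (\<gamma> i x) t"
      unfolding Q_def by blast
    have "plain_complexity U (str_decode (\<gamma> i x)) < b n" if i: "i < k" for i
    proof -
      obtain p t where p: "slen p < b n" "Rg p (\<gamma> i x) t" using ps[OF i] by blast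
      then have "U (str_decode p) = Some (str_decode (\<gamma> i x))" unfolding U_iff by auto
      from plain_complexity_le[of U, OF this] p(1) show ?thesis by simp
    qed
    then show "x \<in> (\<Union>n\<in>{n. n0 \<le> n \<and> m n + w = l}. Bad n)" using n unfolding Bad_def codes_def by blast
  qed
  have lengths: "finite {n. n0 \<le> n \<and> m n + w = l}" "card {n. n0 \<le> n \<and> m n + w = l} \<le> w" for l
  proof -
    \<comment> \<open>Equal \<open>m n\<close> means equal quotients of \<open>v * n\<close> by
      \<open>w\<close>, so the remainder determines \<open>n\<close>.\<close>
    have inj: "inj_on (\<lambda>n. v * n mod w) {n. n0 \<le> n \<and> m n + w = l}"
    proof (rule inj_onI)
      fix a c assume "a \<in> {n. n0 \<le> n \<and> m n + w = l}" "c \<in> {n. n0 \<le> n \<and> m n + w = l}"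
        and mods: "v * a mod w = v * c mod w"
      then have "v * a div w = v * c div w" unfolding m_def by auto
      with mods have "v * a = v * c" by (metis div_mult_mod_eq)
      then show "a = c" using uv by simp
    qed
    have sub: "(\<lambda>n. v * n mod w) ` {n. n0 \<le> n \<and> m n + w = l} \<subseteq> {..<w}" using w0 by auto
    show "finite {n. n0 \<le> n \<and> m n + w = l}" using inj_on_finite[OF inj sub] by simp
    show "card {n. n0 \<le> n \<and> m n + w = l} \<le> w" using card_inj_on_le[OF inj sub] by simp
  qed
  have fin_Q: "finite {x. \<exists>s. Q l x s}" for l
    by (rule finite_subset[OF Q_Bad]) (auto simp: lengths Bad_def)
  have card_Q: "card {x. \<exists>s. Q l x s} \<le> 2 ^ l" for l
  proof -
    have "card {x. \<exists>s. Q l x s} \<le> card (\<Union>n\<in>{n. n0 \<le> n \<and> m n + w = l}. Bad n)"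
      by (intro card_mono Q_Bad finite_UN_I lengths) (simp add: Bad_def)
    also have "\<dots> \<le> (\<Sum>n\<in>{n. n0 \<le> n \<and> m n + w = l}. card (Bad n))" by (intro card_UN_le lengths)
    also have "\<dots> \<le> (\<Sum>n\<in>{n. n0 \<le> n \<and> m n + w = l}. 2 ^ (l - w))"
      using card_Bad by (intro sum_mono) auto
    also have "\<dots> = card {n. n0 \<le> n \<and> m n + w = l} * 2 ^ (l - w)" by simp
    also have "\<dots> \<le> 2 ^ l"
    proof (cases "w \<le> l")
      case True
      have "card {n. n0 \<le> n \<and> m n + w = l} * 2 ^ (l - w) \<le> 2 ^ w * 2 ^ (l - w)"
        using lengths(2)[of l] less_exp[of w] by (intro mult_right_mono) linarith+
      also have "\<dots> = 2 ^ l" using True by (simp flip: power_add)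
      finally show ?thesis .
    next
      case False
      then have "{n. n0 \<le> n \<and> m n + w = l} = {}" by auto
      then show ?thesis by (simp only: card.empty)
    qed
    finally show ?thesis .
  qed
  obtain c where c: "\<And>m x s. finite {x. \<exists>s. Q m x s} \<Longrightarrow> card {x. \<exists>s. Q m x s} \<le> 2 ^ m \<Longrightarrow> Q m x s \<Longrightarrow>
    plain_complexity U (str_decode x) \<le> m + c"
    by (fact plain_complexity_enumerable[OF U Q])
  \<comment> \<open>\<open>n0\<close> makes the guarantee void for \<open>n < n0\<close>,
    \<open>c + w\<close> is what describing an input in \<open>Bad n\<close> costs beyond
    \<open>m n\<close>, and the rest is for rounding.\<close>
  define d where "d = n0 + c + w + 3"
  show ?thesis
  proof (rule EXT_I[where f = F and \<Gamma> = \<Gamma> and d = d])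
    show "inj F" using F_mono by (rule strict_mono_imp_inj_on)
    show "computable_nat F" unfolding F_def[abs_def] by (intro computable_intros)
    show "computable_str (\<Gamma> i)" for i
      unfolding computable_str_iff \<Gamma>_def by simp (intro \<gamma>c computable_intros)
    show "length (\<Gamma> i \<sigma>) = n" if "length \<sigma> = F n" for n \<sigma> i
      using that unfolding \<Gamma>_def by (simp add: slen_\<gamma> idx)
    fix n \<sigma> assume len: "length \<sigma> = F n"
      and C: "\<alpha> * real (F n) + real d \<le> real (plain_complexity U \<sigma>)"
    show "\<exists>i\<in>{1..k}. \<beta> * real n - real d \<le> real (plain_complexity U (\<Gamma> i \<sigma>))"
    proof (rule ccontr)
      assume neg: "\<not> ?thesis"
      have low: "real (plain_complexity U (str_decode (\<gamma> i (str_encode \<sigma>)))) < \<beta> * real n - real d"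
        if "i < k" for i
        using neg that unfolding \<Gamma>_def by (auto dest!: bspec[of _ _ "Suc i"])
      have "0 < k" using slack by (cases k) (use \<open>v \<le> R\<close> in auto)
      have n: "n0 \<le> n"
      proof (rule ccontr)
        assume "\<not> n0 \<le> n"
        moreover have "\<beta> * real n \<le> 1 * real n" using \<beta> by (intro mult_right_mono) auto
        moreover have "real d \<ge> n0" unfolding d_def by simp
        ultimately show False using low[OF \<open>0 < k\<close>] by linarith
      qed
      have real_div: "real a / w - 1 < real (a div w)" "real (a div w) \<le> real a / w" for a
        using w0 floor_divide_of_nat_eq[of a w, where ?'a = real] by linarith+
      \<comment> \<open>Because \<open>u / w \<ge> \<beta>\<close>, rounding \<open>b n\<close> down
        loses less than \<open>1\<close>; complexity below \<open>\<beta> n - d\<close> is thus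
        below \<open>b n\<close>.\<close>
      have "\<beta> * n \<le> u * n / w"
        using mult_right_mono[OF uw, of "real n"] w0 by (simp add: field_simps)
      then have b_ge: "\<beta> * n - 1 < b n" using real_div(1)[of "u * n"] unfolding b_def by simp
      have "\<forall>i. \<exists>pt. i < k \<longrightarrow> slen (fst pt) < b n \<and> Rg (fst pt) (\<gamma> i (str_encode \<sigma>)) (snd pt)"
      proof
        fix i
        show "\<exists>pt. i < k \<longrightarrow> slen (fst pt) < b n \<and> Rg (fst pt) (\<gamma> i (str_encode \<sigma>)) (snd pt)"
        proof (cases "i < k")
          case True
          obtain p where p: "U p = Some (str_decode (\<gamma> i (str_encode \<sigma>)))"
            "length p = plain_complexity U (str_decode (\<gamma> i (str_encode \<sigma>)))"
            using optimal_machine_program[OF U] .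
          have "1 \<le> real d" unfolding d_def by simp
          then have "length p < b n" using low[OF True] b_ge p(2) by linarith
          moreover obtain t where "Rg (str_encode p) (\<gamma> i (str_encode \<sigma>)) t"
            using p(1) unfolding U_iff by auto
          ultimately show ?thesis by (intro exI[of _ "(str_encode p, t)"]) simp
        qed simp
      qed
      from choice[OF this] obtain pt where pt: "\<And>i. i < k \<Longrightarrow>
        slen (fst (pt i)) < b n \<and> Rg (fst (pt i)) (\<gamma> i (str_encode \<sigma>)) (snd (pt i))" by blast
      define s where "s = Suc (\<Sum>i<k. fst (pt i) + snd (pt i))"
      have s: "fst (pt i) < s" "snd (pt i) < s" if "i < k" for i
        using member_le_sum[of i "{..<k}" "\<lambda>i. fst (pt i) + snd (pt i)"] that unfolding s_def by auto
      have "n < w * Suc (m n + w)"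
      proof -
        have "n div w \<le> m n" unfolding m_def using uv by (intro div_le_mono) simp
        then have "w * Suc (n div w) \<le> w * Suc (m n + w)" by (intro mult_left_mono) auto
        then show ?thesis using dividend_less_times_div[OF w0, of n] by (simp only: mult_Suc_right)
      qed
      moreover have "\<forall>i<k. \<exists>p<s. \<exists>t<s. slen p < b n \<and> Rg p (\<gamma> i (str_encode \<sigma>)) t"
        using pt s by blast
      ultimately have "Q (m n + w) (str_encode \<sigma>) s"
        unfolding Q_def using n len by (intro exI[of _ n]) simp
      from c[OF fin_Q card_Q this] have "plain_complexity U \<sigma> \<le> m n + w + c" by simp
      moreover have "m n \<le> \<alpha> * F n + 1"
      proof -
        have "real (m n) \<le> v * n / w" using real_div(2)[of "v * n"] unfolding m_def by simp
        also have "\<dots> \<le> \<alpha> * R * n / w"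
          using mult_right_mono[OF vR, of "real n"] by (intro divide_right_mono) simp_all
        also have "\<dots> = \<alpha> * (R * n / w)" by simp
        also have "\<dots> \<le> \<alpha> * (F n + 1)"
          using real_div(1)[of "R * n"] \<alpha> unfolding F_def by (intro mult_left_mono) auto
        finally show ?thesis using \<alpha> by (simp add: algebra_simps)
      qed
      ultimately show False using C unfolding d_def by simp
    qed
  qed (use \<alpha> \<beta> in auto)
qed

text \<open>The rates are \<open>z = R / w\<close>, \<open>y = u / w\<close> and
  \<open>x = v / w\<close> with \<open>\<beta> < y < x < \<alpha> z\<close>. Choosing
  \<open>z > \<beta> / \<alpha>\<close> leaves room for \<open>x\<close> and \<open>y\<close>, and
  \<open>z < \<rho>\<close> gives the slack. For \<open>\<beta> \<le> \<alpha>\<close> the identity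
  suffices; otherwise \<open>z > 1\<close>, as needed for strictly increasing input lengths.\<close>

lemma EXT_if_less_critical:
  assumes U: "optimal_machine U" and \<alpha>: "0 < \<alpha>" "\<alpha> < 1" and \<beta>: "0 \<le> \<beta>" and k: "1 \<le> k"
    and less: "\<beta> < real k * \<alpha> / (1 + (real k - 1) * \<alpha>)"
  shows "(\<alpha>, \<beta>) \<in> EXT U k"
proof (cases "\<beta> \<le> \<alpha>")
  case True
  then show ?thesis using \<alpha> \<beta> k by (intro EXT_if_le) auto
next
  case False
  define \<rho> where "\<rho> = real k / (1 + (real k - 1) * \<alpha>)"
  have den: "0 < 1 + (real k - 1) * \<alpha>" using \<alpha> k by (intro add_pos_nonneg) auto
  have "\<beta> / \<alpha> < \<rho>" using less \<alpha> unfolding \<rho>_def by (simp add: pos_divide_less_eq mult.commute)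
  then obtain z where z: "z \<in> \<rat>" "\<beta> / \<alpha> < z" "z < \<rho>" using Rats_dense_in_real by blast
  have "1 < \<beta> / \<alpha>" using False \<alpha> by (simp add: pos_less_divide_eq)
  then have z1: "1 < z" using z(2) by linarith
  have \<beta>z: "\<beta> < \<alpha> * z" using z(2) \<alpha> by (simp add: pos_divide_less_eq mult.commute)
  obtain y where y: "y \<in> \<rat>" "\<beta> < y" "y < \<alpha> * z" using Rats_dense_in_real[OF \<beta>z] by blast
  obtain x where x: "x \<in> \<rat>" "y < x" "x < \<alpha> * z" using Rats_dense_in_real[OF y(3)] by blast
  have ex_quot: "\<exists>a c :: nat. 0 < c \<and> q = real a / real c" if "q \<in> \<rat>" "0 < q" for q :: real
    using Rats_abs_nat_div_natE[OF that(1)] that(2) by (metis abs_of_pos neq0_conv)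
  obtain z1 z2 :: nat where zz: "0 < z2" "z = real z1 / z2" using ex_quot[OF z(1)] z1 by auto
  obtain y1 y2 :: nat where yy: "0 < y2" "y = real y1 / y2" using ex_quot[OF y(1)] y(2) \<beta> by auto
  obtain x1 x2 :: nat where xx: "0 < x2" "x = real x1 / x2" using ex_quot[OF x(1)] x(2) y(2) \<beta> by auto
  define w where "w = z2 * y2 * x2"
  define R where "R = z1 * y2 * x2"
  define u where "u = y1 * z2 * x2"
  define v where "v = x1 * z2 * y2"
  have w0: "0 < real w" unfolding w_def using zz xx yy by simp
  have R: "real R = z * w" and u: "real u = y * w" and v: "real v = x * w"
    unfolding R_def u_def v_def w_def using zz xx yy by simp_all
  show ?thesis
  proof (rule EXT_if_rational_slack[OF U])
    have "real u < real v" unfolding u v using x(2) w0 by simp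
    then show "u < v" by simp
    have "1 * real w \<le> real R" unfolding R using \<open>1 < z\<close> by (intro mult_right_mono) auto
    then show "w \<le> R" by simp
    show "v \<le> \<alpha> * R" unfolding v R using x(3) w0 by simp
    show "\<beta> * w \<le> u" unfolding u using y(2) by (intro mult_right_mono) auto
    show "R + k * v < k * w + v"
    proof -
      have "(real k - 1) * x \<le> (real k - 1) * (\<alpha> * z)" using x(3) k by (intro mult_left_mono) auto
      moreover have "z * (1 + (real k - 1) * \<alpha>) < k"
        using z(3) den unfolding \<rho>_def by (simp add: pos_less_divide_eq)
      ultimately have "z + (real k - 1) * x < k" by (simp add: algebra_simps)
      then have "(z + (real k - 1) * x) * w < k * real w" using w0 by (rule mult_strict_right_mono)
      then have "real (R + k * v) < real (k * w + v)" by (simp add: R v algebra_simps)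
      then show ?thesis by (simp only: of_nat_less_iff)
    qed
    have "real k * \<alpha> / (1 + (real k - 1) * \<alpha>) \<le> 1"
      using \<alpha> den by (simp add: pos_divide_le_eq algebra_simps)
    then show "\<beta> \<le> 1" using less by linarith
  qed (use \<alpha> \<beta> in auto)
qed

theorem theorem7:
  fixes U :: "str \<rightharpoonup> str" and k :: nat and \<alpha> \<beta> :: real
  assumes "optimal_machine U"
    and "k \<ge> 1"
    and "\<alpha> \<in> {0..1}" and "\<beta> \<in> {0..1}"
  shows "(\<alpha>, \<beta>) \<in> EXT U k \<longleftrightarrow>
    (k = 1 \<and> \<beta> \<le> \<alpha>) \<or>
    (k \<ge> 2 \<and> ((\<alpha> = 0 \<and> \<beta> = 0) \<or> (\<alpha> = 1 \<and> \<beta> = 1) \<or>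
       \<beta> < real k * \<alpha> / (1 + (real k - 1) * \<alpha>)))"
  (is "?L \<longleftrightarrow> ?R")
proof
  assume ?R
  then show ?L
  proof (elim disjE conjE)
    assume k: "k \<ge> 2" and less: "\<beta> < real k * \<alpha> / (1 + (real k - 1) * \<alpha>)"
    consider "\<alpha> = 0" | "\<alpha> = 1" | "0 < \<alpha>" "\<alpha> < 1" using assms(3) by fastforce
    then show ?L
    proof cases
      case 1
      then show ?thesis using less assms(4) by simp
    next
      case 2
      then show ?thesis using assms by (intro EXT_if_le) auto
    next
      case 3
      then show ?thesis using assms less by (intro EXT_if_less_critical) auto
    qed
  qed (use assms in \<open>auto intro!: EXT_if_le\<close>)
next
  assume L: ?L
  show ?R
  proof (rule ccontr)
    assume neg: "\<not> ?R"
    have \<alpha>: "0 \<le> \<alpha>" "\<alpha> \<le> 1" and \<beta>: "0 \<le> \<beta>" "\<beta> \<le> 1" using assms by auto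
    show False
    proof (cases "\<alpha> = 0")
      case True
      then have "0 < \<beta>" using neg assms(2) \<beta> by (cases "k = 1") auto
      then show False
        using L True \<beta> not_EXT_if_compressible[OF assms(1) compressible_alpha_zero] by auto
    next
      case False
      then have \<alpha>0: "0 < \<alpha>" using \<alpha> by simp
      show False
      proof (cases "k = 1")
        case True
        then have "\<alpha> < \<beta>" using neg by simp
        then show False
          using L True \<alpha>0 \<beta> not_EXT_if_compressible[OF assms(1) compressible_one[OF \<alpha>0]] by auto
      next
        case False
        then have k: "2 \<le> k" using assms(2) by simp
        define \<beta>' where "\<beta>' = real k * \<alpha> / (1 + (real k - 1) * \<alpha>)"
        have den: "0 < 1 + (real k - 1) * \<alpha>" using \<alpha> k by (intro add_pos_nonneg) auto
        have \<beta>'_le: "\<beta>' \<le> \<beta>" using neg k unfolding \<beta>'_def by auto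
        have \<beta>'0: "0 < \<beta>'" unfolding \<beta>'_def using k \<alpha>0 den by simp
        \<comment> \<open>At \<open>\<alpha> = 1\<close> the critical value is \<open>1\<close>,
          which leaves only the corner \<open>(1, 1)\<close>, ruled out by
          \<open>neg\<close>.\<close>
        have "\<alpha> \<noteq> 1"
        proof
          assume "\<alpha> = 1"
          then have "\<beta>' = 1" unfolding \<beta>'_def using k by simp
          then show False using neg \<open>\<alpha> = 1\<close> \<beta>'_le \<beta> k by auto
        qed
        then have \<alpha>1: "\<alpha> < 1" using \<alpha> by simp
        have "\<beta>' * (1 + (real k - 1) * \<alpha>) = k * \<alpha>" unfolding \<beta>'_def using den by simp
        from compressible_critical[OF \<alpha>0 \<alpha>1 k this] have "(\<alpha>, \<beta>') \<notin> EXT U k"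
          using \<beta>'0 \<beta>'_le \<beta> \<alpha> by (intro not_EXT_if_compressible[OF assms(1)]) auto
        moreover have "(\<alpha>, \<beta>') \<in> EXT U k" using L \<alpha> \<beta>'0 \<beta>'_le by (intro EXT_mono[OF L]) auto
        ultimately show False by simp
      qed
    qed
  qed
qed

end
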